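(* Let $M$ be $\mathbb R^2$, $\mathbb S^2$ or $\mathbb H^2$, let $P\subset M$ be a connected geodesic polygon, let $x\in P$ be arbitrary, and let $\exp_P^x:E_xP\to P$ be the (billiard) exponential mapping. The pull-back by $\exp_P^x$ of the Lebesgue (Riemannian area) measure on $P$ to $E_xP$ is the smooth measure with the following density $d\nu(t,\theta)$ in polar coordinates $(t,\theta)$: 1. if $M=\mathbb R^2$, then $d\nu=t\,dt\,d\theta$; 2. if $M=\mathbb H^2$, then $d\nu=\sinh t\,dt\,d\theta$; 3. if $M=\mathbb S^2$, then $d\nu=|\sin t|\,dt\,d\theta$.
   Context: The metric of $M$ is normalized to have curvature $0$, $1$ or $-1$. A geodesic polygon is a compact region bounded by finitely many geodesic sides. For $x\in P$, $T_xP$ denotes the set of unit tangent vectors of $M$ at $x$ directed into $P$, with angular coordinate $\theta$, and $E_xP=T_xP\times\mathbb R_+$ is the full tangent cone at $x$ with polar coordinates $(t,\theta)$. $\exp_P^x(v,t)$ is the position at time $t$ of the unit-speed billiard orbit in $P$ (geodesic motion with optical reflection at the sides) starting at $x$ in direction $v$; it is defined on a subset of $E_xP$ of full Lebesgue measure (orbits are not continued past corners). The pull-back of a measure by such a piecewise smooth map between surfaces is understood in the sense of the change of variables formula, i.e. its density is the absolute value of the Jacobian.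
   Formalization: For M=S^2 the density is |sin t| where exp is defined and 0 elsewhere, and equals |sin t| on all of E_xP for x outside a countable subset of P; as stated it fails, e.g. for a lune with corners x and -x, where all orbits from x stop at time pi. *)

theory Defs
  imports "HOL-Analysis.Analysis"
begin

text \<open>
  The three model surfaces are embedded in a vector space in such a way that the Riemannian
  metric is the restriction to tangent vectors of one fixed bilinear form. The component
  \<open>geod G x v t\<close> is the position at time \<open>t\<close> of the unit-speed geodesic with initial point \<open>x\<close>
  and initial unit tangent vector \<open>v\<close>.
\<close>

record 'a surface =
  pts :: "'a set"
  tangent :: "'a \<Rightarrow> 'a set"
  metric_form :: "'a \<Rightarrow> 'a \<Rightarrow> real"
  geod :: "'a \<Rightarrow> 'a \<Rightarrow> real \<Rightarrow> 'a"

definition euclidean_plane :: "(real ^ 2) surface" where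
  "euclidean_plane = \<lparr> pts = UNIV, tangent = (\<lambda>x. UNIV), metric_form = (\<lambda>u v. u \<bullet> v),
     geod = (\<lambda>x v t. x + t *\<^sub>R v) \<rparr>"

definition unit_sphere :: "(real ^ 3) surface" where
  "unit_sphere = \<lparr> pts = sphere 0 1, tangent = (\<lambda>x. {v. x \<bullet> v = 0}),
     metric_form = (\<lambda>u v. u \<bullet> v),
     geod = (\<lambda>x v t. cos t *\<^sub>R x + sin t *\<^sub>R v) \<rparr>"

text \<open>The hyperbolic plane of curvature \<open>-1\<close> in the hyperboloid model.\<close>

definition lorentz :: "real ^ 3 \<Rightarrow> real ^ 3 \<Rightarrow> real" where
  "lorentz u v = u $ 1 * v $ 1 + u $ 2 * v $ 2 - u $ 3 * v $ 3"

definition hyperbolic_plane :: "(real ^ 3) surface" where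
  "hyperbolic_plane = \<lparr> pts = {x. lorentz x x = -1 \<and> x $ 3 > 0},
     tangent = (\<lambda>x. {v. lorentz x v = 0}), metric_form = lorentz,
     geod = (\<lambda>x v t. cosh t *\<^sub>R x + sinh t *\<^sub>R v) \<rparr>"

definition unit_tangent :: "('a, 'b) surface_scheme \<Rightarrow> 'a \<Rightarrow> 'a set" where
  "unit_tangent G x = {v \<in> tangent G x. metric_form G v v = 1}"

definition orthonormal_frame :: "('a, 'b) surface_scheme \<Rightarrow> 'a \<Rightarrow> 'a \<Rightarrow> 'a \<Rightarrow> bool" where
  "orthonormal_frame G x e1 e2 \<longleftrightarrow>
     e1 \<in> unit_tangent G x \<and> e2 \<in> unit_tangent G x \<and> metric_form G e1 e2 = 0"


text \<open>
  A side is a triple \<open>(p, u, l)\<close>: the geodesic arc of length \<open>l\<close> that starts at \<open>p\<close> in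
  direction \<open>u\<close>. Injectivity on the half-open interval only says that an arc on the sphere
  does not run over itself; its length is at most \<open>2 * pi\<close>.
\<close>

type_synonym 'a side = "'a \<times> 'a \<times> real"

definition is_side :: "('a, 'b) surface_scheme \<Rightarrow> 'a side \<Rightarrow> bool" where
  "is_side G = (\<lambda>(p, u, l). p \<in> pts G \<and> u \<in> unit_tangent G p \<and> l > 0 \<and>
     inj_on (geod G p u) {0..<l})"

definition side_set :: "('a, 'b) surface_scheme \<Rightarrow> 'a side \<Rightarrow> 'a set" where
  "side_set G = (\<lambda>(p, u, l). geod G p u ` {0..l})"

definition side_ends :: "('a, 'b) surface_scheme \<Rightarrow> 'a side \<Rightarrow> 'a set" where
  "side_ends G = (\<lambda>(p, u, l). {p, geod G p u l})"

definition rel_interior_of :: "('a :: topological_space, 'b) surface_scheme \<Rightarrow> 'a set \<Rightarrow> 'a set" where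
  "rel_interior_of G P = top_of_set (pts G) interior_of P"

text \<open>
  \<open>P\<close> is a compact region, that is, the closure of its interior, whose boundary consists of the
  finitely many sides in \<open>S\<close>. The sides meet only in end points; the end points of the sides
  are the corners. Neither \<open>P\<close> nor its boundary is assumed to be connected, and corners with
  angle \<open>pi\<close> are allowed.
\<close>

definition geodesic_polygon ::
    "('a :: topological_space, 'b) surface_scheme \<Rightarrow> 'a set \<Rightarrow> 'a side set \<Rightarrow> bool" where
  "geodesic_polygon G P S \<longleftrightarrow>
     P \<subseteq> pts G \<and> compact P \<and>
     top_of_set (pts G) closure_of (rel_interior_of G P) = P \<and>
     finite S \<and> (\<forall>\<sigma>\<in>S. is_side G \<sigma>) \<and>
     top_of_set (pts G) frontier_of P = (\<Union>\<sigma>\<in>S. side_set G \<sigma>) \<and>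
     (\<forall>\<sigma>\<in>S. \<forall>\<tau>\<in>S. \<sigma> \<noteq> \<tau> \<longrightarrow>
        side_set G \<sigma> \<inter> side_set G \<tau> \<subseteq> side_ends G \<sigma> \<inter> side_ends G \<tau>)"


text \<open>Optical reflection in a line with unit direction \<open>e\<close>: the component of the velocity along
  \<open>e\<close> is kept and the normal component changes sign.\<close>

definition reflect_along ::
    "('a :: real_vector, 'b) surface_scheme \<Rightarrow> 'a \<Rightarrow> 'a \<Rightarrow> 'a" where
  "reflect_along G e w = (2 * metric_form G w e) *\<^sub>R e - w"

text \<open>
  \<open>bounce G P S x v t y w\<close>: the billiard orbit that starts at \<open>x\<close> in direction \<open>v\<close> leaves the
  point \<open>y\<close> at time \<open>t\<close> with velocity \<open>w\<close>, where \<open>t = 0\<close> or \<open>t\<close> is the time of a reflection.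
  A reflection takes place only at a point of a side that is not one of its end points, hence
  the orbit stops when it reaches a corner.
\<close>

inductive bounce ::
    "('a :: real_normed_vector, 'b) surface_scheme \<Rightarrow> 'a set \<Rightarrow> 'a side set \<Rightarrow> 'a \<Rightarrow> 'a \<Rightarrow>
     real \<Rightarrow> 'a \<Rightarrow> 'a \<Rightarrow> bool"
  for G P S x v where
  start: "bounce G P S x v 0 x v"
| reflect: "bounce G P S x v (t + r) (geod G y w r)
     (reflect_along G (vector_derivative (geod G p u) (at s))
                      (vector_derivative (geod G y w) (at r)))"
  if "bounce G P S x v t y w" and "r > 0"
    and "\<forall>q. 0 < q \<and> q < r \<longrightarrow> geod G y w q \<in> rel_interior_of G P"
    and "(p, u, l) \<in> S" and "0 < s" and "s < l"
    and "geod G y w r = geod G p u s"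

text \<open>The billiard orbit of \<open>(x, v)\<close> is defined up to time \<open>t > 0\<close> and is at \<open>z\<close> at time \<open>t\<close>.\<close>

definition billiard_at ::
    "('a :: real_normed_vector, 'b) surface_scheme \<Rightarrow> 'a set \<Rightarrow> 'a side set \<Rightarrow> 'a \<Rightarrow> 'a \<Rightarrow>
     real \<Rightarrow> 'a \<Rightarrow> bool" where
  "billiard_at G P S x v t z \<longleftrightarrow>
     (\<exists>t0 y w. bounce G P S x v t0 y w \<and> t0 < t \<and>
        (\<forall>q. 0 < q \<and> q < t - t0 \<longrightarrow> geod G y w q \<in> rel_interior_of G P) \<and>
        z = geod G y w (t - t0))"


definition dirs_into ::
    "('a :: topological_space, 'b) surface_scheme \<Rightarrow> 'a set \<Rightarrow> 'a \<Rightarrow> 'a set" where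
  "dirs_into G P x = {v \<in> unit_tangent G x.
     \<exists>\<epsilon>>0. \<forall>q. 0 < q \<and> q < \<epsilon> \<longrightarrow> geod G x v q \<in> rel_interior_of G P}"

definition dir :: "'a :: real_vector \<Rightarrow> 'a \<Rightarrow> real \<Rightarrow> 'a" where
  "dir e1 e2 \<theta> = cos \<theta> *\<^sub>R e1 + sin \<theta> *\<^sub>R e2"

text \<open>The tangent cone of \<open>P\<close> at \<open>x\<close> in polar coordinates \<open>(t, \<theta>)\<close> with respect to an orthonormal
  frame \<open>e1\<close>, \<open>e2\<close> at \<open>x\<close>.\<close>

definition tangent_cone ::
    "('a :: real_normed_vector, 'b) surface_scheme \<Rightarrow> 'a set \<Rightarrow> 'a \<Rightarrow> 'a \<Rightarrow> 'a \<Rightarrow> (real \<times> real) set" where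
  "tangent_cone G P x e1 e2 =
     {(t, \<theta>). t > 0 \<and> 0 \<le> \<theta> \<and> \<theta> < 2 * pi \<and> dir e1 e2 \<theta> \<in> dirs_into G P x}"

text \<open>
  In the plane and in the hyperbolic plane, \<open>billiard_domain\<close> has full measure in the tangent cone.
  On the sphere this fails for exceptional \<open>x\<close>, since all geodesics from \<open>x\<close> meet again at the
  antipode: in a lune with corners \<open>x\<close> and \<open>- x\<close>, every orbit from \<open>x\<close> stops at time \<open>pi\<close>.
\<close>

definition billiard_domain ::
    "('a :: real_normed_vector, 'b) surface_scheme \<Rightarrow> 'a set \<Rightarrow> 'a side set \<Rightarrow> 'a \<Rightarrow> 'a \<Rightarrow> 'a \<Rightarrow>
     (real \<times> real) set" where
  "billiard_domain G P S x e1 e2 =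
     {(t, \<theta>) \<in> tangent_cone G P x e1 e2. \<exists>z. billiard_at G P S x (dir e1 e2 \<theta>) t z}"

text \<open>The billiard exponential mapping; it is meaningful on \<open>billiard_domain\<close> only.\<close>

definition billiard_exp ::
    "('a :: real_normed_vector, 'b) surface_scheme \<Rightarrow> 'a set \<Rightarrow> 'a side set \<Rightarrow> 'a \<Rightarrow> 'a \<Rightarrow> 'a \<Rightarrow>
     real \<times> real \<Rightarrow> 'a" where
  "billiard_exp G P S x e1 e2 = (\<lambda>(t, \<theta>). THE z. billiard_at G P S x (dir e1 e2 \<theta>) t z)"


text \<open>
  The absolute value of the Jacobian of \<open>f\<close> at \<open>p\<close> with respect to the Riemannian area of \<open>G\<close> and
  the Lebesgue measure of the coordinate plane: the Riemannian area of the parallelogram spanned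
  by the two partial derivatives of \<open>f\<close>. This is the usual factor \<open>sqrt (det g)\<close> for the
  pulled-back metric \<open>g\<close>.
\<close>

definition area_jacobian ::
    "('a :: real_normed_vector, 'b) surface_scheme \<Rightarrow> (real \<times> real \<Rightarrow> 'a) \<Rightarrow> real \<times> real \<Rightarrow> real" where
  "area_jacobian G f p =
     (let a = frechet_derivative f (at p) (1, 0); b = frechet_derivative f (at p) (0, 1)
      in sqrt (metric_form G a a * metric_form G b b - (metric_form G a b)\<^sup>2))"

text \<open>
  The pull-back, in the sense of the change of variables formula, of the Riemannian area by a map
  \<open>f\<close> with domain \<open>D\<close>, as a measure on \<open>E\<close>.
\<close>

definition pullback_area ::
    "('a :: real_normed_vector, 'b) surface_scheme \<Rightarrow> (real \<times> real) set \<Rightarrow> (real \<times> real) set \<Rightarrow>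
     (real \<times> real \<Rightarrow> 'a) \<Rightarrow> (real \<times> real) measure" where
  "pullback_area G E D f =
     density (lebesgue_on E) (\<lambda>p. ennreal (area_jacobian G f p) * indicator D p)"

text \<open>\<open>f\<close> is differentiable almost everywhere on its domain \<open>D\<close>.\<close>

definition ae_differentiable_on ::
    "(real \<times> real \<Rightarrow> 'a :: real_normed_vector) \<Rightarrow> (real \<times> real) set \<Rightarrow> bool" where
  "ae_differentiable_on f D \<longleftrightarrow> (AE p in lebesgue. p \<in> D \<longrightarrow> f differentiable (at p))"

definition billiard_pullback ::
    "('a :: real_normed_vector, 'b) surface_scheme \<Rightarrow> 'a set \<Rightarrow> 'a side set \<Rightarrow> 'a \<Rightarrow> 'a \<Rightarrow> 'a \<Rightarrow>
     (real \<times> real) measure" where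
  "billiard_pullback G P S x e1 e2 =
     pullback_area G (tangent_cone G P x e1 e2) (billiard_domain G P S x e1 e2)
       (billiard_exp G P S x e1 e2)"

end

theory Submission
  imports Defs
begin

text \<open>
  Reflection in a side is the restriction of an isometry of the surface. Unfolding the orbit of
  \<open>(x, v)\<close> along the list of sides hit so far shows that the billiard exponential map is, away
  from the reflection times, locally the composition of the exponential map of the surface at \<open>x\<close>
  with an isometry, so its Jacobian is the one of geodesic polar coordinates. The exceptional
  directions solve one of countably many equations \<open>a cos \<theta> + b sin \<theta> = 0\<close>, one for each
  unfolded side or corner. The orbit in any other direction hits all sides transversally and never
  reaches a corner. Its reflection times cannot accumulate either, because the unfolded orbit would
  then converge to an unfolded corner. On the sphere, an unfolded corner at \<open>x\<close> or \<open>- x\<close> is met in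
  every direction, which rules out countably many \<open>x\<close>.

  The three surfaces are treated together: with \<open>k\<close> the curvature and \<open>sn'' = - k sn\<close>,
  \<open>sn 0 = 0\<close>, \<open>sn' = cs\<close>, \<open>cs 0 = 1\<close>, geodesics have the form \<open>cs t y + sn t v\<close>.
\<close>

text \<open>The Jacobian is a Frechet derivative, so following a single orbit is not enough: all
  directions near a given one must hit the same sides in the same order. The delicate moment is just
  after a reflection, when the orbit is arbitrarily close to the side it has left and compactness
  alone cannot keep its neighbours off the boundary. Hence the notion \<open>stable\<close> carries,
  besides nearby reflection times, a span of time independent of the direction during which the
  boundary is not met; transversality supplies it. The start needs the same care, since
  \<open>x\<close> may lie on a side or at a corner.

  Exceptional directions are described by whole lines and arbitrary words of sides instead of actual
  itineraries, which leaves explicit equations to solve.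

  Two cases strain the common treatment. Motions of the plane are affine, and the linear identities
  survive there because \<open>cs\<close> is constantly 1. On the hyperboloid the form is indefinite
  and reflections distort the ambient norm, so estimates rest on compactness of \<open>P\<close> and
  limits are compared through the form.\<close>

section \<open>Zero sets, neighbourhoods and null sets\<close>

lemma countable_zeros_of_combination:
  fixes c s :: "real \<Rightarrow> real"
  assumes diff: "\<And>t u. s (t - u) = s t * c u - c t * s u"
    and zeros: "countable {t. s t = 0}" and ab: "a \<noteq> 0 \<or> b \<noteq> 0"
  shows "countable {t. a * c t + b * s t = 0}"
proof (cases "\<exists>u. a * c u + b * s u = 0")
  case True
  then obtain u where u: "a * c u + b * s u = 0" by blast
  \<comment> \<open>Two zeros \<open>t\<close> and \<open>u\<close> make a homogeneous system for
    \<open>(a, b)\<close> singular, and its determinant is \<open>s (t - u)\<close> up to sign. So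
    all zeros lie in one translate of the zeros of \<open>s\<close>.\<close>
  have "s (t - u) = 0" if t: "a * c t + b * s t = 0" for t
  proof -
    have "a * s (t - u) = s t * (a * c u + b * s u) - s u * (a * c t + b * s t)"
      "b * s (t - u) = c u * (a * c t + b * s t) - c t * (a * c u + b * s u)"
      unfolding diff by (simp_all add: algebra_simps)
    then have "a * s (t - u) = 0" "b * s (t - u) = 0" using u t by simp_all
    then show ?thesis using ab by auto
  qed
  then have "{t. a * c t + b * s t = 0} \<subseteq> (\<lambda>t. t + u) ` {t. s t = 0}"
    by (auto simp: image_iff) (metis diff_add_cancel)
  then show ?thesis by (rule countable_subset) (simp add: zeros)
next
  case False
  then show ?thesis by simp
qed

lemma countable_sin_zeros: "countable {t :: real. sin t = 0}"
proof (rule countable_subset)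
  show "{t :: real. sin t = 0} \<subseteq> range (\<lambda>i. real_of_int i * pi)"
    by (auto simp: sin_zero_iff_int2)
qed simp

lemma countable_trig_zeros:
  assumes "a \<noteq> 0 \<or> b \<noteq> 0" shows "countable {t. a * cos t + b * sin t = (0 :: real)}"
  using assms countable_sin_zeros by (intro countable_zeros_of_combination) (auto simp: sin_diff)

lemma eventually_nhds_realpair:
  fixes a b :: real
  assumes "eventually Q (nhds (a, b))"
  obtains d where "d > 0" "\<And>s t. \<bar>s - a\<bar> < d \<Longrightarrow> \<bar>t - b\<bar> < d \<Longrightarrow> Q (s, t)"
proof -
  obtain d where d: "d > 0" "\<And>p. dist p (a, b) < d \<Longrightarrow> Q p"
    using assms by (auto simp: eventually_nhds_metric)
  have "Q (s, t)" if "\<bar>s - a\<bar> < d / 2" "\<bar>t - b\<bar> < d / 2" for s t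
  proof (rule d(2))
    have "dist (s, t) (a, b) \<le> dist s a + dist t b"
      unfolding dist_Pair_Pair by (rule sqrt_sum_squares_le_sum) auto
    then show "dist (s, t) (a, b) < d" using that by (simp add: dist_real_def)
  qed
  then show ?thesis using that[of "d / 2"] d(1) by auto
qed

lemma sign_change_root:
  fixes f :: "real \<Rightarrow> real"
  assumes "continuous_on {a..b} f" "f a * f b < 0" "a < b"
  obtains c where "a < c" "c < b" "f c = 0"
proof -
  have "\<exists>c. a \<le> c \<and> c \<le> b \<and> f c = 0"
    using IVT'[of f a 0 b] IVT2'[of f b 0 a] assms by (auto simp: mult_less_0_iff)
  then obtain c where "a \<le> c" "c \<le> b" "f c = 0" by blast
  moreover from this have "c \<noteq> a" "c \<noteq> b" using assms(2) by auto
  ultimately show ?thesis using that[of c] by auto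
qed

text \<open>Fubini with slices at a fixed angle. The angle is the second coordinate while the
  product rule slices at the first, hence the exchange of the two quantifiers.\<close>

lemma AE_lborel_pairI:
  assumes "Measurable.pred borel Q" "AE \<theta> in lborel. AE t in lborel. Q (t, \<theta>)"
  shows "AE p in lborel. Q (p :: real \<times> real)"
proof -
  have m: "{p \<in> space (lborel \<Otimes>\<^sub>M lborel). Q p} \<in> sets (lborel \<Otimes>\<^sub>M lborel)"
    using assms(1) unfolding lborel_prod by (simp add: pred_def)
  then have "AE t in lborel. AE \<theta> in lborel. Q (t, \<theta>)"
    using lborel_pair.AE_commute[of "\<lambda>t \<theta>. Q (t, \<theta>)"] assms(2) by simp
  then have "AE p in lborel \<Otimes>\<^sub>M lborel. Q p"
    by (intro lborel_pair.AE_pair_measure[OF m])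
  then show ?thesis unfolding lborel_prod .
qed

lemma AE_angle:
  assumes "countable A" shows "AE p in lborel. snd (p :: real \<times> real) \<notin> A"
proof (rule AE_lborel_pairI)
  have "A \<in> sets borel" using assms by (rule sets.countable[rotated]) auto
  moreover have "snd \<in> borel_measurable (borel :: (real \<times> real) measure)"
    by (intro borel_measurable_continuous_onI continuous_on_snd continuous_on_id)
  ultimately have "snd -` (- A) \<in> sets (borel :: (real \<times> real) measure)"
    by (intro measurable_sets_borel) auto
  then show "Measurable.pred borel (\<lambda>p :: real \<times> real. snd p \<notin> A)" by (simp add: pred_def vimage_def)
  have "AE \<theta> in lborel. \<theta> \<notin> A"
    using countable_imp_null_set_lborel[OF assms] by (rule AE_not_in)
  then show "AE \<theta> in lborel. AE t in lborel. snd (t, \<theta>) \<notin> A" by eventually_elim simp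
qed

text \<open>A density is determined by integrals, which agree here for arbitrary functions. This
  suits the indicator of the billiard domain, whose measurability is not established.\<close>

lemma density_cong_AE: "AE p in M. f p = g p \<Longrightarrow> density M f = density M g"
proof -
  assume "AE p in M. f p = g p"
  then have "(\<integral>\<^sup>+ p. f p * indicator A p \<partial>M) = (\<integral>\<^sup>+ p. g p * indicator A p \<partial>M)" for A
    by (intro nn_integral_cong_AE) auto
  then show ?thesis by (simp add: density_def)
qed

section \<open>Geodesics and reflections\<close>

text \<open>The factor \<open>k\<close> switches conditions off in the plane: for
  \<open>k = 0\<close> every vector is tangent and points satisfy no equation, otherwise tangency is
  orthogonality to the position and \<open>metric_form G y y = k\<close>. \<open>nv\<close> picks
  one of the two unit normals. \<open>definite\<close> and \<open>norm_unit_tangent\<close> make up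
  for the indefinite Lorentz form: distinct points are never at null distance, and the base point
  controls the ambient norm of a unit tangent vector.\<close>

locale space_form =
  fixes G :: "('a :: euclidean_space) surface"
    and k :: real and cs sn :: "real \<Rightarrow> real"
    and nv :: "'a \<Rightarrow> 'a \<Rightarrow> 'a"
  assumes curvature:
      "k = 0 \<and> cs = (\<lambda>t. 1) \<and> sn = (\<lambda>t. t) \<or> k = 1 \<and> cs = cos \<and> sn = sin \<or>
       k = -1 \<and> cs = cosh \<and> sn = sinh"
    and bilinear_form: "bounded_bilinear (metric_form G)"
    and form_sym: "metric_form G u v = metric_form G v u"
    and tangent_iff: "v \<in> tangent G y \<longleftrightarrow> k * metric_form G y v = 0"
    and form_pts: "y \<in> pts G \<Longrightarrow> k * metric_form G y y = k\<^sup>2"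
    and geod_eq: "geod G y v t = cs t *\<^sub>R y + sn t *\<^sub>R v"
    and geod_pts: "y \<in> pts G \<Longrightarrow> v \<in> unit_tangent G y \<Longrightarrow> geod G y v t \<in> pts G"
    and nv: "y \<in> pts G \<Longrightarrow> v \<in> unit_tangent G y \<Longrightarrow> orthonormal_frame G y v (nv y v)"
    and nv_basis: "y \<in> pts G \<Longrightarrow> v \<in> unit_tangent G y \<Longrightarrow> w \<in> tangent G y \<Longrightarrow>
        w = metric_form G w v *\<^sub>R v + metric_form G w (nv y v) *\<^sub>R nv y v"
    and definite: "y \<in> pts G \<Longrightarrow> z \<in> pts G \<Longrightarrow> metric_form G (y - z) (y - z) = 0 \<Longrightarrow> y = z"
    and norm_unit_tangent: "y \<in> pts G \<Longrightarrow> v \<in> unit_tangent G y \<Longrightarrow> norm v \<le> 1 + 2 * norm y"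
begin

abbreviation B where "B \<equiv> metric_form G"

sublocale B: bounded_bilinear B by (rule bilinear_form)

lemmas B_simps = B.add_left B.add_right B.diff_left B.diff_right B.scaleR_left B.scaleR_right
  B.minus_left B.minus_right

lemma cs_sn_basics [simp]: "cs 0 = 1" "sn 0 = 0" "sn (- t) = - sn t" "cs (- t) = cs t"
  using curvature by auto

lemma cs_add: "cs (s + t) = cs s * cs t - k * (sn s * sn t)"
  using curvature by (auto simp: cos_add cosh_add)

lemma sn_add: "sn (s + t) = sn s * cs t + cs s * sn t"
  using curvature by (auto simp: sin_add sinh_add)

lemma cs_sn_pythagoras: "cs t * cs t + k * (sn t * sn t) = 1"
  using cs_add[of t "-t"] by simp

lemma has_derivative_cs: "(cs has_real_derivative (- k * sn t)) (at t within A)"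
  and has_derivative_sn: "(sn has_real_derivative cs t) (at t within A)"
  using curvature by (auto intro!: derivative_eq_intros)

lemma continuous_cs_sn [continuous_intros]:
  assumes "continuous_on A f"
  shows "continuous_on A (\<lambda>x. cs (f x))" "continuous_on A (\<lambda>x. sn (f x))"
proof -
  have "continuous_on UNIV cs" "continuous_on UNIV sn"
    by (rule DERIV_continuous_on, rule has_derivative_cs)
       (rule DERIV_continuous_on, rule has_derivative_sn)
  then show "continuous_on A (\<lambda>x. cs (f x))" "continuous_on A (\<lambda>x. sn (f x))"
    using assms by (auto intro: continuous_on_compose2)
qed

text \<open>On the sphere the first positive zero is \<open>pi\<close>; 1 is a convenient bound
  below it and recurs as the length of short time windows.\<close>

lemma sn_pos: assumes "0 < t" "t < 1 \<or> k \<le> 0" shows "sn t > 0"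
  using curvature assms pi_gt3 by (auto intro: sin_gt_zero)

lemma sn_nonzero: assumes "0 < \<bar>t\<bar>" "\<bar>t\<bar> < 1 \<or> k \<le> 0" shows "sn t \<noteq> 0"
  using sn_pos[of "\<bar>t\<bar>"] assms by (auto simp: abs_if split: if_splits)

lemma cs_eq_1: "k = 0 \<Longrightarrow> cs t = 1"
  using curvature by auto

lemma countable_sn_zeros: "countable {t. sn t = 0}"
proof -
  consider "sn = (\<lambda>t. t)" | "sn = sin" | "sn = sinh" using curvature by blast
  then show ?thesis
  proof cases
    case 2
    then show ?thesis by (simp add: countable_sin_zeros)
  qed auto
qed

lemma countable_zeros:
  assumes "a \<noteq> 0 \<or> b \<noteq> 0" shows "countable {t. a * cs t + b * sn t = 0}"
  using assms countable_sn_zeros sn_add[of _ "- _"]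
  by (intro countable_zeros_of_combination) auto

lemma unit_tangentD:
  assumes "v \<in> unit_tangent G y" shows "B v v = 1" "k * B y v = 0" "k * B v y = 0" "v \<in> tangent G y"
  using assms by (auto simp: unit_tangent_def tangent_iff form_sym)

lemma unit_tangentI: "B v v = 1 \<Longrightarrow> k * B y v = 0 \<Longrightarrow> v \<in> unit_tangent G y"
  by (auto simp: unit_tangent_def tangent_iff)

lemma form_pts_cases: assumes "y \<in> pts G" shows "k = 0 \<or> B y y = k \<and> k * k = 1"
  using form_pts[OF assms] curvature by (auto simp: power2_eq_square)

text \<open>\<open>nv_basis\<close> covers only the chosen normal. Any other unit normal is
  \<open>c\<close> times it with \<open>c * c = 1\<close>, and the sign cancels because it enters
  twice.\<close>

lemma orthonormal_basis:
  assumes y: "y \<in> pts G" and f: "orthonormal_frame G y e n" and w: "w \<in> tangent G y"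
  shows "w = B w e *\<^sub>R e + B w n *\<^sub>R n"
proof -
  have e: "e \<in> unit_tangent G y" and n: "n \<in> unit_tangent G y" and en: "B e n = 0"
    using f by (auto simp: orthonormal_frame_def)
  define m c where "m = nv y e" and "c = B n m"
  have "n = B n e *\<^sub>R e + B n m *\<^sub>R m"
    unfolding m_def using nv_basis[OF y e] n by (auto dest: unit_tangentD)
  then have nm: "n = c *\<^sub>R m" using en by (simp add: c_def form_sym)
  then have "B n n = c * c * B m m" by (metis B.scaleR_left B.scaleR_right mult.assoc real_scaleR_def)
  then have "c * c = 1"
    using nv[OF y e] unit_tangentD(1)[OF n] unit_tangentD(1)[of m y]
    by (simp add: m_def orthonormal_frame_def)
  then have "B w n *\<^sub>R n = B w m *\<^sub>R m" by (simp add: nm B_simps)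
  then show ?thesis using nv_basis[OF y e w] by (simp add: m_def)
qed

section \<open>Velocity and the geodesic flow\<close>

definition gvel :: "'a \<Rightarrow> 'a \<Rightarrow> real \<Rightarrow> 'a" where
  "gvel y v t = (- k * sn t) *\<^sub>R y + cs t *\<^sub>R v"

lemma geod_0 [simp]: "geod G y v 0 = y" and gvel_0 [simp]: "gvel y v 0 = v"
  by (simp_all add: geod_eq gvel_def)

lemma vector_derivative_geod [simp]: "vector_derivative (geod G y v) (at t) = gvel y v t"
proof (rule vector_derivative_at)
  have "((\<lambda>t. cs t *\<^sub>R y + sn t *\<^sub>R v) has_vector_derivative gvel y v t) (at t)"
    unfolding gvel_def
    using has_derivative_cs[of t UNIV] has_derivative_sn[of t UNIV]
    by (auto intro!: derivative_eq_intros simp: has_real_derivative_iff_has_vector_derivative[symmetric])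
  then show "(geod G y v has_vector_derivative gvel y v t) (at t)"
    by (simp add: geod_eq[abs_def])
qed

lemma geod_add: "geod G (geod G y v s) (gvel y v s) t = geod G y v (s + t)"
  by (simp add: geod_eq gvel_def cs_add sn_add algebra_simps)

lemma gvel_add: "gvel (geod G y v s) (gvel y v s) t = gvel y v (s + t)"
  by (simp add: geod_eq gvel_def cs_add sn_add algebra_simps)

lemma geod_minus: "geod G y (- v) t = geod G y v (- t)"
  by (simp add: geod_eq)

lemma gvel_unit_tangent:
  assumes y: "y \<in> pts G" and v: "v \<in> unit_tangent G y"
  shows "gvel y v t \<in> unit_tangent G (geod G y v t)"
proof (rule unit_tangentI)
  have kk: "k * (k * B y y) = k"
    using form_pts_cases[OF y] by auto
  have "B (gvel y v t) (gvel y v t) =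
      k * (k * B y y) * (sn t * sn t) - 2 * (k * B y v) * (sn t * cs t) + cs t * cs t * B v v"
    by (simp add: gvel_def B_simps form_sym[of v y] algebra_simps)
  also note kk
  finally show "B (gvel y v t) (gvel y v t) = 1"
    using cs_sn_pythagoras[of t] unit_tangentD[OF v] by (simp add: ac_simps)
  show "k * B (geod G y v t) (gvel y v t) = 0"
  proof -
    have "k * B (geod G y v t) (gvel y v t) = sn t * cs t * (k * B v v - k * (k * B y y))
        + (cs t * cs t - k * (sn t * sn t)) * (k * B y v)"
      by (simp add: geod_eq gvel_def B_simps form_sym[of v y] algebra_simps)
    also have "\<dots> = 0" by (simp only: kk unit_tangentD(1,2)[OF v]) simp
    finally show ?thesis .
  qed
qed

section \<open>Sides as mirrors\<close>

definition normal :: "'a side \<Rightarrow> 'a" where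
  "normal = (\<lambda>(p, u, l). nv p u)"

text \<open>Vanishes on the line that carries the side. For \<open>k \<noteq> 0\<close> the
  subtracted constant is 0 and a linear functional cuts out the line; in the plane the constant is
  the offset of the line and this is the signed distance.\<close>

definition height :: "'a side \<Rightarrow> 'a \<Rightarrow> real" where
  "height \<sigma> y = B y (normal \<sigma>) - B (fst \<sigma>) (normal \<sigma>)"

definition mirror :: "'a side \<Rightarrow> 'a \<Rightarrow> 'a" where
  "mirror \<sigma> y = y - (2 * height \<sigma> y) *\<^sub>R normal \<sigma>"

definition mirror_lin :: "'a side \<Rightarrow> 'a \<Rightarrow> 'a" where
  "mirror_lin \<sigma> v = v - (2 * B v (normal \<sigma>)) *\<^sub>R normal \<sigma>"

lemma side_normal:
  assumes "is_side G \<sigma>"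
  shows "B (normal \<sigma>) (normal \<sigma>) = 1" "k * B (fst \<sigma>) (normal \<sigma>) = 0"
    "B (fst (snd \<sigma>)) (normal \<sigma>) = 0"
proof -
  obtain p u l where \<sigma>: "\<sigma> = (p, u, l)" by (cases \<sigma>)
  have "orthonormal_frame G p u (nv p u)"
    using assms by (intro nv) (auto simp: \<sigma> is_side_def)
  then show "B (normal \<sigma>) (normal \<sigma>) = 1" "k * B (fst \<sigma>) (normal \<sigma>) = 0"
    "B (fst (snd \<sigma>)) (normal \<sigma>) = 0"
    by (simp_all add: \<sigma> normal_def orthonormal_frame_def unit_tangent_def tangent_iff)
qed

lemma normal_const: "is_side G \<sigma> \<Longrightarrow> k = 0 \<or> B (fst \<sigma>) (normal \<sigma>) = 0"
  using side_normal(2) by auto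

text \<open>In the plane \<open>height\<close> is only affine, but there the coefficient
  \<open>cs t\<close> is 1, so the constant is subtracted exactly once.\<close>

lemma height_comb:
  assumes "is_side G \<sigma>"
  shows "height \<sigma> (cs t *\<^sub>R a + sn t *\<^sub>R b) = cs t * height \<sigma> a + sn t * B b (normal \<sigma>)"
  using normal_const[OF assms] cs_eq_1[of t] by (auto simp: height_def B_simps algebra_simps)

lemma height_geod:
  assumes "is_side G \<sigma>"
  shows "height \<sigma> (geod G y v t) = cs t * height \<sigma> y + sn t * B v (normal \<sigma>)"
  by (simp add: geod_eq height_comb[OF assms])

lemma height_side:
  assumes "is_side G (p, u, l)" shows "height (p, u, l) (geod G p u s) = 0"
  using height_geod[OF assms, of p u s] side_normal[OF assms] by (simp add: height_def)

lemma height_side_set: "is_side G \<sigma> \<Longrightarrow> y \<in> side_set G \<sigma> \<Longrightarrow> height \<sigma> y = 0"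
  by (cases \<sigma>) (auto simp: side_set_def height_side)

lemma mirror_fixed: "height \<sigma> y = 0 \<Longrightarrow> mirror \<sigma> y = y"
  by (simp add: mirror_def)

lemma mirror_comb:
  assumes "is_side G \<sigma>"
  shows "mirror \<sigma> (cs t *\<^sub>R a + sn t *\<^sub>R b) = cs t *\<^sub>R mirror \<sigma> a + sn t *\<^sub>R mirror_lin \<sigma> b"
  unfolding mirror_def mirror_lin_def height_comb[OF assms] by (simp add: algebra_simps)

lemma mirror_mirror:
  assumes "is_side G \<sigma>" shows "mirror \<sigma> (mirror \<sigma> y) = y"
proof -
  have "height \<sigma> (mirror \<sigma> y) = - height \<sigma> y"
    using side_normal(1)[OF assms] by (simp add: mirror_def height_def B_simps)
  then show ?thesis by (simp add: mirror_def)
qed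

lemma mirror_lin_mirror_lin: assumes "is_side G \<sigma>" shows "mirror_lin \<sigma> (mirror_lin \<sigma> y) = y"
  using side_normal(1)[OF assms] by (simp add: mirror_lin_def B_simps)

lemma mirror_diff: "mirror \<sigma> a - mirror \<sigma> b = mirror_lin \<sigma> (a - b)"
  by (simp add: mirror_def mirror_lin_def height_def B_simps algebra_simps)

lemma mirror_lin_self_adjoint: "B (mirror_lin \<sigma> a) b = B a (mirror_lin \<sigma> b)"
  by (simp add: mirror_lin_def B_simps form_sym)

lemma mirror_lin_form: assumes "is_side G \<sigma>" shows "B (mirror_lin \<sigma> a) (mirror_lin \<sigma> b) = B a b"
  by (simp add: mirror_lin_self_adjoint mirror_lin_mirror_lin[OF assms])

lemma mirror_eq_mirror_lin: "is_side G \<sigma> \<Longrightarrow> k \<noteq> 0 \<Longrightarrow> mirror \<sigma> = mirror_lin \<sigma>"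
  using normal_const by (auto simp: mirror_def mirror_lin_def height_def fun_eq_iff)

lemma mirror_lin_add: "mirror_lin \<sigma> (a + b) = mirror_lin \<sigma> a + mirror_lin \<sigma> b"
  and mirror_lin_scaleR: "mirror_lin \<sigma> (c *\<^sub>R a) = c *\<^sub>R mirror_lin \<sigma> a"
  by (simp_all add: mirror_lin_def B_simps algebra_simps)

text \<open>The head of a list is the reflection applied last: it is the side hit last.\<close>

definition unfolding_map :: "'a side list \<Rightarrow> 'a \<Rightarrow> 'a" where
  "unfolding_map = foldr mirror"

definition unfolding_lin :: "'a side list \<Rightarrow> 'a \<Rightarrow> 'a" where
  "unfolding_lin = foldr mirror_lin"

text \<open>Mirrors are involutions, so the inverse applies them in the opposite order:
  \<open>fold\<close> in place of \<open>foldr\<close>.\<close>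

definition unfolding_inv :: "'a side list \<Rightarrow> 'a \<Rightarrow> 'a" where
  "unfolding_inv = fold mirror"

text \<open>The adjoint of \<open>unfolding_lin\<close> for the form, as each
  \<open>mirror_lin\<close> is self-adjoint; it carries the normal of a side back to the starting
  point.\<close>

definition unfolding_adj :: "'a side list \<Rightarrow> 'a \<Rightarrow> 'a" where
  "unfolding_adj = fold mirror_lin"

lemma unfolding_simps [simp]:
  "unfolding_map [] y = y" "unfolding_map (\<sigma> # ws) y = mirror \<sigma> (unfolding_map ws y)"
  "unfolding_lin [] y = y" "unfolding_lin (\<sigma> # ws) y = mirror_lin \<sigma> (unfolding_lin ws y)"
  "unfolding_inv [] y = y" "unfolding_inv (\<sigma> # ws) y = unfolding_inv ws (mirror \<sigma> y)"
  "unfolding_adj [] y = y" "unfolding_adj (\<sigma> # ws) y = unfolding_adj ws (mirror_lin \<sigma> y)"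
  by (simp_all add: unfolding_map_def unfolding_lin_def unfolding_inv_def unfolding_adj_def)

abbreviation sides :: "'a side list \<Rightarrow> bool" where
  "sides ws \<equiv> \<forall>\<sigma>\<in>set ws. is_side G \<sigma>"

lemma unfolding_map_comb:
  "sides ws \<Longrightarrow> unfolding_map ws (cs t *\<^sub>R a + sn t *\<^sub>R b) =
     cs t *\<^sub>R unfolding_map ws a + sn t *\<^sub>R unfolding_lin ws b"
  by (induction ws) (auto simp: mirror_comb)

lemma unfolding_map_inv: "sides ws \<Longrightarrow> unfolding_map ws (unfolding_inv ws y) = y"
  by (induction ws arbitrary: y) (auto simp: mirror_mirror)

lemma unfolding_inv_map: "sides ws \<Longrightarrow> unfolding_inv ws (unfolding_map ws y) = y"
  by (induction ws arbitrary: y) (auto simp: mirror_mirror)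

lemma unfolding_map_diff: "unfolding_map ws a - unfolding_map ws b = unfolding_lin ws (a - b)"
  by (induction ws) (auto simp: mirror_diff)

lemma unfolding_lin_form: "sides ws \<Longrightarrow> B (unfolding_lin ws a) (unfolding_lin ws b) = B a b"
  by (induction ws) (auto simp: mirror_lin_form)

lemma unfolding_adj_form: "sides ws \<Longrightarrow> B (unfolding_adj ws a) (unfolding_adj ws b) = B a b"
  by (induction ws arbitrary: a b) (auto simp: mirror_lin_form)

lemma unfolding_adjoint: "B (unfolding_lin ws a) b = B a (unfolding_adj ws b)"
  by (induction ws arbitrary: b) (auto simp: mirror_lin_self_adjoint)

lemma unfolding_map_eq_lin: "sides ws \<Longrightarrow> k \<noteq> 0 \<Longrightarrow> unfolding_map ws y = unfolding_lin ws y"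
  by (induction ws) (auto simp: mirror_eq_mirror_lin)

lemma unfolding_lin_add: "unfolding_lin ws (a + b) = unfolding_lin ws a + unfolding_lin ws b"
  and unfolding_lin_scaleR: "unfolding_lin ws (c *\<^sub>R a) = c *\<^sub>R unfolding_lin ws a"
  by (induction ws; simp add: mirror_lin_add mirror_lin_scaleR)+

lemma linear_unfolding_lin: "linear (unfolding_lin ws)"
  by (intro linearI unfolding_lin_add unfolding_lin_scaleR)

lemma unfolding_map_affine: "unfolding_map ws y = unfolding_lin ws y + unfolding_map ws 0"
  using unfolding_map_diff[of ws y 0] by (simp add: algebra_simps)

lemma continuous_unfolding [continuous_intros]:
  assumes "continuous_on A f"
  shows "continuous_on A (\<lambda>x. unfolding_lin ws (f x))" "continuous_on A (\<lambda>x. unfolding_map ws (f x))"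
proof -
  show "continuous_on A (\<lambda>x. unfolding_lin ws (f x))"
    by (rule bounded_linear.continuous_on[OF _ assms])
       (simp add: linear_unfolding_lin linear_conv_bounded_linear[symmetric])
  then show "continuous_on A (\<lambda>x. unfolding_map ws (f x))"
    unfolding unfolding_map_affine[of ws "f _"] by (rule continuous_on_add) (rule continuous_on_const)
qed

lemma unfolding_map_geod:
  assumes "sides ws"
  shows "unfolding_map ws (geod G y v (t + q)) =
    geod G (unfolding_map ws (geod G y v t)) (unfolding_lin ws (gvel y v t)) q"
  unfolding geod_add[symmetric]
  by (simp add: geod_eq[of "geod G y v t"] geod_eq[of "unfolding_map ws _"] unfolding_map_comb[OF assms])

lemma unfolding_lin_gvel:
  assumes "sides ws"
  shows "unfolding_lin ws (gvel y v (t + q)) =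
    gvel (unfolding_map ws (geod G y v t)) (unfolding_lin ws (gvel y v t)) q"
proof -
  \<comment> \<open>The base point enters the velocity with a factor \<open>k\<close>: for
    \<open>k = 0\<close> it drops out, otherwise the unfolding coincides with its linear
    part.\<close>
  have "(- k * c) *\<^sub>R unfolding_map ws z = (- k * c) *\<^sub>R unfolding_lin ws z" for c z
    using unfolding_map_eq_lin[OF assms] by (cases "k = 0") auto
  then show ?thesis
    unfolding gvel_add[symmetric] gvel_def[of "geod G y v t"] gvel_def[of "unfolding_map ws _"]
    by (simp only: unfolding_lin_add unfolding_lin_scaleR)
qed

section \<open>Optical reflection and the local shape of a side\<close>

text \<open>The normal at \<open>p\<close>, kept fixed as an ambient vector, remains normal along
  the whole geodesic. Therefore one mirror serves all points of a side.\<close>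

lemma side_frame:
  assumes \<sigma>: "is_side G (p, u, l)"
  shows "geod G p u s \<in> pts G" "orthonormal_frame G (geod G p u s) (gvel p u s) (normal (p, u, l))"
proof -
  have p: "p \<in> pts G" and u: "u \<in> unit_tangent G p" using \<sigma> by (auto simp: is_side_def)
  show "geod G p u s \<in> pts G" by (rule geod_pts[OF p u])
  let ?n = "normal (p, u, l)"
  have n: "B ?n ?n = 1" "k * B p ?n = 0" "B u ?n = 0" using side_normal[OF \<sigma>] by auto
  have "B (gvel p u s) ?n = 0" using n by (auto simp: gvel_def B_simps)
  moreover have "k * B (geod G p u s) ?n = 0" using n by (auto simp: geod_eq B_simps)
  ultimately show "orthonormal_frame G (geod G p u s) (gvel p u s) ?n"
    using gvel_unit_tangent[OF p u] n(1) by (auto simp: orthonormal_frame_def unit_tangentI)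
qed

text \<open>Keeping the tangential component and negating the normal one amounts to subtracting the
  normal one twice; the result no longer depends on the point of impact.\<close>

lemma reflect_along_eq_mirror_lin:
  assumes "is_side G (p, u, l)" "w \<in> tangent G (geod G p u s)"
  shows "reflect_along G (gvel p u s) w = mirror_lin (p, u, l) w"
proof -
  let ?e = "gvel p u s" and ?n = "normal (p, u, l)"
  have "w = B w ?e *\<^sub>R ?e + B w ?n *\<^sub>R ?n"
    by (rule orthonormal_basis[OF side_frame[OF assms(1)] assms(2)])
  then have "2 *\<^sub>R w = 2 *\<^sub>R (B w ?e *\<^sub>R ?e + B w ?n *\<^sub>R ?n)" by (rule arg_cong)
  then have "w + w = (2 * B w ?e) *\<^sub>R ?e + (2 * B w ?n) *\<^sub>R ?n"
    by (simp only: scaleR_2[symmetric] scaleR_add_right scaleR_scaleR)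
  then show ?thesis
    unfolding reflect_along_def mirror_lin_def by (simp add: algebra_simps)
qed

lemma mirror_lin_unit_tangent:
  assumes \<sigma>: "is_side G \<sigma>" and h: "height \<sigma> y = 0" and w: "w \<in> unit_tangent G y"
  shows "mirror_lin \<sigma> w \<in> unit_tangent G y"
proof (rule unit_tangentI)
  show "B (mirror_lin \<sigma> w) (mirror_lin \<sigma> w) = 1" using mirror_lin_form[OF \<sigma>] unit_tangentD[OF w] by simp
  have "k * B y (normal \<sigma>) = 0" using h side_normal(2)[OF \<sigma>] by (auto simp: height_def)
  then show "k * B y (mirror_lin \<sigma> w) = 0"
    using unit_tangentD[OF w] by (auto simp: mirror_lin_def B_simps)
qed

text \<open>Pairing the coincidence with \<open>u\<close> gives equal values of \<open>sn\<close>;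
  for \<open>k \<noteq> 0\<close> the point \<open>p\<close> is not 0, which gives equal values of
  \<open>cs\<close>. The addition theorems turn this into a period.\<close>

lemma geod_inj_period:
  assumes p: "p \<in> pts G" and u: "u \<in> unit_tangent G p" and eq: "geod G p u s = geod G p u t"
  shows "geod G p u (t - s) = p"
proof -
  have "geod G p u (t - s) = geod G (geod G p u t) (gvel p u t) (- s)" by (simp add: geod_add)
  have d: "(cs t - cs s) *\<^sub>R p + (sn t - sn s) *\<^sub>R u = 0"
    using eq by (simp add: geod_eq algebra_simps)
  have "B u ((cs t - cs s) *\<^sub>R p + (sn t - sn s) *\<^sub>R u) = 0" unfolding d by (rule B.zero_right)
  then have 1: "(cs t - cs s) * B u p + (sn t - sn s) = 0"
    using unit_tangentD[OF u] by (simp add: B_simps)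
  have sn: "sn t = sn s"
  proof (cases "k = 0")
    case True
    then show ?thesis using 1 cs_eq_1 by simp
  next
    case False
    then show ?thesis using 1 unit_tangentD[OF u] by simp
  qed
  have cs: "cs t = cs s"
  proof (cases "k = 0")
    case True
    then show ?thesis using cs_eq_1 by simp
  next
    case False
    then have "B p p \<noteq> 0" using form_pts_cases[OF p] by auto
    then have "p \<noteq> 0" using B.zero_left by metis
    then show ?thesis using d sn by simp
  qed
  have "cs (t - s) = 1" "sn (t - s) = 0"
    using cs_add[of t "-s"] sn_add[of t "-s"] cs_sn_pythagoras[of s] by (simp_all add: cs sn)
  then show ?thesis by (simp add: geod_eq)
qed

text \<open>A side may be a full great circle with coinciding ends, and injectivity is known only on
  the half-open interval. A coincidence with the far end is shifted by the period to parameter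
  0.\<close>

lemma side_interior_not_end:
  assumes \<sigma>: "is_side G (p, u, l)" and s: "0 < s" "s < l"
  shows "geod G p u s \<notin> side_ends G (p, u, l)"
proof
  have p: "p \<in> pts G" and u: "u \<in> unit_tangent G p" and inj: "inj_on (geod G p u) {0..<l}"
    using \<sigma> by (auto simp: is_side_def)
  assume "geod G p u s \<in> side_ends G (p, u, l)"
  then consider "geod G p u s = geod G p u 0" | "geod G p u s = geod G p u l"
    by (auto simp: side_ends_def)
  then show False
  proof cases
    case 1
    then show False using inj_onD[OF inj 1] s by auto
  next
    case 2
    have "geod G p u (l - s) = geod G p u 0" using geod_inj_period[OF p u 2] by simp
    then show False using inj_onD[OF inj, of "l - s" 0] s by auto
  qed
qed

lemma compact_side: "compact (side_set G \<sigma>)"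
proof (cases \<sigma>)
  case (fields p u l)
  have "continuous_on {0..l} (\<lambda>t. cs t *\<^sub>R p + sn t *\<^sub>R u)" by (intro continuous_intros)
  then show ?thesis
    using compact_continuous_image[of "{0..l}" "geod G p u"]
    by (simp add: fields side_set_def geod_eq[abs_def])
qed

text \<open>Ensures that a perturbed orbit reaching the line of a side near an interior point of the
  side reaches the side itself. Close to \<open>z\<close> the component along the line determines a
  point of the line.\<close>

lemma height_zero_local:
  assumes \<sigma>: "is_side G (p, u, l)" and e: "0 < e"
  shows "\<exists>d>0. \<forall>y\<in>pts G. dist y (geod G p u s) < d \<and> height (p, u, l) y = 0 \<longrightarrow>
    (\<exists>s'. \<bar>s' - s\<bar> < e \<and> y = geod G p u s')"
proof -
  let ?n = "normal (p, u, l)"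
  define z v where "z = geod G p u s" and "v = gvel p u s"
  have zp: "z \<in> pts G" and fr: "orthonormal_frame G z v ?n"
    using side_frame[OF \<sigma>, of s] by (auto simp: z_def v_def)
  have v: "v \<in> unit_tangent G z" using fr by (auto simp: orthonormal_frame_def)
  have hz: "height (p, u, l) z = 0" unfolding z_def by (rule height_side[OF \<sigma>])
  \<comment> \<open>Keeps \<open>q\<close> below \<open>e\<close> and below \<open>pi / 2\<close> in
    absolute value; \<open>cs\<close> is positive there.\<close>
  define r where "r = min (e / 2) (1 / 2)"
  have r: "0 < r" "r < 1" "r < e" using e by (auto simp: r_def)
  have snr: "sn r > 0" using sn_pos r by auto
  have contsn: "continuous_on A sn" for A using continuous_cs_sn(2)[of A "\<lambda>x. x"] by simp
  have "((\<lambda>y. B (y - z) v) \<longlongrightarrow> B (z - z) v) (nhds z)"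
    by (rule B.tendsto[OF tendsto_diff[OF filterlim_ident tendsto_const] tendsto_const])
  then have 1: "((\<lambda>y. B (y - z) v) \<longlongrightarrow> 0) (nhds z)" by (simp add: B.zero_left)
  have 2: "((\<lambda>y. k * B y z) \<longlongrightarrow> k * B z z) (nhds z)"
    by (rule tendsto_mult_left, rule B.tendsto[OF filterlim_ident tendsto_const])
  have kz: "k = 0 \<or> k * B z z = 1 \<and> B z z = k" using form_pts_cases[OF zp] by auto
  have "eventually (\<lambda>y. \<bar>B (y - z) v\<bar> < sn r) (nhds z)"
    using tendstoD[OF 1 snr] by simp
  moreover have "eventually (\<lambda>y. k = 0 \<or> k * B y z > 0) (nhds z)"
  proof (cases "k = 0")
    case False
    then show ?thesis using order_tendstoD(1)[OF 2, of 0] kz by auto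
  qed auto
  ultimately have "eventually (\<lambda>y. \<bar>B (y - z) v\<bar> < sn r \<and> (k = 0 \<or> k * B y z > 0)) (nhds z)"
    by eventually_elim auto
  then obtain d where d: "d > 0"
    "\<And>y. dist y z < d \<Longrightarrow> \<bar>B (y - z) v\<bar> < sn r \<and> (k = 0 \<or> k * B y z > 0)"
    by (auto simp: eventually_nhds_metric)
  have "\<exists>s'. \<bar>s' - s\<bar> < e \<and> y = geod G p u s'"
    if y: "y \<in> pts G" and dy: "dist y z < d" and hy: "height (p, u, l) y = 0" for y
  proof -
    have "- sn r \<le> B (y - z) v" "B (y - z) v \<le> sn r" using d(2)[OF dy] by auto
    \<comment> \<open>By the intermediate value theorem the tangential component of the chord equals
      \<open>sn q\<close> for a small \<open>q\<close>, which turns out to be the parameter relative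
      to \<open>s\<close>.\<close>
    then obtain q where q: "-r \<le> q" "q \<le> r" "sn q = B (y - z) v"
      using IVT'[of sn "-r" "B (y - z) v" r, OF _ _ _ contsn] r by auto
    have hn: "B (y - z) ?n = 0" using hy hz by (simp add: height_def B_simps)
    have "y = geod G z v q"
    proof (cases "k = 0")
      case True
      then have "y - z \<in> tangent G z" by (simp add: tangent_iff)
      then have "y - z = B (y - z) v *\<^sub>R v"
        using orthonormal_basis[OF zp fr, of "y - z"] hn by simp
      then show ?thesis using q(3) cs_eq_1[OF True] by (simp add: geod_eq algebra_simps)
    next
      case False
      have kk: "k * k = 1" using form_pts_cases[OF zp] False by auto
      have kz': "k * B z z = 1" "B z z = k" "B y y = k"
        using kz form_pts_cases[OF y] False by auto
      have zv: "B z v = 0" "B z ?n = 0"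
        using fr False by (auto simp: orthonormal_frame_def dest: unit_tangentD)
      define c where "c = k * B y z"
      have "y - c *\<^sub>R z \<in> tangent G z"
        using kz' by (simp add: c_def tangent_iff B_simps form_sym[of z y])
      then have "y - c *\<^sub>R z = B y v *\<^sub>R v"
        using orthonormal_basis[OF zp fr, of "y - c *\<^sub>R z"] hn zv by (simp add: B_simps)
      then have yeq: "y = c *\<^sub>R z + sn q *\<^sub>R v" using q(3) zv by (simp add: B_simps algebra_simps)
      have "B (c *\<^sub>R z + sn q *\<^sub>R v) (c *\<^sub>R z + sn q *\<^sub>R v) =
          c * c * B z z + sn q * sn q * B v v + 2 * c * sn q * B z v"
        by (simp add: B_simps form_sym[of v z] algebra_simps)
      then have "c * c * k + sn q * sn q = k"
        using zv(1) unit_tangentD(1)[OF v] kz'(2,3) yeq[symmetric] by simp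
      then have "k * (c * c * k + sn q * sn q) = k * k" by (rule arg_cong)
      then have "c * c * (k * k) + k * (sn q * sn q) = k * k"
        by (simp add: distrib_left mult.left_commute[of k] mult.assoc)
      then have "c * c + k * (sn q * sn q) = 1" unfolding kk by simp
      \<comment> \<open>Now \<open>y\<close> is known up to the sign of its component along
        \<open>z\<close>; positivity of \<open>k * B y z\<close> near \<open>z\<close> selects the
        sign.\<close>
      then have "c * c = cs q * cs q" using cs_sn_pythagoras[of q] by linarith
      moreover have "c > 0" using d(2)[OF dy] False by (simp add: c_def)
      moreover have "cs q > 0"
      proof -
        have "\<bar>q\<bar> < pi / 2" using q r pi_gt3 by auto
        then have "0 < cos q" by (intro cos_gt_zero_pi) auto
        then show ?thesis using curvature cosh_real_pos[of q] by auto
      qed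
      ultimately have "c = cs q"
        using power2_eq_imp_eq[of c "cs q"] by (simp add: power2_eq_square)
      then show ?thesis using yeq by (simp add: geod_eq)
    qed
    then have "y = geod G p u (s + q)" by (simp add: z_def v_def geod_add)
    moreover have "\<bar>(s + q) - s\<bar> < e" using q r by auto
    ultimately show ?thesis by blast
  qed
  then show ?thesis using d(1) unfolding z_def by blast
qed

lemma cs_sn_lipschitz:
  obtains L where "L \<ge> 0" "\<And>r. 0 \<le> r \<Longrightarrow> r \<le> T \<Longrightarrow> \<bar>cs r - 1\<bar> \<le> L * r \<and> \<bar>sn r\<bar> \<le> L * r"
proof -
  have "continuous_on {0..T} (\<lambda>t. (cs t, k * sn t))"
    by (rule continuous_on_Pair[OF continuous_cs_sn(1)[OF continuous_on_id]
          continuous_on_mult[OF continuous_on_const continuous_cs_sn(2)[OF continuous_on_id]]])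
  then have "compact ((\<lambda>t. (cs t, k * sn t)) ` {0..T})"
    by (rule compact_continuous_image) simp
  then have "bounded ((\<lambda>t. (cs t, k * sn t)) ` {0..T})" by (rule compact_imp_bounded)
  then obtain L where "\<forall>y\<in>(\<lambda>t. (cs t, k * sn t)) ` {0..T}. norm y \<le> L"
    unfolding bounded_iff ..
  then have L: "norm (cs t, k * sn t) \<le> L" if "t \<in> {0..T}" for t using that by simp
  have bd: "norm (cs t) \<le> \<bar>L\<bar>" "norm (- k * sn t) \<le> \<bar>L\<bar>" if "t \<in> {0..T}" for t
    using L[OF that] norm_fst_le[of "cs t" "k * sn t"] norm_snd_le[of "k * sn t" "cs t"] by auto
  have "\<bar>cs r - 1\<bar> \<le> \<bar>L\<bar> * r \<and> \<bar>sn r\<bar> \<le> \<bar>L\<bar> * r" if r: "0 \<le> r" "r \<le> T" for r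
    using field_differentiable_bound[of "{0..T}" cs "\<lambda>t. - k * sn t" "\<bar>L\<bar>" r 0]
      field_differentiable_bound[of "{0..T}" sn cs "\<bar>L\<bar>" r 0]
      has_derivative_cs has_derivative_sn bd r by auto
  then show ?thesis using that[of "\<bar>L\<bar>"] by auto
qed

text \<open>One time \<open>q0\<close> serves all directions at \<open>z\<close> because
  \<open>norm_unit_tangent\<close> bounds them by the position.\<close>

lemma geod_near:
  assumes "0 < d"
  obtains q0 where "q0 > 0" "\<And>v q. v \<in> unit_tangent G z \<Longrightarrow> z \<in> pts G \<Longrightarrow> 0 < q \<Longrightarrow> q < q0 \<Longrightarrow> dist (geod G z v q) z < d"
proof -
  obtain L where L: "L \<ge> 0" "\<And>r. 0 \<le> r \<Longrightarrow> r \<le> 1 \<Longrightarrow> \<bar>cs r - 1\<bar> \<le> L * r \<and> \<bar>sn r\<bar> \<le> L * r"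
    using cs_sn_lipschitz[of 1] by blast
  define M where "M = L * norm z + L * (1 + 2 * norm z) + 1"
  have M: "M > 0" unfolding M_def using L(1) by (intro add_nonneg_pos add_nonneg_nonneg mult_nonneg_nonneg) auto
  have "dist (geod G z v q) z < d"
    if v: "v \<in> unit_tangent G z" and z: "z \<in> pts G" and q: "0 < q" "q < min 1 (d / M)" for v q
  proof -
    have "dist (geod G z v q) z = norm ((cs q - 1) *\<^sub>R z + sn q *\<^sub>R v)"
      by (simp add: dist_norm geod_eq algebra_simps)
    also have "\<dots> \<le> \<bar>cs q - 1\<bar> * norm z + \<bar>sn q\<bar> * norm v"
      by (rule norm_triangle_le) simp
    also have "\<dots> \<le> (L * q) * norm z + (L * q) * (1 + 2 * norm z)"
      using L(2)[of q] q L(1) norm_unit_tangent[OF z v] by (intro add_mono mult_mono) auto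
    also have "\<dots> \<le> M * q" using q by (simp add: M_def algebra_simps)
    also have "\<dots> < d" using q M by (simp add: field_simps)
    finally show ?thesis .
  qed
  then show ?thesis using that[of "min 1 (d / M)"] M assms by auto
qed

text \<open>The incoming direction, reversed, and the reflected direction lie on the same side of the
  mirror, and so do all the directions between them.\<close>

lemma fan:
  assumes fr: "orthonormal_frame G z e n" and z: "z \<in> pts G" and w: "w \<in> unit_tangent G z" and b: "B w n \<noteq> 0"
  obtains f where "continuous_on {0..1 :: real} f" "f 0 = - w" "f 1 = w - (2 * B w n) *\<^sub>R n"
    "\<And>i. f i \<in> unit_tangent G z" "\<And>i. B (f i) n \<noteq> 0"
proof -
  define a where "a = B w e"
  define b where "b = B w n"
  have en: "B e e = 1" "B n n = 1" "B e n = 0" "B n e = 0" "k * B z e = 0" "k * B z n = 0"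
    using fr by (auto simp: orthonormal_frame_def form_sym[of n e] dest: unit_tangentD)
  have w_eq: "w = a *\<^sub>R e + b *\<^sub>R n"
    unfolding a_def b_def using orthonormal_basis[OF z fr] w by (auto dest: unit_tangentD)
  have "B w w = a * a + b * b" by (subst (1 2) w_eq) (simp add: B_simps en)
  then have ab: "b\<^sup>2 + a\<^sup>2 = 1" using unit_tangentD(1)[OF w] by (simp add: power2_eq_square)
  have b0: "b \<noteq> 0" using b by (simp add: b_def)
  \<comment> \<open>The normal coefficient stays \<open>- b\<close> while the tangential one runs
    from \<open>- a\<close> to \<open>a\<close>. Division by \<open>N\<close>, positive since
    \<open>b \<noteq> 0\<close>, restores unit length.\<close>
  define N where "N = (\<lambda>i :: real. sqrt (b\<^sup>2 + ((2 * i - 1) * a)\<^sup>2))"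
  have N: "N i > 0" "N i * N i = b\<^sup>2 + ((2 * i - 1) * a)\<^sup>2" for i
    using b0 by (auto simp: N_def add_pos_nonneg)
  define f where "f = (\<lambda>i. (1 / N i) *\<^sub>R (((2 * i - 1) * a) *\<^sub>R e - b *\<^sub>R n))"
  have "continuous_on {0..1} f"
    unfolding f_def using N(1) unfolding N_def
    by (intro continuous_intros) (auto simp: less_imp_neq[symmetric])
  moreover have "N 0 = 1" "N 1 = 1" using ab by (simp_all add: N_def)
  then have "f 0 = - w" "f 1 = w - (2 * B w n) *\<^sub>R n"
    unfolding b_def[symmetric] by (simp_all add: f_def w_eq algebra_simps scaleR_2[symmetric])
  moreover have "f i \<in> unit_tangent G z" for i
  proof (rule unit_tangentI)
    have "B (f i) (f i) = (1 / (N i * N i)) * (N i * N i)"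
      unfolding N(2) by (subst N(2)[symmetric])
        (simp add: f_def B_simps en power2_eq_square add_divide_distrib add.commute)
    then show "B (f i) (f i) = 1"
      using N(1)[of i] by simp
    show "k * B z (f i) = 0" using en by (auto simp: f_def B_simps)
  qed
  moreover have "B (f i) n \<noteq> 0" for i
    using N(1)[of i] b0 by (simp add: f_def B_simps en)
  ultimately show ?thesis by (rule that)
qed

end

section \<open>Unfolded orbits\<close>

locale billiard_table = space_form +
  fixes P :: "'a set" and S :: "'a side set" and x e1 e2 :: 'a
  assumes polygon: "geodesic_polygon G P S"
    and base: "x \<in> P"
    and frame: "orthonormal_frame G x e1 e2"
begin

abbreviation inside :: "'a set" where "inside \<equiv> rel_interior_of G P"

definition rim :: "'a set" where "rim = (\<Union>\<sigma>\<in>S. side_set G \<sigma>)"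

lemma P_pts: "P \<subseteq> pts G" and compact_P: "compact P" and finite_S: "finite S"
  and side: "\<sigma> \<in> S \<Longrightarrow> is_side G \<sigma>"
  using polygon by (auto simp: geodesic_polygon_def)

lemma x_pts: "x \<in> pts G" using base P_pts by auto

lemma compact_rim: "compact rim"
  unfolding rim_def using finite_S compact_side by blast

lemma rim_eq: "rim = P - inside"
proof -
  have "closedin (top_of_set (pts G)) P"
    using P_pts compact_P by (simp add: closed_subset compact_imp_closed)
  then have "top_of_set (pts G) closure_of P = P" by (simp add: closure_of_eq)
  then show ?thesis
    using polygon by (simp add: geodesic_polygon_def rim_def frontier_of_def rel_interior_of_def)
qed

lemma inner_subset: "inside \<subseteq> P"
  unfolding rel_interior_of_def by (rule interior_of_subset)

lemma inner_open: obtains U where "open U" "inside = pts G \<inter> U"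
  using openin_interior_of[of "top_of_set (pts G)" P]
  unfolding rel_interior_of_def openin_open by blast

lemma P_closed: "closed P" using compact_P by (rule compact_imp_closed)

text \<open>Off the rim, lying in \<open>inside\<close> and lying in \<open>P\<close> coincide; the
  former is an open condition, the latter a closed one, so connectedness decides.\<close>

lemma stays_inner:
  assumes cont: "continuous_on I f" and I: "connected I" and pts: "\<And>i. i \<in> I \<Longrightarrow> f i \<in> pts G"
    and rim: "\<And>i. i \<in> I \<Longrightarrow> f i \<notin> rim" and i0: "i0 \<in> I" "f i0 \<in> inside" and i: "i \<in> I"
  shows "f i \<in> inside"
proof -
  have "openin (top_of_set (pts G)) inside" unfolding rel_interior_of_def by simp
  then have 1: "openin (top_of_set I) (I \<inter> f -` inside)"
    using pts by (intro continuous_openin_preimage[OF cont, of "pts G"]) auto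
  have "I \<inter> f -` inside = I \<inter> f -` P" using rim rim_eq inner_subset by auto
  then have 2: "closedin (top_of_set I) (I \<inter> f -` inside)"
    using continuous_closedin_preimage[OF cont P_closed] by simp
  have "I \<inter> f -` inside = {} \<or> I \<inter> f -` inside = I"
    using I 1 2 unfolding connected_clopen by blast
  then show ?thesis using i0 i by auto
qed

text \<open>Defined for all real times. It is the true orbit only while \<open>ws\<close> lists the
  sides hit so far; at other times it follows the geodesic extension of that piece.\<close>

definition orb :: "'a side list \<Rightarrow> real \<Rightarrow> real \<Rightarrow> 'a" where
  "orb ws \<theta> t = unfolding_map ws (geod G x (dir e1 e2 \<theta>) t)"

definition vel :: "'a side list \<Rightarrow> real \<Rightarrow> real \<Rightarrow> 'a" where
  "vel ws \<theta> t = unfolding_lin ws (gvel x (dir e1 e2 \<theta>) t)"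

lemma sides: "set ws \<subseteq> S \<Longrightarrow> \<sigma> \<in> set ws \<Longrightarrow> is_side G \<sigma>" using side by blast

lemma frame_unit: "B e1 e1 = 1" "B e2 e2 = 1" "B e1 e2 = 0" "B e2 e1 = 0" "k * B x e1 = 0" "k * B x e2 = 0"
  using frame unfolding orthonormal_frame_def by (auto dest: unit_tangentD simp: form_sym[of e2 e1])

lemma dir_unit: "dir e1 e2 \<theta> \<in> unit_tangent G x"
proof (rule unit_tangentI)
  show "B (dir e1 e2 \<theta>) (dir e1 e2 \<theta>) = 1"
    using frame_unit sin_cos_squared_add3[of \<theta>] by (simp add: dir_def B_simps)
  show "k * B x (dir e1 e2 \<theta>) = 0"
    using frame_unit by (auto simp: dir_def B_simps)
qed

lemma orb_0: "orb ws \<theta> 0 = unfolding_map ws x" by (simp add: orb_def)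

lemma orb_Nil: "orb [] \<theta> t = geod G x (dir e1 e2 \<theta>) t" by (simp add: orb_def)

lemma orb_add: "set ws \<subseteq> S \<Longrightarrow> geod G (orb ws \<theta> t) (vel ws \<theta> t) q = orb ws \<theta> (t + q)"
  unfolding orb_def vel_def using sides by (subst unfolding_map_geod) auto

lemma vel_add: "set ws \<subseteq> S \<Longrightarrow> gvel (orb ws \<theta> t) (vel ws \<theta> t) q = vel ws \<theta> (t + q)"
  unfolding orb_def vel_def using sides by (subst unfolding_lin_gvel) auto

lemma height_orb:
  "set ws \<subseteq> S \<Longrightarrow> \<sigma> \<in> S \<Longrightarrow> height \<sigma> (orb ws \<theta> (t + q)) =
     cs q * height \<sigma> (orb ws \<theta> t) + sn q * B (vel ws \<theta> t) (normal \<sigma>)"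
  by (simp add: orb_add[symmetric] height_geod side)

lemma continuous_dir:
  fixes f :: "'b :: t2_space \<Rightarrow> real"
  assumes "continuous_on A f" shows "continuous_on A (\<lambda>p. dir e1 e2 (f p))"
  unfolding dir_def by (intro continuous_intros assms)

lemma continuous_orb:
  fixes f g :: "'b :: t2_space \<Rightarrow> real"
  assumes "continuous_on A f" "continuous_on A g"
  shows "continuous_on A (\<lambda>p. orb ws (f p) (g p))" "continuous_on A (\<lambda>p. vel ws (f p) (g p))"
  unfolding orb_def vel_def geod_eq gvel_def
  by (rule continuous_unfolding, intro continuous_intros continuous_dir assms)+

lemma continuous_height:
  assumes "continuous_on A f" shows "continuous_on A (\<lambda>p. height \<sigma> (f p))"
  unfolding height_def by (intro continuous_intros B.continuous_on assms)

section \<open>Grazing directions and transversality\<close>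

text \<open>Lying in the line of a side for all time mentions no time of contact, which leaves one
  condition on \<open>\<theta>\<close> for each word and side. Tangency at a single time already
  implies it; this is \<open>transversal\<close>.\<close>

definition tangential :: "real set" where
  "tangential = {\<theta>. \<exists>ws \<sigma>. set ws \<subseteq> S \<and> \<sigma> \<in> S \<and> (\<forall>t. height \<sigma> (orb ws \<theta> t) = 0)}"

lemma countable_words: "countable {ws. set ws \<subseteq> S}"
  using countable_lists[OF countable_finite[OF finite_S]] by (simp add: lists_eq_set)

lemma countable_tangential: "countable tangential"
proof -
  have "countable {\<theta>. \<forall>t. height \<sigma> (orb ws \<theta> t) = 0}" (is "countable ?T")
    if ws: "set ws \<subseteq> S" and \<sigma>: "\<sigma> \<in> S" for ws \<sigma>
  proof (cases "height \<sigma> (unfolding_map ws x) = 0")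
    case False
    then have "height \<sigma> (orb ws \<theta> 0) \<noteq> 0" for \<theta> by (simp add: orb_0)
    then have "?T = {}" by blast
    then show ?thesis by (simp only: countable_empty)
  next
    case True
    \<comment> \<open>The normal of the side carried back to \<open>x\<close>. It is tangent at
      \<open>x\<close> because the unfolded \<open>x\<close> lies on the line of the side, and as a
      unit vector it is not orthogonal to both frame vectors.\<close>
    define m where "m = unfolding_adj ws (normal \<sigma>)"
    have sw: "sides ws" using sides ws by auto
    have mm: "B m m = 1" unfolding m_def using unfolding_adj_form[OF sw] side_normal(1)[OF side[OF \<sigma>]] by simp
    have "k * B x m = 0"
    proof (cases "k = 0")
      case False
      have "B x m = B (unfolding_map ws x) (normal \<sigma>)"
        unfolding m_def unfolding_map_eq_lin[OF sw False] by (simp add: unfolding_adjoint)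
      then show ?thesis using True side_normal(2)[OF side[OF \<sigma>]] by (auto simp: height_def)
    qed simp
    then have m: "m = B m e1 *\<^sub>R e1 + B m e2 *\<^sub>R e2"
      by (intro orthonormal_basis[OF x_pts frame]) (simp add: tangent_iff)
    have ab: "B e1 m \<noteq> 0 \<or> B e2 m \<noteq> 0"
    proof (rule ccontr)
      assume "\<not> ?thesis"
      then have "B m e1 *\<^sub>R e1 + B m e2 *\<^sub>R e2 = 0" by (simp add: form_sym[of m])
      then have "m = 0" using m by (rule trans[rotated])
      then show False using mm by (simp add: B.zero_left)
    qed
    have "?T \<subseteq> {\<theta>. B e1 m * cos \<theta> + B e2 m * sin \<theta> = 0}"
    proof safe
      fix \<theta> assume "\<forall>t. height \<sigma> (orb ws \<theta> t) = 0"
      \<comment> \<open>The height starts at 0, so at any other time it is \<open>sn\<close> times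
        the normal velocity; \<open>1/2\<close> is a time at which \<open>sn\<close> is
        positive.\<close>
      then have "sn (1/2) * B (vel ws \<theta> 0) (normal \<sigma>) = 0"
        using height_orb[OF ws \<sigma>, of \<theta> 0 "1/2"] by simp
      then have "B (vel ws \<theta> 0) (normal \<sigma>) = 0" using sn_pos[of "1/2"] by simp
      then have "B (dir e1 e2 \<theta>) m = 0" by (simp add: vel_def unfolding_adjoint m_def)
      then show "B e1 m * cos \<theta> + B e2 m * sin \<theta> = 0"
        by (simp add: dir_def B_simps mult.commute)
    qed
    then show ?thesis using countable_trig_zeros[OF ab] by (rule countable_subset)
  qed
  then have "countable (\<Union>ws\<in>{ws. set ws \<subseteq> S}. \<Union>\<sigma>\<in>S. {\<theta>. \<forall>t. height \<sigma> (orb ws \<theta> t) = 0})"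
    using countable_words countable_finite[OF finite_S] by (intro countable_UN) auto
  then show ?thesis by (rule countable_subset[rotated]) (auto simp: tangential_def)
qed

lemma countable_hits:
  assumes "\<theta> \<notin> tangential" "set ws \<subseteq> S" "\<sigma> \<in> S"
  shows "countable {t. height \<sigma> (orb ws \<theta> t) = 0}"
proof -
  define a b where "a = height \<sigma> (orb ws \<theta> 0)" and "b = B (vel ws \<theta> 0) (normal \<sigma>)"
  have eq: "height \<sigma> (orb ws \<theta> t) = a * cs t + b * sn t" for t
    using height_orb[OF assms(2,3), of \<theta> 0 t] by (simp add: a_def b_def mult.commute)
  have "a \<noteq> 0 \<or> b \<noteq> 0"
  proof (rule ccontr)
    assume "\<not> ?thesis"
    then have "height \<sigma> (orb ws \<theta> t) = 0" for t by (simp add: eq)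
    then show False using assms unfolding tangential_def by blast
  qed
  then show ?thesis unfolding eq by (rule countable_zeros)
qed

text \<open>The height is a combination of \<open>cs\<close> and \<open>sn\<close>, fixed by its
  value and derivative at one time; if both vanish there, it vanishes identically.\<close>

lemma transversal:
  assumes "\<theta> \<notin> tangential" "set ws \<subseteq> S" "\<sigma> \<in> S" "height \<sigma> (orb ws \<theta> t) = 0"
  shows "B (vel ws \<theta> t) (normal \<sigma>) \<noteq> 0"
proof
  assume "B (vel ws \<theta> t) (normal \<sigma>) = 0"
  then have "height \<sigma> (orb ws \<theta> s) = 0" for s
    using height_orb[OF assms(2,3), of \<theta> t "s - t"] assms(4) by simp
  then show False using assms unfolding tangential_def by blast
qed

text \<open>Only the sides through \<open>orb ws \<theta>0 t\<close> matter close to that point; an orbit that starts on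
  such a side transversally cannot meet it again within time \<open>1\<close>.\<close>

lemma leaves_rim:
  assumes \<theta>0: "\<theta>0 \<notin> tangential" and ws: "set ws \<subseteq> S"
  obtains \<rho> where "\<rho> > 0" "eventually (\<lambda>(\<tau>, \<theta>).
      (\<forall>\<sigma>\<in>S. orb ws \<theta>0 t \<in> side_set G \<sigma> \<longrightarrow> height \<sigma> (orb ws \<theta> \<tau>) = 0) \<longrightarrow>
      (\<forall>q. 0 < \<bar>q\<bar> \<and> \<bar>q\<bar> < \<rho> \<longrightarrow> orb ws \<theta> (\<tau> + q) \<notin> rim)) (nhds (t, \<theta>0))"
proof -
  define T where "T = {\<sigma>\<in>S. orb ws \<theta>0 t \<in> side_set G \<sigma>}"
  define K where "K = (\<Union>\<sigma>\<in>S - T. side_set G \<sigma>)"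
  have "closed K" unfolding K_def using finite_S compact_side
    by (intro closed_UN) (auto intro: compact_imp_closed)
  \<comment> \<open>The offset from the base time has its own coordinate, so that the product
    neighbourhood yields one range of offsets for all nearby times and angles.\<close>
  define W where "W = (\<lambda>p :: (real \<times> real) \<times> real. orb ws (snd (fst p)) (fst (fst p) + snd p)) -` (- K)"
  have "open W" unfolding W_def
  proof (rule open_vimage)
    show "open (- K)" using \<open>closed K\<close> by (rule open_Compl)
    show "continuous_on UNIV (\<lambda>p :: (real \<times> real) \<times> real. orb ws (snd (fst p)) (fst (fst p) + snd p))"
      by (intro continuous_orb continuous_on_add continuous_on_fst continuous_on_snd continuous_on_id)
  qed
  have "((t, \<theta>0), 0) \<in> W" by (auto simp: W_def K_def T_def)
  then obtain U V where UV: "open U" "open V" "(t, \<theta>0) \<in> U" "0 \<in> V" "U \<times> V \<subseteq> W"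
    by (rule open_prod_elim[OF \<open>open W\<close>]) auto
  obtain r where r: "r > 0" "ball 0 r \<subseteq> V" using openE[OF UV(2,4)] by blast
  have "eventually (\<lambda>p. \<forall>\<sigma>\<in>T. B (vel ws (snd p) (fst p)) (normal \<sigma>) \<noteq> 0) (nhds (t, \<theta>0))"
  proof (rule eventually_ball_finite)
    show "finite T" using finite_S by (simp add: T_def)
    show "\<forall>\<sigma>\<in>T. eventually (\<lambda>p. B (vel ws (snd p) (fst p)) (normal \<sigma>) \<noteq> 0) (nhds (t, \<theta>0))"
    proof
      fix \<sigma> assume "\<sigma> \<in> T"
      then have \<sigma>: "\<sigma> \<in> S" "height \<sigma> (orb ws \<theta>0 t) = 0"
        using height_side_set[OF side] by (auto simp: T_def)
      have "open {p. B (vel ws (snd p) (fst p)) (normal \<sigma>) \<noteq> 0}"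
        by (intro open_Collect_neq B.continuous_on continuous_orb continuous_on_fst continuous_on_snd
            continuous_on_id continuous_on_const)
      then have "eventually (\<lambda>p. p \<in> {p. B (vel ws (snd p) (fst p)) (normal \<sigma>) \<noteq> 0}) (nhds (t, \<theta>0))"
        using transversal[OF \<theta>0 ws \<sigma>] by (intro eventually_nhds_in_open) auto
      then show "eventually (\<lambda>p. B (vel ws (snd p) (fst p)) (normal \<sigma>) \<noteq> 0) (nhds (t, \<theta>0))"
        by simp
    qed
  qed
  moreover have "eventually (\<lambda>p. p \<in> U) (nhds (t, \<theta>0))" using UV by (simp add: eventually_nhds_in_open)
  ultimately have "eventually (\<lambda>(\<tau>, \<theta>).
      (\<forall>\<sigma>\<in>S. orb ws \<theta>0 t \<in> side_set G \<sigma> \<longrightarrow> height \<sigma> (orb ws \<theta> \<tau>) = 0) \<longrightarrow>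
      (\<forall>q. 0 < \<bar>q\<bar> \<and> \<bar>q\<bar> < min r 1 \<longrightarrow> orb ws \<theta> (\<tau> + q) \<notin> rim)) (nhds (t, \<theta>0))"
  proof eventually_elim
    case (elim p)
    obtain \<tau> \<theta> where p: "p = (\<tau>, \<theta>)" by (cases p)
    have "orb ws \<theta> (\<tau> + q) \<notin> rim"
      if h: "\<forall>\<sigma>\<in>S. orb ws \<theta>0 t \<in> side_set G \<sigma> \<longrightarrow> height \<sigma> (orb ws \<theta> \<tau>) = 0"
        and q: "0 < \<bar>q\<bar>" "\<bar>q\<bar> < min r 1" for q
    proof
      assume "orb ws \<theta> (\<tau> + q) \<in> rim"
      then obtain \<sigma> where \<sigma>: "\<sigma> \<in> S" "orb ws \<theta> (\<tau> + q) \<in> side_set G \<sigma>" by (auto simp: rim_def)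
      have "q \<in> V" using q r(2) by (auto simp: subset_iff dist_real_def)
      then have "((\<tau>, \<theta>), q) \<in> W" using elim p UV(5) by auto
      then have "\<sigma> \<in> T" using \<sigma> by (auto simp: W_def K_def)
      then have "height \<sigma> (orb ws \<theta> \<tau>) = 0" using h unfolding T_def by blast
      moreover have "B (vel ws \<theta> \<tau>) (normal \<sigma>) \<noteq> 0"
        using bspec[OF elim(1) \<open>\<sigma> \<in> T\<close>] p by simp
      moreover have "height \<sigma> (orb ws \<theta> (\<tau> + q)) = 0"
        using height_side_set[OF side] \<sigma> by auto
      ultimately show False
        using height_orb[OF ws \<sigma>(1), of \<theta> \<tau> q] sn_nonzero[of q] q by auto
    qed
    then show ?case unfolding p by auto
  qed
  then show ?thesis using that[of "min r 1"] r(1) by simp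
qed

section \<open>Stability of bounce sequences\<close>

abbreviation bounces :: "real \<Rightarrow> real \<Rightarrow> 'a \<Rightarrow> 'a \<Rightarrow> bool" where
  "bounces \<theta> \<equiv> bounce G P S x (dir e1 e2 \<theta>)"

lemma only_side:
  assumes "(p, u, l) \<in> S" "0 < s" "s < l" "\<sigma> \<in> S" "geod G p u s \<in> side_set G \<sigma>"
  shows "\<sigma> = (p, u, l)"
proof (rule ccontr)
  assume "\<sigma> \<noteq> (p, u, l)"
  moreover have "geod G p u s \<in> side_set G (p, u, l)"
    using assms(2,3) by (auto simp: side_set_def)
  ultimately have "geod G p u s \<in> side_ends G (p, u, l)"
    using polygon assms(1,4,5) unfolding geodesic_polygon_def by blast
  then show False using side_interior_not_end[OF side[OF assms(1)] assms(2,3)] by blast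
qed

lemma reflect_along_mirror_lin:
  assumes "(p, u, l) \<in> S" "y \<in> pts G" "w \<in> unit_tangent G y" "geod G y w r = geod G p u s"
  shows "reflect_along G (vector_derivative (geod G p u) (at s)) (vector_derivative (geod G y w) (at r)) =
    mirror_lin (p, u, l) (gvel y w r)"
proof -
  have "gvel y w r \<in> tangent G (geod G p u s)"
    using gvel_unit_tangent[OF assms(2,3), of r] unfolding assms(4) by (rule unit_tangentD(4))
  then show ?thesis using reflect_along_eq_mirror_lin[OF side[OF assms(1)]] by simp
qed

lemma orb_hit: "height \<sigma> (orb ws \<theta> t) = 0 \<Longrightarrow> orb (\<sigma> # ws) \<theta> t = orb ws \<theta> t"
  by (simp add: orb_def mirror_fixed)

lemma vel_hit: "vel (\<sigma> # ws) \<theta> t = mirror_lin \<sigma> (vel ws \<theta> t)"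
  by (simp add: vel_def)

lemma bounce_orb:
  assumes "bounces \<theta> t y w"
  shows "\<exists>ws. set ws \<subseteq> S \<and> y = orb ws \<theta> t \<and> w = vel ws \<theta> t \<and> y \<in> pts G \<and>
    w \<in> unit_tangent G y \<and> t \<ge> 0"
  using assms
proof (induction rule: bounce.induct)
  case start
  then show ?case
    using x_pts dir_unit by (intro exI[of _ "[]"]) (simp add: orb_def vel_def)
next
  case (reflect t y w r p u l s)
  then obtain ws where ws: "set ws \<subseteq> S" "y = orb ws \<theta> t" "w = vel ws \<theta> t" and y: "y \<in> pts G"
    and w: "w \<in> unit_tangent G y" and t: "t \<ge> 0" by blast
  let ?\<sigma> = "(p, u, l)"
  have pos: "geod G y w r = orb ws \<theta> (t + r)" using orb_add[OF ws(1)] ws by simp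
  have h: "height ?\<sigma> (geod G y w r) = 0"
    unfolding reflect.hyps by (rule height_side[OF side[OF reflect.hyps(4)]])
  have 1: "geod G y w r = orb (?\<sigma> # ws) \<theta> (t + r)" using orb_hit h pos by simp
  have 2: "reflect_along G (vector_derivative (geod G p u) (at s)) (vector_derivative (geod G y w) (at r)) =
      mirror_lin ?\<sigma> (gvel y w r)"
    by (rule reflect_along_mirror_lin[OF reflect.hyps(4) y w reflect.hyps(7)])
  also have "\<dots> = vel (?\<sigma> # ws) \<theta> (t + r)" using vel_add[OF ws(1)] ws by (simp add: vel_hit)
  finally have 3: "reflect_along G (vector_derivative (geod G p u) (at s)) (vector_derivative (geod G y w) (at r)) =
      vel (?\<sigma> # ws) \<theta> (t + r)" .
  have "mirror_lin ?\<sigma> (gvel y w r) \<in> unit_tangent G (geod G y w r)"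
    by (rule mirror_lin_unit_tangent[OF side[OF reflect.hyps(4)] h gvel_unit_tangent[OF y w]])
  then show ?case
    using 1 2 3 ws(1) reflect.hyps(2,4) t geod_pts[OF y w, of r]
    by (intro exI[of _ "?\<sigma> # ws"] conjI) auto
qed

lemma bounce_orb_tangent:
  assumes "bounces \<theta> t (orb ws \<theta> t) (vel ws \<theta> t)"
  shows "orb ws \<theta> t \<in> pts G" "vel ws \<theta> t \<in> unit_tangent G (orb ws \<theta> t)"
  using bounce_orb[OF assms] by auto

lemma bounce_orb_pts:
  assumes "set ws \<subseteq> S" "bounces \<theta> t (orb ws \<theta> t) (vel ws \<theta> t)"
  shows "orb ws \<theta> q \<in> pts G"
  using geod_pts[OF bounce_orb_tangent[OF assms(2)], of "q - t"] by (simp add: orb_add[OF assms(1)])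

lemma bounce_hit:
  assumes ws: "set ws \<subseteq> S" and b: "bounces \<theta> t (orb ws \<theta> t) (vel ws \<theta> t)" and r: "t < t'"
    and int: "\<And>q. t < q \<Longrightarrow> q < t' \<Longrightarrow> orb ws \<theta> q \<in> inside"
    and \<sigma>: "(p, u, l) \<in> S" "0 < s" "s < l" and hit: "orb ws \<theta> t' = geod G p u s"
  shows "bounces \<theta> t' (orb ((p, u, l) # ws) \<theta> t') (vel ((p, u, l) # ws) \<theta> t')"
proof -
  let ?y = "orb ws \<theta> t" and ?w = "vel ws \<theta> t" and ?r = "t' - t"
  have pos: "geod G ?y ?w ?r = orb ws \<theta> t'" by (simp add: orb_add[OF ws])
  have "bounces \<theta> (t + ?r) (geod G ?y ?w ?r)
     (reflect_along G (vector_derivative (geod G p u) (at s)) (vector_derivative (geod G ?y ?w) (at ?r)))"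
  proof (rule bounce.reflect[OF b _ _ \<sigma>])
    show "geod G ?y ?w ?r = geod G p u s" using hit pos by simp
    show "\<forall>q. 0 < q \<and> q < ?r \<longrightarrow> geod G ?y ?w q \<in> inside"
      using int by (simp add: orb_add[OF ws])
  qed (use r in auto)
  moreover have "reflect_along G (vector_derivative (geod G p u) (at s)) (vector_derivative (geod G ?y ?w) (at ?r)) =
      mirror_lin (p, u, l) (gvel ?y ?w ?r)"
    using hit pos by (intro reflect_along_mirror_lin[OF \<sigma>(1) bounce_orb_tangent[OF b]]) simp
  moreover have "height (p, u, l) (orb ws \<theta> t') = 0"
    unfolding hit by (rule height_side[OF side[OF \<sigma>(1)]])
  ultimately show ?thesis by (simp add: orb_hit vel_hit vel_add[OF ws] pos)
qed

text \<open>The tube lemma over a compact time interval. Membership in the surface is a separate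
  premise because \<open>inside\<close> is open only relative to the surface.\<close>

lemma inner_tube:
  assumes int: "\<And>q. a \<le> q \<Longrightarrow> q \<le> b \<Longrightarrow> orb ws \<theta>0 q \<in> inside"
  obtains d where "d > 0"
    "\<And>\<theta> q. \<bar>\<theta> - \<theta>0\<bar> < d \<Longrightarrow> a \<le> q \<Longrightarrow> q \<le> b \<Longrightarrow> orb ws \<theta> q \<in> pts G \<Longrightarrow> orb ws \<theta> q \<in> inside"
proof -
  obtain U where U: "open U" "inside = pts G \<inter> U" by (rule inner_open)
  define W where "W = (\<lambda>p. orb ws (fst p) (snd p)) -` U"
  have "open W" unfolding W_def
    using U(1) by (rule open_vimage) (intro continuous_orb continuous_on_fst continuous_on_snd continuous_on_id)
  moreover have "{\<theta>0} \<times> {a..b} \<subseteq> W" using int U(2) by (auto simp: W_def)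
  ultimately obtain X where X: "\<theta>0 \<in> X" "open X" "X \<times> {a..b} \<subseteq> W"
    using Elementary_Topology.tube_lemma[of "{a..b}" W \<theta>0] by auto
  obtain d where d: "d > 0" "ball \<theta>0 d \<subseteq> X" using openE[OF X(2,1)] by blast
  show ?thesis
  proof (rule that[OF d(1)])
    fix \<theta> q assume *: "\<bar>\<theta> - \<theta>0\<bar> < d" "a \<le> q" "q \<le> b" "orb ws \<theta> q \<in> pts G"
    then have "(\<theta>, q) \<in> W" using d(2) X(3) by (auto simp: subset_iff dist_real_def abs_minus_commute)
    then show "orb ws \<theta> q \<in> inside" using * U(2) by (simp add: W_def)
  qed
qed

text \<open>The gap \<open>\<rho>\<close> is fixed before \<open>\<epsilon>\<close>, so it does not
  shrink when the reflection times are pinned down more precisely.\<close>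

definition stable :: "real \<Rightarrow> 'a side list \<Rightarrow> real \<Rightarrow> real \<Rightarrow> bool" where
  "stable \<theta>0 ws t \<rho> \<longleftrightarrow> (\<forall>\<epsilon>>0. \<exists>d>0. \<forall>\<theta>. \<bar>\<theta> - \<theta>0\<bar> < d \<longrightarrow>
     (\<exists>\<tau>. \<bar>\<tau> - t\<bar> < \<epsilon> \<and> bounces \<theta> \<tau> (orb ws \<theta> \<tau>) (vel ws \<theta> \<tau>) \<and>
       (\<forall>q. 0 < q \<and> q < \<rho> \<longrightarrow> orb ws \<theta> (\<tau> + q) \<notin> rim)))"

text \<open>The gap of \<open>stable\<close> covers the moments right after the reflection, where
  the orbit is too close to the side for compactness; \<open>inner_tube\<close> covers the compact
  rest up to \<open>a\<close>.\<close>

lemma stable_advance: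
  assumes st: "stable \<theta>0 ws t \<rho>" and \<rho>: "\<rho> > 0" and ws: "set ws \<subseteq> S" and a: "t < b" "b \<le> a"
    and int: "\<And>q. t < q \<Longrightarrow> q \<le> a \<Longrightarrow> orb ws \<theta>0 q \<in> inside"
  obtains d where "d > 0" "\<And>\<theta>. \<bar>\<theta> - \<theta>0\<bar> < d \<Longrightarrow>
    \<exists>\<tau><b. bounces \<theta> \<tau> (orb ws \<theta> \<tau>) (vel ws \<theta> \<tau>) \<and> (\<forall>q. \<tau> < q \<and> q \<le> a \<longrightarrow> orb ws \<theta> q \<in> inside)"
proof -
  \<comment> \<open>Nearby reflections occur within \<open>c\<close> of \<open>t\<close>, so a gap
    of length at least \<open>2 * c\<close> reaches past \<open>t + c\<close>, where the tube
    begins.\<close>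
  define c where "c = min \<rho> (b - t) / 2"
  have c: "0 < c" "2 * c \<le> \<rho>" "t + c < b" using \<rho> a by (auto simp: c_def min_def field_simps)
  obtain d1 where d1: "d1 > 0" "\<And>\<theta> q. \<bar>\<theta> - \<theta>0\<bar> < d1 \<Longrightarrow> t + c \<le> q \<Longrightarrow> q \<le> a \<Longrightarrow>
      orb ws \<theta> q \<in> pts G \<Longrightarrow> orb ws \<theta> q \<in> inside"
    using inner_tube[of "t + c" a ws \<theta>0] int c a by auto
  obtain d2 where d2: "d2 > 0" "\<And>\<theta>. \<bar>\<theta> - \<theta>0\<bar> < d2 \<Longrightarrow>
     (\<exists>\<tau>. \<bar>\<tau> - t\<bar> < c \<and> bounces \<theta> \<tau> (orb ws \<theta> \<tau>) (vel ws \<theta> \<tau>) \<and>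
       (\<forall>q. 0 < q \<and> q < \<rho> \<longrightarrow> orb ws \<theta> (\<tau> + q) \<notin> rim))"
    using st c(1) unfolding stable_def by blast
  have "\<exists>\<tau><b. bounces \<theta> \<tau> (orb ws \<theta> \<tau>) (vel ws \<theta> \<tau>) \<and> (\<forall>q. \<tau> < q \<and> q \<le> a \<longrightarrow> orb ws \<theta> q \<in> inside)"
    if \<theta>: "\<bar>\<theta> - \<theta>0\<bar> < min d1 d2" for \<theta>
  proof -
    obtain \<tau> where \<tau>: "\<bar>\<tau> - t\<bar> < c" and bo: "bounces \<theta> \<tau> (orb ws \<theta> \<tau>) (vel ws \<theta> \<tau>)"
      and rim: "\<And>q. 0 < q \<Longrightarrow> q < \<rho> \<Longrightarrow> orb ws \<theta> (\<tau> + q) \<notin> rim"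
      using d2(2)[of \<theta>] \<theta> by auto
    have pts: "orb ws \<theta> q \<in> pts G" for q by (rule bounce_orb_pts[OF ws bo])
    have late: "orb ws \<theta> q \<in> inside" if "t + c \<le> q" "q \<le> a" for q
      using d1(2)[of \<theta> q] that pts \<theta> by auto
    have norim: "orb ws \<theta> q \<notin> rim" if "q \<in> {\<tau><..a}" for q
    proof (cases "t + c \<le> q")
      case True
      then show ?thesis using late that rim_eq by auto
    next
      case False
      then show ?thesis using rim[of "q - \<tau>"] that \<tau> c by auto
    qed
    have "orb ws \<theta> q \<in> inside" if "\<tau> < q" "q \<le> a" for q
    proof (rule stays_inner[of "{\<tau><..a}" "orb ws \<theta>" a])
      show "continuous_on {\<tau><..a} (orb ws \<theta>)"
        using continuous_orb(1)[OF continuous_on_const continuous_on_id] by simp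
      show "orb ws \<theta> a \<in> inside" using late c a by auto
    qed (use norim pts that in auto)
    moreover have "\<tau> < b" using \<tau> c by auto
    ultimately show ?thesis using bo by blast
  qed
  then show ?thesis using that[of "min d1 d2"] d1(1) d2(1) by simp
qed

text \<open>The hitting time of the next side is found by the intermediate value theorem for \<open>height\<close>,
  which changes sign because the hit is transversal.\<close>

lemma stable_hit:
  assumes \<theta>0: "\<theta>0 \<notin> tangential" and st: "stable \<theta>0 ws t \<rho>" and \<rho>: "\<rho> > 0" and ws: "set ws \<subseteq> S"
    and t: "t < t'" and int: "\<And>q. t < q \<Longrightarrow> q < t' \<Longrightarrow> orb ws \<theta>0 q \<in> inside"
    and \<sigma>: "(p, u, l) \<in> S" "0 < s" "s < l" and hit: "orb ws \<theta>0 t' = geod G p u s"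
  shows "\<exists>\<rho>'>0. stable \<theta>0 ((p, u, l) # ws) t' \<rho>'"
proof -
  let ?\<sigma> = "(p, u, l)"
  have sd: "is_side G ?\<sigma>" using side[OF \<sigma>(1)] .
  have ws': "set (?\<sigma> # ws) \<subseteq> S" using ws \<sigma> by auto
  have h0: "height ?\<sigma> (orb ws \<theta>0 t') = 0" unfolding hit by (rule height_side[OF sd])
  have only: "\<sigma>' = ?\<sigma>" if "\<sigma>' \<in> S" "orb ws \<theta>0 t' \<in> side_set G \<sigma>'" for \<sigma>'
    using only_side[OF \<sigma> that(1)] that(2) hit by simp
  have only': "\<sigma>' = ?\<sigma>" if "\<sigma>' \<in> S" "orb (?\<sigma> # ws) \<theta>0 t' \<in> side_set G \<sigma>'" for \<sigma>'
    using only[OF that(1)] that(2) orb_hit[OF h0] by simp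
  obtain \<rho>1 where \<rho>1: "\<rho>1 > 0" and 1: "eventually (\<lambda>(\<tau>, \<theta>).
      (\<forall>\<sigma>\<in>S. orb ws \<theta>0 t' \<in> side_set G \<sigma> \<longrightarrow> height \<sigma> (orb ws \<theta> \<tau>) = 0) \<longrightarrow>
      (\<forall>q. 0 < \<bar>q\<bar> \<and> \<bar>q\<bar> < \<rho>1 \<longrightarrow> orb ws \<theta> (\<tau> + q) \<notin> rim)) (nhds (t', \<theta>0))"
    by (rule leaves_rim[OF \<theta>0 ws])
  obtain \<rho>2 where \<rho>2: "\<rho>2 > 0" and 2: "eventually (\<lambda>(\<tau>, \<theta>).
      (\<forall>\<sigma>\<in>S. orb (?\<sigma> # ws) \<theta>0 t' \<in> side_set G \<sigma> \<longrightarrow> height \<sigma> (orb (?\<sigma> # ws) \<theta> \<tau>) = 0) \<longrightarrow>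
      (\<forall>q. 0 < \<bar>q\<bar> \<and> \<bar>q\<bar> < \<rho>2 \<longrightarrow> orb (?\<sigma> # ws) \<theta> (\<tau> + q) \<notin> rim)) (nhds (t', \<theta>0))"
    by (rule leaves_rim[OF \<theta>0 ws'])
  obtain d1 where d1: "d1 > 0" "\<And>\<tau> \<theta>. \<bar>\<tau> - t'\<bar> < d1 \<Longrightarrow> \<bar>\<theta> - \<theta>0\<bar> < d1 \<Longrightarrow> height ?\<sigma> (orb ws \<theta> \<tau>) = 0 \<Longrightarrow>
      (\<forall>q. 0 < \<bar>q\<bar> \<and> \<bar>q\<bar> < \<rho>1 \<longrightarrow> orb ws \<theta> (\<tau> + q) \<notin> rim)"
  proof -
    obtain d where d: "d > 0" "\<And>\<tau> \<theta>. \<bar>\<tau> - t'\<bar> < d \<Longrightarrow> \<bar>\<theta> - \<theta>0\<bar> < d \<Longrightarrow>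
      (\<forall>\<sigma>\<in>S. orb ws \<theta>0 t' \<in> side_set G \<sigma> \<longrightarrow> height \<sigma> (orb ws \<theta> \<tau>) = 0) \<longrightarrow>
      (\<forall>q. 0 < \<bar>q\<bar> \<and> \<bar>q\<bar> < \<rho>1 \<longrightarrow> orb ws \<theta> (\<tau> + q) \<notin> rim)"
      by (rule eventually_nhds_realpair[OF 1]) auto
    show ?thesis using that[OF d(1)] d(2) only by metis
  qed
  obtain d2 where d2: "d2 > 0" "\<And>\<tau> \<theta>. \<bar>\<tau> - t'\<bar> < d2 \<Longrightarrow> \<bar>\<theta> - \<theta>0\<bar> < d2 \<Longrightarrow> height ?\<sigma> (orb ws \<theta> \<tau>) = 0 \<Longrightarrow>
      (\<forall>q. 0 < \<bar>q\<bar> \<and> \<bar>q\<bar> < \<rho>2 \<longrightarrow> orb (?\<sigma> # ws) \<theta> (\<tau> + q) \<notin> rim)"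
  proof -
    obtain d where d: "d > 0" "\<And>\<tau> \<theta>. \<bar>\<tau> - t'\<bar> < d \<Longrightarrow> \<bar>\<theta> - \<theta>0\<bar> < d \<Longrightarrow>
      (\<forall>\<sigma>\<in>S. orb (?\<sigma> # ws) \<theta>0 t' \<in> side_set G \<sigma> \<longrightarrow> height \<sigma> (orb (?\<sigma> # ws) \<theta> \<tau>) = 0) \<longrightarrow>
      (\<forall>q. 0 < \<bar>q\<bar> \<and> \<bar>q\<bar> < \<rho>2 \<longrightarrow> orb (?\<sigma> # ws) \<theta> (\<tau> + q) \<notin> rim)"
      by (rule eventually_nhds_realpair[OF 2]) auto
    show ?thesis using that[OF d(1)] d(2) only' orb_hit by metis
  qed
  \<comment> \<open>A parameter within \<open>e\<close> of \<open>s\<close> stays strictly between 0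
    and \<open>l\<close>, so the perturbed hit is no corner.\<close>
  define e where "e = min s (l - s)"
  have e: "e > 0" using \<sigma> by (auto simp: e_def)
  obtain d3 where d3: "d3 > 0" "\<And>y. y \<in> pts G \<Longrightarrow> dist y (geod G p u s) < d3 \<Longrightarrow> height ?\<sigma> y = 0 \<Longrightarrow>
      \<exists>s'. \<bar>s' - s\<bar> < e \<and> y = geod G p u s'"
    using height_zero_local[OF sd e] by blast
  have "open {c. dist (orb ws (snd c) (fst c)) (geod G p u s) < d3}"
    by (intro open_Collect_less continuous_on_dist continuous_orb continuous_on_fst continuous_on_snd
        continuous_on_id continuous_on_const)
  then have "eventually (\<lambda>q. q \<in> {c. dist (orb ws (snd c) (fst c)) (geod G p u s) < d3}) (nhds (t', \<theta>0))"
    using hit d3(1) by (intro eventually_nhds_in_open) auto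
  then obtain d4 where d4: "d4 > 0" "\<And>\<tau> \<theta>. \<bar>\<tau> - t'\<bar> < d4 \<Longrightarrow> \<bar>\<theta> - \<theta>0\<bar> < d4 \<Longrightarrow>
      dist (orb ws \<theta> \<tau>) (geod G p u s) < d3"
    by (rule eventually_nhds_realpair) auto
  have "stable \<theta>0 (?\<sigma> # ws) t' \<rho>2"
    unfolding stable_def
  proof (intro allI impI)
    fix \<epsilon> :: real assume \<epsilon>: "\<epsilon> > 0"
    \<comment> \<open>Half of \<open>m\<close> becomes \<open>\<eta>\<close>; then the whole window
      of width \<open>2 * \<eta>\<close> around \<open>t'\<close> fits into the range
      \<open>\<rho>1\<close> that is free of the rim before a hit.\<close>
    define m where "m = Min {\<epsilon>, d1, d2, d4, \<rho>1, 1, t' - t}"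
    have "m \<le> c" if "c \<in> {\<epsilon>, d1, d2, d4, \<rho>1, 1, t' - t}" for c
      unfolding m_def using that by (intro Min_le) auto
    then have "m \<le> \<epsilon>" "m \<le> d1" "m \<le> d2" "m \<le> d4" "m \<le> \<rho>1" "m \<le> 1" "m \<le> t' - t"
      by simp_all
    moreover have "0 < m" unfolding m_def using \<epsilon> d1(1) d2(1) d4(1) \<rho>1 t by simp
    moreover define \<eta> where "\<eta> = m / 2"
    ultimately have \<eta>: "0 < \<eta>" "\<eta> < \<epsilon>" "\<eta> < d1" "\<eta> < d2" "\<eta> < d4" "2 * \<eta> \<le> \<rho>1" "\<eta> < 1" "\<eta> < t' - t"
      by simp_all
    define f where "f = (\<lambda>\<theta> \<tau>. height ?\<sigma> (orb ws \<theta> \<tau>))"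
    have f: "f \<theta>0 (t' + q) = sn q * B (vel ws \<theta>0 t') (normal ?\<sigma>)" for q
      unfolding f_def using height_orb[OF ws \<sigma>(1)] h0 by simp
    have "B (vel ws \<theta>0 t') (normal ?\<sigma>) \<noteq> 0" by (rule transversal[OF \<theta>0 ws \<sigma>(1) h0])
    moreover have "sn \<eta> > 0" using \<eta> by (intro sn_pos) auto
    ultimately have "0 < (sn \<eta> * B (vel ws \<theta>0 t') (normal ?\<sigma>))\<^sup>2" by simp
    then have neg: "f \<theta>0 (t' - \<eta>) * f \<theta>0 (t' + \<eta>) < 0"
      using f[of "- \<eta>"] f[of \<eta>] by (simp add: power2_eq_square)
    have "open {\<theta>. f \<theta> (t' - \<eta>) * f \<theta> (t' + \<eta>) < 0}"
      unfolding f_def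
      by (intro open_Collect_less continuous_on_mult continuous_height continuous_orb
          continuous_on_id continuous_on_const)
    then obtain d5 where d5: "d5 > 0" "ball \<theta>0 d5 \<subseteq> {\<theta>. f \<theta> (t' - \<eta>) * f \<theta> (t' + \<eta>) < 0}"
      using openE[of _ \<theta>0] neg by blast
    obtain d6 where d6: "d6 > 0" "\<And>\<theta>. \<bar>\<theta> - \<theta>0\<bar> < d6 \<Longrightarrow>
      \<exists>\<tau><t' - \<eta>. bounces \<theta> \<tau> (orb ws \<theta> \<tau>) (vel ws \<theta> \<tau>) \<and>
        (\<forall>q. \<tau> < q \<and> q \<le> t' - \<eta> \<longrightarrow> orb ws \<theta> q \<in> inside)"
      by (rule stable_advance[OF st \<rho> ws, of "t' - \<eta>" "t' - \<eta>"]) (use \<eta> int in auto)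
    have "\<exists>\<tau>. \<bar>\<tau> - t'\<bar> < \<epsilon> \<and> bounces \<theta> \<tau> (orb (?\<sigma> # ws) \<theta> \<tau>) (vel (?\<sigma> # ws) \<theta> \<tau>) \<and>
        (\<forall>q. 0 < q \<and> q < \<rho>2 \<longrightarrow> orb (?\<sigma> # ws) \<theta> (\<tau> + q) \<notin> rim)"
      if \<theta>: "\<bar>\<theta> - \<theta>0\<bar> < d1" "\<bar>\<theta> - \<theta>0\<bar> < d2" "\<bar>\<theta> - \<theta>0\<bar> < d4" "\<bar>\<theta> - \<theta>0\<bar> < d5" "\<bar>\<theta> - \<theta>0\<bar> < d6" for \<theta>
    proof -
      obtain \<tau> where \<tau>: "\<tau> < t' - \<eta>" and b: "bounces \<theta> \<tau> (orb ws \<theta> \<tau>) (vel ws \<theta> \<tau>)"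
        and early: "\<And>q. \<tau> < q \<Longrightarrow> q \<le> t' - \<eta> \<Longrightarrow> orb ws \<theta> q \<in> inside"
        using d6(2)[OF \<theta>(5)] by blast
      have pts: "orb ws \<theta> q \<in> pts G" for q by (rule bounce_orb_pts[OF ws b])
      have "f \<theta> (t' - \<eta>) * f \<theta> (t' + \<eta>) < 0"
        using d5(2) \<theta>(4) by (auto simp: subset_iff dist_real_def abs_minus_commute)
      moreover have "continuous_on {t' - \<eta>..t' + \<eta>} (f \<theta>)"
        unfolding f_def by (intro continuous_height continuous_orb continuous_on_id continuous_on_const)
      ultimately obtain \<tau>' where \<tau>': "t' - \<eta> < \<tau>'" "\<tau>' < t' + \<eta>" "f \<theta> \<tau>' = 0"
        using \<eta>(1) by (elim sign_change_root) auto
      have \<tau>'': "\<bar>\<tau>' - t'\<bar> < \<eta>" and h: "height ?\<sigma> (orb ws \<theta> \<tau>') = 0" using \<tau>' by (auto simp: f_def)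
      \<comment> \<open>The root \<open>\<tau>'\<close> is the next hit and not a later one:
        stability keeps the orbit inside up to \<open>t' - \<eta>\<close>, and from there on
        \<open>leaves_rim\<close>, read backwards in time from \<open>\<tau>'\<close>, excludes an
        earlier contact.\<close>
      have norim: "orb ws \<theta> q \<notin> rim" if "q \<in> {\<tau><..<\<tau>'}" for q
      proof (cases "q \<le> t' - \<eta>")
        case True
        then show ?thesis using early that rim_eq by auto
      next
        case False
        then have "0 < \<bar>q - \<tau>'\<bar>" "\<bar>q - \<tau>'\<bar> < \<rho>1" using that \<tau>' \<eta>(6) by auto
        moreover have "\<bar>\<tau>' - t'\<bar> < d1" using \<tau>'' \<eta>(3) by linarith
        ultimately have "orb ws \<theta> (\<tau>' + (q - \<tau>')) \<notin> rim"
          using d1(2)[OF _ \<theta>(1) h] by blast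
        then show ?thesis by simp
      qed
      have inn: "orb ws \<theta> q \<in> inside" if "\<tau> < q" "q < \<tau>'" for q
      proof (rule stays_inner[of "{\<tau><..<\<tau>'}" "orb ws \<theta>" "t' - \<eta>"])
        show "continuous_on {\<tau><..<\<tau>'} (orb ws \<theta>)"
          using continuous_orb(1)[OF continuous_on_const continuous_on_id] by simp
        show "orb ws \<theta> (t' - \<eta>) \<in> inside" using early \<tau> by auto
      qed (use norim pts that \<tau> \<tau>' in auto)
      have "dist (orb ws \<theta> \<tau>') (geod G p u s) < d3" using \<tau>'' \<eta>(5) by (intro d4(2) \<theta>(3)) auto
      then obtain s' where s': "\<bar>s' - s\<bar> < e" "orb ws \<theta> \<tau>' = geod G p u s'"
        using d3(2)[OF pts _ h] by blast
      have "bounces \<theta> \<tau>' (orb (?\<sigma> # ws) \<theta> \<tau>') (vel (?\<sigma> # ws) \<theta> \<tau>')"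
        by (rule bounce_hit[OF ws b _ inn \<sigma>(1) _ _ s'(2)]) (use \<tau> \<tau>' s' in \<open>auto simp: e_def\<close>)
      moreover have "\<forall>q. 0 < q \<and> q < \<rho>2 \<longrightarrow> orb (?\<sigma> # ws) \<theta> (\<tau>' + q) \<notin> rim"
      proof -
        have "\<bar>\<tau>' - t'\<bar> < d2" using \<tau>'' \<eta>(4) by linarith
        from d2(2)[OF this \<theta>(2) h] show ?thesis by simp
      qed
      ultimately show ?thesis using \<tau>'' \<eta>(2) by (intro exI[of _ \<tau>']) auto
    qed
    then show "\<exists>d>0. \<forall>\<theta>. \<bar>\<theta> - \<theta>0\<bar> < d \<longrightarrow>
        (\<exists>\<tau>. \<bar>\<tau> - t'\<bar> < \<epsilon> \<and> bounces \<theta> \<tau> (orb (?\<sigma> # ws) \<theta> \<tau>) (vel (?\<sigma> # ws) \<theta> \<tau>) \<and>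
        (\<forall>q. 0 < q \<and> q < \<rho>2 \<longrightarrow> orb (?\<sigma> # ws) \<theta> (\<tau> + q) \<notin> rim))"
      using d1(1) d2(1) d4(1) d5(1) d6(1)
      by (intro exI[of _ "min d1 (min d2 (min d4 (min d5 d6)))"]) simp
  qed
  then show ?thesis using \<rho>2 by blast
qed

text \<open>All orbits start at the same point, so the sides through \<open>x\<close> have height 0
  at time 0 for every direction, and \<open>leaves_rim\<close> treats interior points, side points
  and corners alike.\<close>

lemma start_off_rim:
  assumes \<theta>0: "\<theta>0 \<notin> tangential"
  obtains \<rho> d where "\<rho> > 0" "d > 0"
    "\<And>\<theta> q. \<bar>\<theta> - \<theta>0\<bar> < d \<Longrightarrow> 0 < q \<Longrightarrow> q < \<rho> \<Longrightarrow> orb [] \<theta> q \<notin> rim"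
proof -
  obtain \<rho> where \<rho>: "\<rho> > 0" and 1: "eventually (\<lambda>(\<tau>, \<theta>).
      (\<forall>\<sigma>\<in>S. orb [] \<theta>0 0 \<in> side_set G \<sigma> \<longrightarrow> height \<sigma> (orb [] \<theta> \<tau>) = 0) \<longrightarrow>
      (\<forall>q. 0 < \<bar>q\<bar> \<and> \<bar>q\<bar> < \<rho> \<longrightarrow> orb [] \<theta> (\<tau> + q) \<notin> rim)) (nhds (0, \<theta>0))"
    by (rule leaves_rim[OF \<theta>0, of "[]"]) simp
  have o: "orb [] \<theta> 0 = x" for \<theta> by (simp add: orb_def)
  obtain d where d: "d > 0" "\<And>\<tau> \<theta>. \<bar>\<tau> - 0\<bar> < d \<Longrightarrow> \<bar>\<theta> - \<theta>0\<bar> < d \<Longrightarrow>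
      (\<forall>\<sigma>\<in>S. orb [] \<theta>0 0 \<in> side_set G \<sigma> \<longrightarrow> height \<sigma> (orb [] \<theta> \<tau>) = 0) \<longrightarrow>
      (\<forall>q. 0 < \<bar>q\<bar> \<and> \<bar>q\<bar> < \<rho> \<longrightarrow> orb [] \<theta> (\<tau> + q) \<notin> rim)"
    by (rule eventually_nhds_realpair[OF 1]) auto
  have hz: "\<forall>\<sigma>\<in>S. orb [] \<theta>0 0 \<in> side_set G \<sigma> \<longrightarrow> height \<sigma> (orb [] \<theta> 0) = 0" for \<theta>
    unfolding o using height_side_set[OF side] by blast
  have "\<bar>0 - 0 :: real\<bar> < d" using d(1) by simp
  then have "orb [] \<theta> q \<notin> rim" if "\<bar>\<theta> - \<theta>0\<bar> < d" "0 < q" "q < \<rho>" for \<theta> q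
    using mp[OF d(2)[OF _ that(1)] hz] that(2,3) by simp
  then show ?thesis using that \<rho> d(1) by blast
qed

lemma bounce_stable:
  assumes \<theta>0: "\<theta>0 \<notin> tangential" and "bounces \<theta>0 t y w"
  shows "\<exists>ws \<rho>. set ws \<subseteq> S \<and> y = orb ws \<theta>0 t \<and> w = vel ws \<theta>0 t \<and> \<rho> > 0 \<and> stable \<theta>0 ws t \<rho>"
  using assms(2)
proof (induction rule: bounce.induct)
  case start
  obtain \<rho> d where \<rho>: "\<rho> > 0" and d: "d > 0"
    "\<And>\<theta> q. \<bar>\<theta> - \<theta>0\<bar> < d \<Longrightarrow> 0 < q \<Longrightarrow> q < \<rho> \<Longrightarrow> orb [] \<theta> q \<notin> rim"
    by (rule start_off_rim[OF \<theta>0]) blast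
  have o: "orb [] \<theta> 0 = x" "vel [] \<theta> 0 = dir e1 e2 \<theta>" for \<theta> by (simp_all add: orb_def vel_def)
  have "stable \<theta>0 [] 0 \<rho>"
    unfolding stable_def using d bounce.start[of G P S x] o
    by (intro allI impI exI[of _ d] conjI exI[of _ "0 :: real"]) auto
  then show ?case using \<rho> o by (intro exI[of _ "[]"]) auto
next
  case (reflect t y w r p u l s)
  then obtain ws \<rho> where ws: "set ws \<subseteq> S" and yw: "y = orb ws \<theta>0 t" "w = vel ws \<theta>0 t"
    and st: "\<rho> > 0" "stable \<theta>0 ws t \<rho>" by blast
  let ?\<sigma> = "(p, u, l)"
  have pos: "geod G y w q = orb ws \<theta>0 (t + q)" for q using orb_add[OF ws] yw by simp
  have hit: "orb ws \<theta>0 (t + r) = geod G p u s" using pos reflect.hyps(7) by simp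
  have h: "height ?\<sigma> (orb ws \<theta>0 (t + r)) = 0"
    unfolding hit by (rule height_side[OF side[OF reflect.hyps(4)]])
  have int: "orb ws \<theta>0 q \<in> inside" if "t < q" "q < t + r" for q
    using reflect.hyps(3)[rule_format, of "q - t"] pos[of "q - t"] that by simp
  obtain \<rho>' where "\<rho>' > 0" "stable \<theta>0 (?\<sigma> # ws) (t + r) \<rho>'"
    using stable_hit[OF \<theta>0 st(2,1) ws _ int reflect.hyps(4-6) hit] reflect.hyps(2) by auto
  moreover have "y \<in> pts G" "w \<in> unit_tangent G y"
    using bounce_orb[OF reflect.hyps(1)] by auto
  then have "reflect_along G (vector_derivative (geod G p u) (at s)) (vector_derivative (geod G y w) (at r)) =
      vel (?\<sigma> # ws) \<theta>0 (t + r)"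
    using reflect_along_mirror_lin[OF reflect.hyps(4) _ _ reflect.hyps(7)] vel_add[OF ws] yw
    by (simp add: vel_hit)
  moreover have "geod G y w r = orb (?\<sigma> # ws) \<theta>0 (t + r)" using pos orb_hit[OF h] by simp
  ultimately show ?case
    using ws reflect.hyps(4) by (intro exI[of _ "?\<sigma> # ws"] exI[of _ \<rho>']) auto
qed

section \<open>The billiard exponential map near a regular point\<close>

text \<open>\<open>bounce\<close> has its start built in. The single step as a relation on states
  can be iterated from any state, so single-valuedness makes two histories comparable by
  confluence.\<close>

definition hit_step :: "((real \<times> 'a \<times> 'a) \<times> (real \<times> 'a \<times> 'a)) set" where
  "hit_step = {((t, y, w), (t + r, geod G y w r,
       reflect_along G (vector_derivative (geod G p u) (at s)) (vector_derivative (geod G y w) (at r))))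
     | t y w r p u l s. 0 < r \<and> (\<forall>q. 0 < q \<and> q < r \<longrightarrow> geod G y w q \<in> inside) \<and>
       (p, u, l) \<in> S \<and> 0 < s \<and> s < l \<and> geod G y w r = geod G p u s}"

lemma bounce_hit_step: "bounces \<theta> t y w \<Longrightarrow> ((0, x, dir e1 e2 \<theta>), (t, y, w)) \<in> hit_step\<^sup>*"
proof (induction rule: bounce.induct)
  case (reflect t y w r p u l s)
  then have "((t, y, w), (t + r, geod G y w r,
       reflect_along G (vector_derivative (geod G p u) (at s)) (vector_derivative (geod G y w) (at r)))) \<in> hit_step"
    unfolding hit_step_def by blast
  with reflect.IH show ?case by (rule rtrancl_into_rtrancl)
qed simp

lemma on_rim: "(p, u, l) \<in> S \<Longrightarrow> 0 < s \<Longrightarrow> s < l \<Longrightarrow> geod G p u s \<in> rim"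
  unfolding rim_def by (rule UN_I[of "(p, u, l)"]) (auto simp: side_set_def)

text \<open>The hit time is the first exit from \<open>inside\<close>, the side is unique away from
  end points, and injectivity fixes \<open>s\<close>, on which the reflecting tangent direction
  depends.\<close>

lemma single_valued_hit_step: "single_valued hit_step"
proof (rule single_valuedI)
  fix a b c assume "(a, b) \<in> hit_step" "(a, c) \<in> hit_step"
  then obtain t y w r p u l s r' p' u' l' s' where a: "a = (t, y, w)"
    and b: "b = (t + r, geod G y w r,
       reflect_along G (vector_derivative (geod G p u) (at s)) (vector_derivative (geod G y w) (at r)))"
    and c: "c = (t + r', geod G y w r',
       reflect_along G (vector_derivative (geod G p' u') (at s')) (vector_derivative (geod G y w) (at r')))"
    and r: "0 < r" "\<And>q. 0 < q \<Longrightarrow> q < r \<Longrightarrow> geod G y w q \<in> inside"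
    and r': "0 < r'" "\<And>q. 0 < q \<Longrightarrow> q < r' \<Longrightarrow> geod G y w q \<in> inside"
    and \<sigma>: "(p, u, l) \<in> S" "0 < s" "s < l" and \<sigma>': "(p', u', l') \<in> S" "0 < s'" "s' < l'"
    and hit: "geod G y w r = geod G p u s" and hit': "geod G y w r' = geod G p' u' s'"
    unfolding hit_step_def by auto
  have "geod G y w r \<notin> inside" "geod G y w r' \<notin> inside"
    using on_rim[OF \<sigma>] on_rim[OF \<sigma>'] hit hit' rim_eq by auto
  then have [simp]: "r' = r" using r r' by (metis linorder_neqE_linordered_idom)
  have "geod G p u s \<in> side_set G (p', u', l')" using hit hit' \<sigma>' by (force simp: side_set_def)
  then have [simp]: "p' = p" "u' = u" "l' = l" using only_side[OF \<sigma> \<sigma>'(1)] by auto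
  have "inj_on (geod G p u) {0..<l}" using side[OF \<sigma>(1)] by (simp add: is_side_def)
  then have "s' = s" using hit hit' \<sigma> \<sigma>' by (auto dest: inj_onD)
  then show "b = c" by (simp add: b c)
qed

lemma hit_step_time: "((t, y, w), (t', y', w')) \<in> hit_step\<^sup>* \<Longrightarrow> t \<le> t'"
proof (induction "(t', y', w')" arbitrary: t' y' w' rule: rtrancl_induct)
  case (step b)
  then show ?case by (cases b) (fastforce simp: hit_step_def)
qed simp

lemma hit_step_exit:
  assumes "((t, y, w), (t', y', w')) \<in> hit_step\<^sup>*" "(t, y, w) \<noteq> (t', y', w')"
  shows "\<exists>r>0. t + r \<le> t' \<and> geod G y w r \<notin> inside"
  using assms(1)
proof (cases rule: converse_rtranclE)
  case (step c)
  then obtain r p u l s where "c = (t + r, geod G y w r,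
       reflect_along G (vector_derivative (geod G p u) (at s)) (vector_derivative (geod G y w) (at r)))"
    and "0 < r" "(p, u, l) \<in> S" "0 < s" "s < l" "geod G y w r = geod G p u s"
    unfolding hit_step_def by auto
  moreover from this have "t + r \<le> t'" using hit_step_time step(2) by auto
  ultimately show ?thesis using on_rim[of p u l s] rim_eq by (intro exI[of _ r]) auto
qed (use assms in auto)

text \<open>By confluence one history continues the other; if they differed, the shorter one would
  leave \<open>inside\<close> at its next hit, before \<open>T\<close>.\<close>

lemma last_bounce_unique:
  assumes "bounces \<theta> t y w" "t < T" "\<And>q. 0 < q \<Longrightarrow> q < T - t \<Longrightarrow> geod G y w q \<in> inside"
    and "bounces \<theta> t' y' w'" "t' < T" "\<And>q. 0 < q \<Longrightarrow> q < T - t' \<Longrightarrow> geod G y' w' q \<in> inside"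
  shows "(t, y, w) = (t', y', w')"
proof (rule ccontr)
  assume ne: "(t, y, w) \<noteq> (t', y', w')"
  have "((t, y, w), (t', y', w')) \<in> hit_step\<^sup>* \<or> ((t', y', w'), (t, y, w)) \<in> hit_step\<^sup>*"
    using single_valued_confluent[OF single_valued_hit_step] bounce_hit_step assms(1,4) by blast
  then show False
  proof
    assume "((t, y, w), (t', y', w')) \<in> hit_step\<^sup>*"
    then obtain r where "r > 0" "t + r \<le> t'" "geod G y w r \<notin> inside" using hit_step_exit ne by blast
    then show False using assms(3)[of r] assms(5) by auto
  next
    assume "((t', y', w'), (t, y, w)) \<in> hit_step\<^sup>*"
    then obtain r where "r > 0" "t' + r \<le> t" "geod G y' w' r \<notin> inside"
      using hit_step_exit[OF _ ne[symmetric]] by blast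
    then show False using assms(6)[of r] assms(2) by auto
  qed
qed

abbreviation at_time :: "real \<Rightarrow> real \<Rightarrow> 'a \<Rightarrow> bool" where
  "at_time \<theta> t \<equiv> billiard_at G P S x (dir e1 e2 \<theta>) t"

lemma billiard_at_unique:
  assumes "at_time \<theta> t z" "at_time \<theta> t z'" shows "z = z'"
proof -
  obtain t0 y w where 1: "bounces \<theta> t0 y w" "t0 < t"
    "\<And>q. 0 < q \<Longrightarrow> q < t - t0 \<Longrightarrow> geod G y w q \<in> inside" "z = geod G y w (t - t0)"
    using assms(1) unfolding billiard_at_def by blast
  obtain t1 y' w' where 2: "bounces \<theta> t1 y' w'" "t1 < t"
    "\<And>q. 0 < q \<Longrightarrow> q < t - t1 \<Longrightarrow> geod G y' w' q \<in> inside" "z' = geod G y' w' (t - t1)"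
    using assms(2) unfolding billiard_at_def by blast
  show ?thesis using last_bounce_unique[OF 1(1-3) 2(1-3)] 1(4) 2(4) by simp
qed

abbreviation bexp :: "real \<times> real \<Rightarrow> 'a" where
  "bexp \<equiv> billiard_exp G P S x e1 e2"

lemma at_time_orb:
  assumes "set ws \<subseteq> S" "bounces \<theta> \<tau> (orb ws \<theta> \<tau>) (vel ws \<theta> \<tau>)" "\<tau> < t"
    and "\<And>q. \<tau> < q \<Longrightarrow> q < t \<Longrightarrow> orb ws \<theta> q \<in> inside"
  shows "at_time \<theta> t (orb ws \<theta> t)"
  unfolding billiard_at_def
  using assms(2-4)
  by (intro exI[of _ \<tau>] exI[of _ "orb ws \<theta> \<tau>"] exI[of _ "vel ws \<theta> \<tau>"]) (simp add: orb_add[OF assms(1)])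

lemma bexp_eq: "at_time \<theta> t z \<Longrightarrow> bexp (t, \<theta>) = z"
  unfolding billiard_exp_def using billiard_at_unique by (auto intro: the_equality)

section \<open>Regular points and the Jacobian\<close>

definition regular :: "real \<times> real \<Rightarrow> bool" where
  "regular = (\<lambda>(t, \<theta>). \<theta> \<notin> tangential \<and>
     (\<forall>ws\<in>{ws. set ws \<subseteq> S}. \<forall>\<sigma>\<in>S. height \<sigma> (orb ws \<theta> t) \<noteq> 0))"

lemma inner_or_rim:
  assumes ws: "set ws \<subseteq> S" and "\<tau> < t" and int: "\<And>q. \<tau> < q \<Longrightarrow> q < t \<Longrightarrow> orb ws \<theta> q \<in> inside"
  shows "orb ws \<theta> t \<in> P"
proof (rule ccontr)
  assume *: "orb ws \<theta> t \<notin> P"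
  have "open (orb ws \<theta> -` (- P))"
    using P_closed by (intro open_vimage open_Compl continuous_orb continuous_on_const continuous_on_id)
  moreover have "t \<in> orb ws \<theta> -` (- P)" using * by simp
  ultimately obtain d where d: "d > 0" "ball t d \<subseteq> orb ws \<theta> -` (- P)" by (rule openE)
  define q where "q = max ((t + \<tau>) / 2) (t - d / 2)"
  have q: "\<tau> < q" "q < t" "\<bar>t - q\<bar> < d"
    using d(1) \<open>\<tau> < t\<close> by (auto simp: q_def max_def abs_if field_simps)
  then have "orb ws \<theta> q \<notin> P" using d(2) by (auto simp: subset_iff dist_real_def)
  then show False using int[OF q(1,2)] inner_subset by blast
qed

text \<open>At a regular time the orbit is not on the rim, so it continues a little beyond
  \<open>t\<close>. By stability all nearby orbits then follow the same word at all times near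
  \<open>t\<close>.\<close>

lemma bexp_local:
  assumes reg: "regular (t, \<theta>0)" and "at_time \<theta>0 t z"
  shows "\<exists>ws. set ws \<subseteq> S \<and> eventually (\<lambda>p. bexp p = orb ws (snd p) (fst p)) (nhds (t, \<theta>0))"
proof -
  have \<theta>0: "\<theta>0 \<notin> tangential" using reg by (simp add: regular_def)
  obtain t0 y w where b: "bounces \<theta>0 t0 y w" and t0: "t0 < t"
    and int: "\<And>q. 0 < q \<Longrightarrow> q < t - t0 \<Longrightarrow> geod G y w q \<in> inside"
    using assms(2) unfolding billiard_at_def by blast
  obtain ws \<rho> where ws: "set ws \<subseteq> S" and yw: "y = orb ws \<theta>0 t0" "w = vel ws \<theta>0 t0"
    and \<rho>: "\<rho> > 0" and st: "stable \<theta>0 ws t0 \<rho>"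
    using bounce_stable[OF \<theta>0 b] by blast
  have int': "orb ws \<theta>0 q \<in> inside" if "t0 < q" "q < t" for q
    using int[of "q - t0"] that orb_add[OF ws, of \<theta>0 t0 "q - t0"] yw by simp
  have "orb ws \<theta>0 t \<notin> rim"
  proof
    assume "orb ws \<theta>0 t \<in> rim"
    then obtain \<sigma> where "\<sigma> \<in> S" "orb ws \<theta>0 t \<in> side_set G \<sigma>" by (auto simp: rim_def)
    then have "height \<sigma> (orb ws \<theta>0 t) = 0" using height_side_set[OF side] by blast
    then show False using reg ws \<open>\<sigma> \<in> S\<close> by (auto simp: regular_def)
  qed
  then have inn: "orb ws \<theta>0 t \<in> inside"
    using inner_or_rim[OF ws t0 int'] rim_eq by auto
  obtain U where U: "open U" "inside = pts G \<inter> U" by (rule inner_open)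
  have "open (orb ws \<theta>0 -` U)"
    using U(1) by (intro open_vimage continuous_orb continuous_on_const continuous_on_id)
  moreover have "t \<in> orb ws \<theta>0 -` U" using inn U by simp
  ultimately obtain d where d: "d > 0" "ball t d \<subseteq> orb ws \<theta>0 -` U" by (rule openE)
  have pts: "orb ws \<theta>0 q \<in> pts G" for q using bounce_orb_pts[OF ws] b yw by simp
  define a where "a = t + d / 2"
  have late: "orb ws \<theta>0 q \<in> inside" if "t0 < q" "q \<le> a" for q
  proof (cases "q < t")
    case False
    then have "q \<in> ball t d" using that d(1) by (auto simp: a_def dist_real_def)
    then show ?thesis using d(2) U(2) pts by auto
  qed (use int' that in auto)
  \<comment> \<open>The midpoint of \<open>t0\<close> and \<open>t\<close> separates the last
    reflections of nearby orbits from the times near \<open>t\<close>.\<close>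
  obtain d' where d': "d' > 0" "\<And>\<theta>. \<bar>\<theta> - \<theta>0\<bar> < d' \<Longrightarrow>
    \<exists>\<tau><(t0 + t) / 2. bounces \<theta> \<tau> (orb ws \<theta> \<tau>) (vel ws \<theta> \<tau>) \<and> (\<forall>q. \<tau> < q \<and> q \<le> a \<longrightarrow> orb ws \<theta> q \<in> inside)"
    by (rule stable_advance[OF st \<rho> ws, of "(t0 + t) / 2" a]) (use late t0 d(1) in \<open>auto simp: a_def\<close>)
  define N where "N = {(t0 + t) / 2 <..< a} \<times> ball \<theta>0 d'"
  have "eventually (\<lambda>p. p \<in> N) (nhds (t, \<theta>0))"
    using t0 d(1) d'(1) unfolding N_def
    by (intro eventually_nhds_in_open open_Times) (auto simp: a_def)
  then have "eventually (\<lambda>p. bexp p = orb ws (snd p) (fst p)) (nhds (t, \<theta>0))"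
  proof eventually_elim
    case (elim p)
    obtain t' \<theta> where p: "p = (t', \<theta>)" by (cases p)
    have \<theta>: "\<bar>\<theta> - \<theta>0\<bar> < d'" and t': "(t0 + t) / 2 < t'" "t' < a"
      using elim by (auto simp: p N_def dist_real_def)
    obtain \<tau> where \<tau>: "\<tau> < (t0 + t) / 2" "bounces \<theta> \<tau> (orb ws \<theta> \<tau>) (vel ws \<theta> \<tau>)"
      "\<And>q. \<tau> < q \<Longrightarrow> q \<le> a \<Longrightarrow> orb ws \<theta> q \<in> inside"
      using d'(2)[OF \<theta>] by blast
    have "at_time \<theta> t' (orb ws \<theta> t')"
      by (rule at_time_orb[OF ws \<tau>(2)]) (use \<tau> t' in auto)
    then show ?case using bexp_eq p by simp
  qed
  then show ?thesis using ws by blast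
qed

text \<open>The angular derivative is the Jacobi field of a rotation of the initial direction, moved
  by the linear part of the unfolding.\<close>

lemma orb_derivative:
  "((\<lambda>p. orb ws (snd p) (fst p)) has_derivative
     (\<lambda>h. fst h *\<^sub>R vel ws \<theta> t + snd h *\<^sub>R (sn t *\<^sub>R unfolding_lin ws (cos \<theta> *\<^sub>R e2 - sin \<theta> *\<^sub>R e1)))) (at (t, \<theta>))"
proof -
  have bl: "bounded_linear (unfolding_lin ws)"
    using linear_unfolding_lin by (simp add: linear_conv_bounded_linear)
  have "((\<lambda>p. cs (fst p) *\<^sub>R x + sn (fst p) *\<^sub>R (cos (snd p) *\<^sub>R e1 + sin (snd p) *\<^sub>R e2)) has_derivative
     (\<lambda>h. fst h *\<^sub>R gvel x (dir e1 e2 \<theta>) t + snd h *\<^sub>R (sn t *\<^sub>R (cos \<theta> *\<^sub>R e2 - sin \<theta> *\<^sub>R e1)))) (at (t, \<theta>))"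
    by (auto intro!: derivative_eq_intros DERIV_compose_FDERIV[OF has_derivative_cs]
          DERIV_compose_FDERIV[OF has_derivative_sn]
          simp: gvel_def dir_def algebra_simps fun_eq_iff)
  from bounded_linear.has_derivative[OF bl this]
  have "((\<lambda>p. unfolding_lin ws (geod G x (dir e1 e2 (snd p)) (fst p)) + unfolding_map ws 0) has_derivative
     (\<lambda>h. fst h *\<^sub>R vel ws \<theta> t + snd h *\<^sub>R (sn t *\<^sub>R unfolding_lin ws (cos \<theta> *\<^sub>R e2 - sin \<theta> *\<^sub>R e1)))) (at (t, \<theta>))"
    by (simp add: geod_eq dir_def vel_def unfolding_lin_add unfolding_lin_scaleR has_derivative_add_const)
  then show ?thesis unfolding orb_def unfolding_map_affine[symmetric] .
qed

text \<open>The velocity is a unit vector orthogonal to the Jacobi field, which has length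
  \<open>\<bar>sn t\<bar>\<close>, and the unfolding preserves the form.\<close>

lemma jacobian_orb:
  assumes ws: "set ws \<subseteq> S" and ev: "eventually (\<lambda>p. f p = orb ws (snd p) (fst p)) (nhds (t, \<theta>))"
  shows "f differentiable (at (t, \<theta>))" "area_jacobian G f (t, \<theta>) = \<bar>sn t\<bar>"
proof -
  let ?m = "cos \<theta> *\<^sub>R e2 - sin \<theta> *\<^sub>R e1"
  let ?b = "sn t *\<^sub>R unfolding_lin ws ?m"
  have sw: "sides ws" using sides ws by blast
  have "eventually (\<lambda>p. orb ws (snd p) (fst p) = f p) (at (t, \<theta>))"
    using ev unfolding eventually_nhds_conv_at by (simp add: eq_commute)
  moreover have "orb ws (snd (t, \<theta>)) (fst (t, \<theta>)) = f (t, \<theta>)"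
    using eventually_nhds_x_imp_x[OF ev] by simp
  ultimately have D: "(f has_derivative (\<lambda>h. fst h *\<^sub>R vel ws \<theta> t + snd h *\<^sub>R ?b)) (at (t, \<theta>))"
    by (intro has_derivative_transform_eventually[OF orb_derivative]) auto
  then show "f differentiable (at (t, \<theta>))" by (auto simp: differentiable_def)
  have a: "frechet_derivative f (at (t, \<theta>)) (1, 0) = vel ws \<theta> t"
    and b: "frechet_derivative f (at (t, \<theta>)) (0, 1) = ?b"
    using frechet_derivative_at[OF D, symmetric] by simp_all
  have "B (vel ws \<theta> t) (vel ws \<theta> t) = 1"
    using gvel_unit_tangent[OF x_pts dir_unit] unfolding vel_def unfolding_lin_form[OF sw]
    by (auto dest: unit_tangentD)
  moreover have "B ?m ?m = 1"
    using frame_unit sin_cos_squared_add3[of \<theta>] by (simp add: B_simps)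
  then have "B ?b ?b = (sn t)\<^sup>2"
    by (simp add: B_simps unfolding_lin_form[OF sw] power2_eq_square)
  moreover have "B (gvel x (dir e1 e2 \<theta>) t) ?m = 0"
    using frame_unit by (auto simp: gvel_def dir_def B_simps)
  then have "B (vel ws \<theta> t) ?b = 0"
    by (simp add: B.scaleR_right vel_def unfolding_lin_form[OF sw])
  ultimately show "area_jacobian G f (t, \<theta>) = \<bar>sn t\<bar>"
    unfolding area_jacobian_def Let_def a b by simp
qed

text \<open>An angle outside \<open>tangential\<close> leaves only countably many bad times for each
  word and side; Fubini and countability of the words do the rest.\<close>

lemma AE_regular: "AE p in lborel. regular p"
proof -
  have "AE p in lborel. height \<sigma> (orb ws (snd p) (fst p)) \<noteq> 0" if ws: "set ws \<subseteq> S" and \<sigma>: "\<sigma> \<in> S" for ws \<sigma>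
  proof (rule AE_lborel_pairI)
    have "open {p :: real \<times> real. height \<sigma> (orb ws (snd p) (fst p)) \<noteq> 0}"
      by (intro open_Collect_neq continuous_height continuous_orb continuous_on_fst continuous_on_snd
            continuous_on_id continuous_on_const)
    then show "Measurable.pred borel (\<lambda>p :: real \<times> real. height \<sigma> (orb ws (snd p) (fst p)) \<noteq> 0)"
      by (simp add: pred_def)
    have "AE \<theta> in lborel. \<theta> \<notin> tangential"
      using countable_imp_null_set_lborel[OF countable_tangential] by (rule AE_not_in)
    then show "AE \<theta> in lborel. AE t in lborel. height \<sigma> (orb ws (snd (t, \<theta>)) (fst (t, \<theta>))) \<noteq> 0"
    proof eventually_elim
      case (elim \<theta>)
      have "AE t in lborel. t \<notin> {t. height \<sigma> (orb ws \<theta> t) = 0}"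
        using countable_imp_null_set_lborel[OF countable_hits[OF elim ws \<sigma>]] by (rule AE_not_in)
      then show ?case by simp
    qed
  qed
  then have "AE p in lborel. \<forall>\<sigma>\<in>S. height \<sigma> (orb ws (snd p) (fst p)) \<noteq> 0" if "set ws \<subseteq> S" for ws
    using that countable_finite[OF finite_S] by (subst AE_ball_countable) auto
  then have "AE p in lborel. \<forall>ws\<in>{ws. set ws \<subseteq> S}. \<forall>\<sigma>\<in>S. height \<sigma> (orb ws (snd p) (fst p)) \<noteq> 0"
    using countable_words by (subst AE_ball_countable) auto
  moreover note AE_angle[OF countable_tangential]
  ultimately show ?thesis by eventually_elim (auto simp: regular_def)
qed

section \<open>Orbits in generic directions never stop\<close>

text \<open>Only positive times count, since \<open>x\<close> itself may be a corner.\<close>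

definition cornered :: "real set" where
  "cornered = {\<theta>. \<exists>ws \<sigma> t. set ws \<subseteq> S \<and> \<sigma> \<in> S \<and> t > 0 \<and> orb ws \<theta> t \<in> side_ends G \<sigma>}"

text \<open>The frame components of \<open>c - x\<close> are \<open>sn t\<close> times cosine and
  sine of the angle, so an unfolded corner fixes the direction up to sign. This breaks down where
  \<open>sn t = 0\<close> and all geodesics from \<open>x\<close> meet again.\<close>

lemma countable_cornered:
  assumes "\<And>ws \<sigma> \<theta> t. set ws \<subseteq> S \<Longrightarrow> \<sigma> \<in> S \<Longrightarrow> t > 0 \<Longrightarrow> orb ws \<theta> t \<in> side_ends G \<sigma> \<Longrightarrow> sn t \<noteq> 0"
  shows "countable cornered"
proof -
  have "countable {\<theta>. \<exists>t. sn t \<noteq> 0 \<and> orb ws \<theta> t = z}" (is "countable ?T") if ws: "set ws \<subseteq> S" for ws z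
  proof -
    define c where "c = unfolding_inv ws z"
    define a b where "a = B (c - x) e1" and "b = B (c - x) e2"
    have ab: "a = sn t * cos \<theta>" "b = sn t * sin \<theta>" if "orb ws \<theta> t = z" for \<theta> t
    proof -
      have "c = geod G x (dir e1 e2 \<theta>) t"
        unfolding c_def that[symmetric] orb_def using sides ws by (intro unfolding_inv_map) auto
      then have c: "c - x = (cs t - 1) *\<^sub>R x + sn t *\<^sub>R dir e1 e2 \<theta>"
        by (simp add: geod_eq algebra_simps)
      have "(cs t - 1) * B x e1 = 0" "(cs t - 1) * B x e2 = 0"
        using frame_unit(5,6) cs_eq_1[of t] by auto
      then show "a = sn t * cos \<theta>" "b = sn t * sin \<theta>"
        unfolding a_def b_def c by (simp_all add: dir_def B_simps frame_unit)
    qed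
    show ?thesis
    proof (cases "a = 0 \<and> b = 0")
      case True
      have "?T = {}"
      proof safe
        fix \<theta> t assume "sn t \<noteq> 0" "z = orb ws \<theta> t"
        then have "cos \<theta> = 0" "sin \<theta> = 0" using ab[of \<theta> t] True by auto
        then show "\<theta> \<in> {}" using sin_cos_squared_add[of \<theta>] by simp
      qed
      then show ?thesis by (simp only: countable_empty)
    next
      case False
      have "?T \<subseteq> {\<theta>. b * cos \<theta> + (- a) * sin \<theta> = 0}" using ab by auto
      then show ?thesis by (rule countable_subset) (use False in \<open>intro countable_trig_zeros, auto\<close>)
    qed
  qed
  moreover have "countable (side_ends G \<sigma>)" for \<sigma> by (cases \<sigma>) (simp add: side_ends_def)
  ultimately have "countable (\<Union>ws\<in>{ws. set ws \<subseteq> S}. \<Union>\<sigma>\<in>S. \<Union>z\<in>side_ends G \<sigma>. {\<theta>. \<exists>t. sn t \<noteq> 0 \<and> orb ws \<theta> t = z})"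
    (is "countable ?U")
    using countable_words countable_finite[OF finite_S] by (intro countable_UN) auto
  moreover have "cornered \<subseteq> ?U"
  proof
    fix \<theta> assume "\<theta> \<in> cornered"
    then obtain ws \<sigma> t where *: "set ws \<subseteq> S" "\<sigma> \<in> S" "t > 0" "orb ws \<theta> t \<in> side_ends G \<sigma>"
      unfolding cornered_def by blast
    then have "sn t \<noteq> 0" by (rule assms)
    with * show "\<theta> \<in> ?U" by blast
  qed
  ultimately show ?thesis by (rule countable_subset[rotated])
qed

lemma off_rim:
  assumes "\<theta> \<notin> tangential" "set ws \<subseteq> S"
  obtains \<rho> where "\<rho> > 0" "\<And>q. 0 < \<bar>q\<bar> \<Longrightarrow> \<bar>q\<bar> < \<rho> \<Longrightarrow> orb ws \<theta> (t + q) \<notin> rim"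
proof -
  obtain \<rho> where \<rho>: "\<rho> > 0" and 1: "eventually (\<lambda>(\<tau>, \<theta>').
      (\<forall>\<sigma>\<in>S. orb ws \<theta> t \<in> side_set G \<sigma> \<longrightarrow> height \<sigma> (orb ws \<theta>' \<tau>) = 0) \<longrightarrow>
      (\<forall>q. 0 < \<bar>q\<bar> \<and> \<bar>q\<bar> < \<rho> \<longrightarrow> orb ws \<theta>' (\<tau> + q) \<notin> rim)) (nhds (t, \<theta>))"
    by (rule leaves_rim[OF assms])
  have "\<forall>\<sigma>\<in>S. orb ws \<theta> t \<in> side_set G \<sigma> \<longrightarrow> height \<sigma> (orb ws \<theta> t) = 0"
    using height_side_set[OF side] by blast
  then show ?thesis using eventually_nhds_x_imp_x[OF 1] that[OF \<rho>] by blast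
qed

section \<open>Continuation of the orbit\<close>

text \<open>A bounce says nothing about the next instant. The last clause records that the orbit
  moves into the interior, which makes the next exit strictly later.\<close>

definition live :: "real \<Rightarrow> 'a side list \<Rightarrow> real \<Rightarrow> bool" where
  "live \<theta> ws t \<longleftrightarrow> set ws \<subseteq> S \<and> 0 \<le> t \<and> bounces \<theta> t (orb ws \<theta> t) (vel ws \<theta> t) \<and>
     (\<exists>\<epsilon>>0. \<forall>q. t < q \<and> q < t + \<epsilon> \<longrightarrow> orb ws \<theta> q \<in> inside)"

text \<open>Near the point of impact only one side is present, and the fan leads from the reversed
  incoming direction to the outgoing one without crossing its line. So the outgoing orbit starts in
  the region the incoming orbit came from.\<close>

lemma reflected_inner:
  assumes \<theta>: "\<theta> \<notin> tangential" and ws: "set ws \<subseteq> S" and t: "t < t'"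
    and b: "bounces \<theta> t (orb ws \<theta> t) (vel ws \<theta> t)"
    and int: "\<And>q. t < q \<Longrightarrow> q < t' \<Longrightarrow> orb ws \<theta> q \<in> inside"
    and \<sigma>: "(p, u, l) \<in> S" "0 < s" "s < l" and hit: "orb ws \<theta> t' = geod G p u s"
  shows "\<exists>\<epsilon>>0. \<forall>q. t' < q \<and> q < t' + \<epsilon> \<longrightarrow> orb ((p, u, l) # ws) \<theta> q \<in> inside"
proof -
  let ?\<sigma> = "(p, u, l)"
  let ?ws = "?\<sigma> # ws"
  have ws': "set ?ws \<subseteq> S" using ws \<sigma> by auto
  have sd: "is_side G ?\<sigma>" by (rule side[OF \<sigma>(1)])
  define z where "z = geod G p u s"
  define w where "w = vel ws \<theta> t'"
  have pts: "orb ws \<theta> q \<in> pts G" for q by (rule bounce_orb_pts[OF ws b])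
  have zp: "z \<in> pts G" and fr: "orthonormal_frame G z (gvel p u s) (normal ?\<sigma>)"
    using side_frame[OF sd] by (auto simp: z_def)
  have hz: "height ?\<sigma> z = 0" unfolding z_def by (rule height_side[OF sd])
  then have h: "height ?\<sigma> (orb ws \<theta> t') = 0" using hit z_def by simp
  have wn: "B w (normal ?\<sigma>) \<noteq> 0" unfolding w_def by (rule transversal[OF \<theta> ws \<sigma>(1) h])
  have wz: "w \<in> unit_tangent G z"
  proof -
    have "gvel (orb ws \<theta> t) (vel ws \<theta> t) (t' - t) \<in> unit_tangent G (geod G (orb ws \<theta> t) (vel ws \<theta> t) (t' - t))"
      by (rule gvel_unit_tangent[OF bounce_orb_tangent[OF b]])
    then show ?thesis by (simp add: vel_add[OF ws] orb_add[OF ws] hit z_def w_def)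
  qed
  obtain f where f: "continuous_on {0..1 :: real} f" "f 0 = - w" "f 1 = w - (2 * B w (normal ?\<sigma>)) *\<^sub>R normal ?\<sigma>"
    "\<And>i. f i \<in> unit_tangent G z" "\<And>i. B (f i) (normal ?\<sigma>) \<noteq> 0"
    by (rule fan[OF fr zp wz wn]) blast
  have f1: "f 1 = vel ?ws \<theta> t'" using f(3) by (simp add: vel_hit mirror_lin_def w_def)
  have oz: "orb ?ws \<theta> t' = z" using orb_hit[OF h] hit by (simp add: z_def)
  define K where "K = (\<Union>\<sigma>'\<in>S - {?\<sigma>}. side_set G \<sigma>')"
  have "closed K" unfolding K_def using finite_S compact_side
    by (intro closed_UN) (auto intro: compact_imp_closed)
  moreover have "z \<notin> K" unfolding K_def z_def using only_side[OF \<sigma>] by blast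
  ultimately obtain d where d: "d > 0" "ball z d \<subseteq> - K" using openE[of "- K" z] by auto
  obtain q0 where q0: "q0 > 0"
    "\<And>v q. v \<in> unit_tangent G z \<Longrightarrow> z \<in> pts G \<Longrightarrow> 0 < q \<Longrightarrow> q < q0 \<Longrightarrow> dist (geod G z v q) z < d"
    by (rule geod_near[OF d(1), of z]) blast
  obtain \<rho> where \<rho>: "\<rho> > 0" "\<And>q. 0 < \<bar>q\<bar> \<Longrightarrow> \<bar>q\<bar> < \<rho> \<Longrightarrow> orb ?ws \<theta> (t' + q) \<notin> rim"
    by (rule off_rim[OF \<theta> ws', of t']) blast
  \<comment> \<open>Small enough that the fan stays within \<open>d\<close> of \<open>z\<close>,
    \<open>sn q\<close> is positive, the outgoing orbit is still off the rim and
    \<open>t' - q\<close> lies after \<open>t\<close>.\<close>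
  define q where "q = Min {q0, 1, \<rho>, t' - t} / 2"
  have "Min {q0, 1, \<rho>, t' - t} > 0" using q0 \<rho> t by simp
  moreover have "Min {q0, 1, \<rho>, t' - t} \<le> c" if "c \<in> {q0, 1, \<rho>, t' - t}" for c
    using that by (intro Min_le) auto
  then have "Min {q0, 1, \<rho>, t' - t} \<le> q0" "Min {q0, 1, \<rho>, t' - t} \<le> 1"
    "Min {q0, 1, \<rho>, t' - t} \<le> \<rho>" "Min {q0, 1, \<rho>, t' - t} \<le> t' - t" by blast+
  ultimately have q: "0 < q" "q < q0" "q < 1" "q < \<rho>" "q < t' - t" unfolding q_def by linarith+
  have "geod G z (f 1) q \<in> inside"
  proof (rule stays_inner[of "{0..1}" "\<lambda>i. geod G z (f i) q" 0])
    show "continuous_on {0..1} (\<lambda>i. geod G z (f i) q)"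
      unfolding geod_eq using f(1)
      by (intro continuous_on_add continuous_on_scaleR continuous_on_const)
    show "geod G z (f i) q \<in> pts G" for i by (rule geod_pts[OF zp f(4)])
    show "geod G z (f i) q \<notin> rim" for i
    proof
      assume "geod G z (f i) q \<in> rim"
      then obtain \<sigma>' where \<sigma>': "\<sigma>' \<in> S" "geod G z (f i) q \<in> side_set G \<sigma>'" by (auto simp: rim_def)
      have "dist (geod G z (f i) q) z < d" by (rule q0(2)[OF f(4) zp q(1,2)])
      then have "geod G z (f i) q \<notin> K" using d(2) by (auto simp: subset_iff dist_commute)
      then have "\<sigma>' = ?\<sigma>" using \<sigma>' unfolding K_def by blast
      then have "height ?\<sigma> (geod G z (f i) q) = 0" using height_side_set[OF sd] \<sigma>' by simp
      then have "sn q * B (f i) (normal ?\<sigma>) = 0" using height_geod[OF sd] hz by simp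
      then show False using f(5)[of i] sn_pos[of q] q by auto
    qed
    have "orb ws \<theta> (t' - q) = geod G z w (- q)"
      using orb_add[OF ws, of \<theta> t' "- q"] by (simp add: hit z_def w_def)
    then show "geod G z (f 0) q \<in> inside"
      using int[of "t' - q"] q f(2) by (simp add: geod_minus)
  qed auto
  then have inn: "orb ?ws \<theta> (t' + q) \<in> inside"
    using orb_add[OF ws', of \<theta> t' q] f1 oz by simp
  have "bounces \<theta> t' (orb ?ws \<theta> t') (vel ?ws \<theta> t')" by (rule bounce_hit[OF ws b t int \<sigma> hit])
  then have pts': "orb ?ws \<theta> r \<in> pts G" for r by (rule bounce_orb_pts[OF ws'])
  have "orb ?ws \<theta> r \<in> inside" if r: "t' < r" "r < t' + \<rho>" for r
  proof (rule stays_inner[of "{t'<..<t' + \<rho>}" "orb ?ws \<theta>" "t' + q"])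
    show "continuous_on {t'<..<t' + \<rho>} (orb ?ws \<theta>)"
      by (intro continuous_orb continuous_on_const continuous_on_id)
    show "orb ?ws \<theta> i \<notin> rim" if "i \<in> {t'<..<t' + \<rho>}" for i
      using \<rho>(2)[of "i - t'"] that by auto
  qed (use pts' inn q r in auto)
  then show ?thesis using \<rho>(1) by blast
qed

text \<open>The first exit is the infimum of a closed set of times. It is not at a corner because
  the direction is not \<open>cornered\<close>, so it is a reflection, and
  \<open>reflected_inner\<close> lets the orbit go on.\<close>

lemma next_hit:
  assumes \<theta>: "\<theta> \<notin> tangential" "\<theta> \<notin> cornered" and l: "live \<theta> ws t" and q: "t < q" "orb ws \<theta> q \<notin> inside"
  shows "\<exists>t' \<sigma>. t < t' \<and> t' \<le> q \<and> \<sigma> \<in> S \<and> (\<forall>r. t < r \<and> r < t' \<longrightarrow> orb ws \<theta> r \<in> inside) \<and>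
    orb ws \<theta> t' \<in> side_set G \<sigma> \<and> live \<theta> (\<sigma> # ws) t'"
proof -
  obtain \<epsilon> where ws: "set ws \<subseteq> S" and t: "0 \<le> t" and b: "bounces \<theta> t (orb ws \<theta> t) (vel ws \<theta> t)"
    and \<epsilon>: "\<epsilon> > 0" "\<And>q. t < q \<Longrightarrow> q < t + \<epsilon> \<Longrightarrow> orb ws \<theta> q \<in> inside"
    using l unfolding live_def by blast
  have pts: "orb ws \<theta> q \<in> pts G" for q by (rule bounce_orb_pts[OF ws b])
  obtain U where U: "open U" "inside = pts G \<inter> U" by (rule inner_open)
  \<comment> \<open>Starts at \<open>t + \<epsilon>\<close> because the position at \<open>t\<close>
    may itself lie on the rim.\<close>
  define N where "N = {t + \<epsilon>..} \<inter> orb ws \<theta> -` (- U)"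
  have "closed N" unfolding N_def
    using U(1) by (intro closed_Int closed_vimage continuous_orb continuous_on_const continuous_on_id) auto
  have qN: "q \<in> N" using q \<epsilon>(2)[of q] pts U(2) unfolding N_def by (cases "q < t + \<epsilon>") auto
  have bdd: "bdd_below N" by (rule bdd_belowI[of _ "t + \<epsilon>"]) (auto simp: N_def)
  define t' where "t' = Inf N"
  have t'N: "t' \<in> N" unfolding t'_def using qN bdd \<open>closed N\<close> by (intro closed_contains_Inf) auto
  then have t': "t < t'" using \<epsilon> by (auto simp: N_def)
  have t'q: "t' \<le> q" unfolding t'_def by (rule cInf_lower[OF qN bdd])
  have int: "orb ws \<theta> r \<in> inside" if "t < r" "r < t'" for r
  proof (cases "r < t + \<epsilon>")
    case False
    have "r \<notin> N" using cInf_lower[OF _ bdd] that(2) unfolding t'_def by fastforce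
    then show ?thesis using False pts U(2) by (auto simp: N_def)
  qed (use \<epsilon>(2) that in auto)
  have "orb ws \<theta> t' \<in> rim"
    using inner_or_rim[OF ws t' int] t'N U(2) rim_eq by (auto simp: N_def)
  then obtain \<sigma> where \<sigma>: "\<sigma> \<in> S" "orb ws \<theta> t' \<in> side_set G \<sigma>" by (auto simp: rim_def)
  obtain p u l where pul: "\<sigma> = (p, u, l)" by (cases \<sigma>)
  obtain s where s: "0 \<le> s" "s \<le> l" and hit: "orb ws \<theta> t' = geod G p u s"
    using \<sigma>(2) by (auto simp: pul side_set_def)
  have "orb ws \<theta> t' \<notin> side_ends G \<sigma>"
  proof
    assume "orb ws \<theta> t' \<in> side_ends G \<sigma>"
    moreover have "t' > 0" using t t' by simp
    ultimately have "\<theta> \<in> cornered" unfolding cornered_def using ws \<sigma>(1) by blast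
    then show False using \<theta>(2) by blast
  qed
  then have "s \<noteq> 0" "s \<noteq> l" using hit by (auto simp: pul side_ends_def)
  then have s': "0 < s" "s < l" using s by auto
  have \<sigma>S: "(p, u, l) \<in> S" using \<sigma>(1) pul by simp
  have "bounces \<theta> t' (orb (\<sigma> # ws) \<theta> t') (vel (\<sigma> # ws) \<theta> t')"
    unfolding pul by (rule bounce_hit[OF ws b t' int \<sigma>S s' hit])
  then have "live \<theta> (\<sigma> # ws) t'"
    unfolding live_def pul using reflected_inner[OF \<theta>(1) ws t' b int \<sigma>S s' hit] ws \<sigma>S t t' by auto
  then show ?thesis using t' t'q \<sigma> int by blast
qed

text \<open>The constant must not depend on word or direction. The position lies in the compact
  \<open>P\<close> and bounds the velocity, whose ambient norm need not be 1 on the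
  hyperboloid.\<close>

lemma orb_lipschitz:
  obtains L where "L \<ge> 0" "\<And>\<theta> ws t t'. set ws \<subseteq> S \<Longrightarrow> bounces \<theta> t (orb ws \<theta> t) (vel ws \<theta> t) \<Longrightarrow>
    orb ws \<theta> t \<in> P \<Longrightarrow> t \<le> t' \<Longrightarrow> t' \<le> t + T \<Longrightarrow> norm (orb ws \<theta> t' - orb ws \<theta> t) \<le> L * (t' - t)"
proof -
  obtain L where L: "L \<ge> 0" "\<And>r. 0 \<le> r \<Longrightarrow> r \<le> T \<Longrightarrow> \<bar>cs r - 1\<bar> \<le> L * r \<and> \<bar>sn r\<bar> \<le> L * r"
    using cs_sn_lipschitz[of T] by blast
  obtain M where M: "\<And>y. y \<in> P \<Longrightarrow> norm y \<le> M"
    using compact_imp_bounded[OF compact_P] unfolding bounded_iff by blast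
  have M0: "M \<ge> 0" using M[OF base] norm_ge_zero[of x] by linarith
  define L' where "L' = L * M + L * (1 + 2 * M)"
  have "norm (orb ws \<theta> t' - orb ws \<theta> t) \<le> L' * (t' - t)"
    if ws: "set ws \<subseteq> S" and b: "bounces \<theta> t (orb ws \<theta> t) (vel ws \<theta> t)" and y: "orb ws \<theta> t \<in> P"
      and t: "t \<le> t'" "t' \<le> t + T" for \<theta> ws t t'
  proof -
    define r where "r = t' - t"
    have r: "0 \<le> r" "r \<le> T" using t by (auto simp: r_def)
    have "orb ws \<theta> t' - orb ws \<theta> t = (cs r - 1) *\<^sub>R orb ws \<theta> t + sn r *\<^sub>R vel ws \<theta> t"
      using orb_add[OF ws, of \<theta> t r] by (simp add: r_def geod_eq algebra_simps)
    also have "norm \<dots> \<le> \<bar>cs r - 1\<bar> * norm (orb ws \<theta> t) + \<bar>sn r\<bar> * norm (vel ws \<theta> t)"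
      by (rule norm_triangle_le) simp
    also have "\<dots> \<le> (L * r) * M + (L * r) * (1 + 2 * M)"
    proof (intro add_mono mult_mono)
      show "norm (vel ws \<theta> t) \<le> 1 + 2 * M"
        using norm_unit_tangent[OF bounce_orb_tangent[OF b]] M[OF y] by linarith
    qed (use L r M[OF y] in auto)
    finally show ?thesis by (simp add: L'_def r_def algebra_simps)
  qed
  moreover have "L' \<ge> 0" using L(1) M0 by (simp add: L'_def)
  ultimately show ?thesis using that by blast
qed

text \<open>If the reflection times accumulated, the positions would converge to a point \<open>z\<close>, and from
  some moment on only sides through \<open>z\<close> are hit. The reflections in these sides fix \<open>z\<close>, so the
  unfolded orbit runs into an unfolded copy of \<open>z\<close>; this makes \<open>\<theta>\<close> \<open>cornered\<close> if \<open>z\<close> is a corner.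
  Otherwise a single side is hit twice within a short time.\<close>

lemma no_accumulation:
  assumes \<theta>: "\<theta> \<notin> tangential" "\<theta> \<notin> cornered"
    and live: "\<And>n. live \<theta> (ws n) (t n)" and tT: "\<And>n. t n < T" and t_less: "\<And>n. t n < t (Suc n)"
    and ws_Suc: "\<And>n. ws (Suc n) = \<sigma> n # ws n" and hit: "\<And>n. orb (ws n) \<theta> (t (Suc n)) \<in> side_set G (\<sigma> n)"
    and x0: "orb (ws 0) \<theta> (t 0) \<in> P"
  shows False
proof -
  have ws: "set (ws n) \<subseteq> S" and t0: "0 \<le> t n"
    and b: "bounces \<theta> (t n) (orb (ws n) \<theta> (t n)) (vel (ws n) \<theta> (t n))" for n
    using live[of n] by (auto simp: live_def)
  have \<sigma>S: "\<sigma> n \<in> S" for n using ws[of "Suc n"] ws_Suc by auto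
  define y where "y = (\<lambda>n. orb (ws n) \<theta> (t n))"
  have h: "height (\<sigma> n) (orb (ws n) \<theta> (t (Suc n))) = 0" for n
    by (rule height_side_set[OF side[OF \<sigma>S] hit])
  have y_Suc: "y (Suc n) = orb (ws n) \<theta> (t (Suc n))" for n
    unfolding y_def ws_Suc by (rule orb_hit[OF h])
  have y_side: "y (Suc n) \<in> side_set G (\<sigma> n)" for n using hit by (simp add: y_Suc)
  have y_rim: "y (Suc n) \<in> rim" for n using y_side \<sigma>S unfolding rim_def by blast
  have yP: "y n \<in> P" for n
  proof (cases n)
    case 0
    then show ?thesis using x0 by (simp add: y_def)
  next
    case (Suc m)
    then show ?thesis using y_rim[of m] rim_eq by blast
  qed
  have mono: "t m \<le> t n" if "m \<le> n" for m n
    by (rule lift_Suc_mono_le[of t, OF less_imp_le[OF t_less] that])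
  obtain T' where T': "t \<longlonglongrightarrow> T'" "\<And>n. t n \<le> T'"
  proof (rule incseq_convergent[of t T])
    show "incseq t" using mono by (simp add: incseq_def)
    show "\<forall>i. t i \<le> T" using tT less_imp_le by blast
  qed blast
  obtain L where L: "L \<ge> 0" "\<And>\<theta> ws s s'. set ws \<subseteq> S \<Longrightarrow> bounces \<theta> s (orb ws \<theta> s) (vel ws \<theta> s) \<Longrightarrow>
    orb ws \<theta> s \<in> P \<Longrightarrow> s \<le> s' \<Longrightarrow> s' \<le> s + T \<Longrightarrow> norm (orb ws \<theta> s' - orb ws \<theta> s) \<le> L * (s' - s)"
    by (rule orb_lipschitz[of T]) blast
  have vstep: "norm (y (Suc n) - y n) \<le> L * (t (Suc n) - t n)" for n
  proof -
    have "norm (orb (ws n) \<theta> (t (Suc n)) - orb (ws n) \<theta> (t n)) \<le> L * (t (Suc n) - t n)"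
      using ws b yP[of n] t_less[of n] tT[of "Suc n"] t0[of n] by (intro L(2)) (auto simp: y_def)
    then show ?thesis unfolding y_Suc by (simp add: y_def)
  qed
  have tele: "norm (y n - y m) \<le> L * (t n - t m)" if "m \<le> n" for m n
    using that
  proof (induction n rule: dec_induct)
    case (step n)
    have "norm (y (Suc n) - y m) \<le> norm (y (Suc n) - y n) + norm (y n - y m)"
      using norm_triangle_ineq[of "y (Suc n) - y n" "y n - y m"] by simp
    also have "\<dots> \<le> L * (t (Suc n) - t n) + L * (t n - t m)"
      using step.IH vstep[of n] by simp
    finally show ?case by (simp add: algebra_simps)
  qed simp
  have "Cauchy y"
  proof (rule CauchyI)
    fix e :: real assume e: "e > 0"
    have "Cauchy t" using T'(1) LIMSEQ_imp_Cauchy by blast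
    moreover have "e / (L + 1) > 0" using e L(1) by simp
    ultimately obtain N where N: "\<And>m n. m \<ge> N \<Longrightarrow> n \<ge> N \<Longrightarrow> norm (t m - t n) < e / (L + 1)"
      using CauchyD by blast
    have less: "norm (y n - y m) < e" if "N \<le> m" "m \<le> n" for m n
    proof -
      have "norm (y n - y m) \<le> L * (t n - t m)" by (rule tele[OF that(2)])
      also have "\<dots> \<le> (L + 1) * (t n - t m)" using mono[OF that(2)] by (simp add: algebra_simps)
      also have "\<dots> < (L + 1) * (e / (L + 1))"
        using N[of n m] that L(1) by (intro mult_strict_left_mono) auto
      finally show ?thesis using L(1) by simp
    qed
    have "norm (y m - y n) < e" if "N \<le> m" "N \<le> n" for m n
      using less[of m n] less[of n m] that by (cases "m \<le> n") (auto simp: norm_minus_commute)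
    then show "\<exists>M. \<forall>m\<ge>M. \<forall>n\<ge>M. norm (y m - y n) < e" by blast
  qed
  then obtain z where z: "y \<longlonglongrightarrow> z" by (auto simp: Cauchy_convergent_iff convergent_def)
  have "(\<lambda>n. y (Suc n)) \<longlonglongrightarrow> z" using z by (rule LIMSEQ_Suc)
  then have z_rim: "z \<in> rim"
    by (rule closed_sequentially[OF compact_imp_closed[OF compact_rim] y_rim])
  then have zp: "z \<in> pts G" using rim_eq P_pts by blast
  define K where "K = (\<Union>\<sigma>\<in>{\<sigma>\<in>S. z \<notin> side_set G \<sigma>}. side_set G \<sigma>)"
  have "closed K" unfolding K_def using finite_S compact_side
    by (intro closed_UN) (auto intro: compact_imp_closed)
  moreover have "z \<notin> K" by (auto simp: K_def)
  ultimately have "eventually (\<lambda>n. y n \<in> - K) sequentially"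
    using topological_tendstoD[OF z, of "- K"] by auto
  then obtain N where N: "\<And>n. n \<ge> N \<Longrightarrow> y n \<notin> K" by (auto simp: eventually_sequentially)
  have z_side: "z \<in> side_set G (\<sigma> n)" if "n \<ge> N" for n
  proof -
    have "y (Suc n) \<notin> K" using that by (intro N) simp
    then show ?thesis using y_side[of n] \<sigma>S[of n] unfolding K_def by blast
  qed
  show False
  proof (cases "\<exists>\<tau>\<in>S. z \<in> side_ends G \<tau>")
    case True
    then obtain \<tau> where \<tau>: "\<tau> \<in> S" "z \<in> side_ends G \<tau>" by blast
    define c where "c = unfolding_inv (ws N) z"
    \<comment> \<open>From \<open>N\<close> on each new mirror fixes \<open>z\<close>, so its
      unfolded copy no longer moves.\<close>
    have inv: "unfolding_inv (ws n) z = c" if "n \<ge> N" for n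
      using that
    proof (induction n rule: dec_induct)
      case (step n)
      have "height (\<sigma> n) z = 0" by (rule height_side_set[OF side[OF \<sigma>S] z_side[OF step.hyps(1)]])
      then show ?case using step.IH by (simp add: ws_Suc mirror_fixed)
    qed (simp add: c_def)
    have sw: "sides (ws n)" for n using sides ws by blast
    \<comment> \<open>Compared through the form, which the unfoldings preserve;
      \<open>definite\<close> later turns the value 0 into equality of points.\<close>
    have dist_inv: "B (orb (ws n) \<theta> s - z) (orb (ws n) \<theta> s - z) = B (orb [] \<theta> s - c) (orb [] \<theta> s - c)"
      if "n \<ge> N" for n s
    proof -
      have "orb (ws n) \<theta> s - z = unfolding_map (ws n) (orb [] \<theta> s) - unfolding_map (ws n) c"
        using unfolding_map_inv[OF sw, of n z] by (simp add: inv[OF that] orb_def)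
      then show ?thesis by (simp add: unfolding_map_diff unfolding_lin_form[OF sw])
    qed
    have "(\<lambda>n. B (y n - z) (y n - z)) \<longlonglongrightarrow> B (z - z) (z - z)"
      by (rule B.tendsto[OF tendsto_diff[OF z tendsto_const] tendsto_diff[OF z tendsto_const]])
    then have 1: "(\<lambda>n. B (y n - z) (y n - z)) \<longlonglongrightarrow> 0" by (simp add: B.zero_left)
    have "isCont (orb [] \<theta>) T'"
      using continuous_orb(1)[OF continuous_on_const continuous_on_id, of UNIV "[]" \<theta>]
      by (simp add: continuous_on_eq_continuous_at)
    then have "(\<lambda>n. orb [] \<theta> (t n)) \<longlonglongrightarrow> orb [] \<theta> T'" using T'(1) by (rule isCont_tendsto_compose)
    then have 2: "(\<lambda>n. B (orb [] \<theta> (t n) - c) (orb [] \<theta> (t n) - c)) \<longlonglongrightarrow>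
        B (orb [] \<theta> T' - c) (orb [] \<theta> T' - c)"
      using B.tendsto[OF tendsto_diff[OF _ tendsto_const] tendsto_diff[OF _ tendsto_const]] by blast
    have "eventually (\<lambda>n. B (y n - z) (y n - z) = B (orb [] \<theta> (t n) - c) (orb [] \<theta> (t n) - c)) sequentially"
      unfolding eventually_sequentially y_def using dist_inv by blast
    then have "(\<lambda>n. B (y n - z) (y n - z)) \<longlonglongrightarrow> B (orb [] \<theta> T' - c) (orb [] \<theta> T' - c)"
      using 2 by (simp add: tendsto_cong)
    then have "B (orb [] \<theta> T' - c) (orb [] \<theta> T' - c) = 0" using 1 LIMSEQ_unique by blast
    then have "B (orb (ws N) \<theta> T' - z) (orb (ws N) \<theta> T' - z) = 0" using dist_inv[of N] by simp
    then have "orb (ws N) \<theta> T' = z"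
      by (intro definite zp bounce_orb_pts[OF ws b])
    moreover have "T' > 0" using T'(2)[of 1] t_less[of 0] t0[of 0] by simp
    ultimately have "\<theta> \<in> cornered" unfolding cornered_def using ws \<tau> by blast
    then show False using \<theta>(2) by blast
  next
    case False
    obtain p u l where pul: "\<sigma> N = (p, u, l)" by (cases "\<sigma> N")
    obtain s where s: "0 \<le> s" "s \<le> l" and zs: "z = geod G p u s"
      using z_side[of N] by (auto simp: pul side_set_def)
    have "z \<notin> side_ends G (\<sigma> N)" using False \<sigma>S by blast
    then have s': "0 < s" "s < l" using s zs by (auto simp: pul side_ends_def less_le)
    have \<sigma>N: "\<sigma> n = \<sigma> N" if "n \<ge> N" for n
      using only_side[of p u l s "\<sigma> n"] \<sigma>S[of N] \<sigma>S[of n] z_side[OF that] s' zs by (simp add: pul)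
    have "Cauchy t" using T'(1) LIMSEQ_imp_Cauchy by blast
    then obtain M where M: "\<And>m n. m \<ge> M \<Longrightarrow> n \<ge> M \<Longrightarrow> norm (t m - t n) < 1"
      using CauchyD[of t 1] by auto
    define n where "n = max M N"
    \<comment> \<open>The time between two consecutive hits of one side. The height vanishes at
      both, although the velocity is transversal and \<open>sn r\<close> is positive.\<close>
    define r where "r = t (Suc (Suc n)) - t (Suc n)"
    have r: "0 < r" "r < 1"
      using M[of "Suc (Suc n)" "Suc n"] t_less[of "Suc n"] by (auto simp: r_def n_def)
    have "height (\<sigma> N) (y (Suc n)) = 0"
      using h[of n] \<sigma>N[of n] y_Suc by (simp add: n_def)
    then have h1: "height (\<sigma> N) (orb (ws (Suc n)) \<theta> (t (Suc n))) = 0" by (simp add: y_def)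
    have "height (\<sigma> N) (orb (ws (Suc n)) \<theta> (t (Suc n) + r)) = 0"
      using h[of "Suc n"] \<sigma>N[of "Suc n"] by (simp add: n_def r_def)
    then have "sn r * B (vel (ws (Suc n)) \<theta> (t (Suc n))) (normal (\<sigma> N)) = 0"
      using height_orb[OF ws \<sigma>S, of N "Suc n" \<theta> "t (Suc n)" r] h1 by simp
    then show False
      using transversal[OF \<theta>(1) ws \<sigma>S h1] sn_pos[of r] r by simp
  qed
qed

text \<open>If time \<open>T\<close> were not reached, every live state before \<open>T\<close>
  would have another hit before \<open>T\<close>; the resulting chain of hits contradicts
  \<open>no_accumulation\<close>.\<close>

lemma at_time_exists:
  assumes \<theta>: "\<theta> \<notin> tangential" "\<theta> \<notin> cornered" and start: "dir e1 e2 \<theta> \<in> dirs_into G P x" and T: "0 < T"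
  shows "\<exists>z. at_time \<theta> T z"
proof (rule ccontr)
  assume no: "\<not> ?thesis"
  have nxt: "\<exists>s \<sigma>. t < s \<and> s < T \<and> orb ws \<theta> s \<in> side_set G \<sigma> \<and> live \<theta> (\<sigma> # ws) s"
    if l: "live \<theta> ws t" and tT: "t < T" for ws t
  proof -
    have ws: "set ws \<subseteq> S" and b: "bounces \<theta> t (orb ws \<theta> t) (vel ws \<theta> t)"
      using l by (auto simp: live_def)
    obtain q where q: "t < q" "q < T" "orb ws \<theta> q \<notin> inside"
      using at_time_orb[OF ws b tT] no by blast
    then show ?thesis using next_hit[OF \<theta> l q(1,3)] by (meson order.strict_trans1)
  qed
  have live0: "live \<theta> [] 0"
  proof -
    obtain \<epsilon> where "\<epsilon> > 0" "\<And>q. 0 < q \<Longrightarrow> q < \<epsilon> \<Longrightarrow> geod G x (dir e1 e2 \<theta>) q \<in> inside"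
      using start unfolding dirs_into_def by blast
    then show ?thesis
      using bounce.start[of G P S x "dir e1 e2 \<theta>"] by (auto simp: live_def orb_def vel_def)
  qed
  \<comment> \<open>The clause for \<open>n = 0\<close> pins the chain to the start, whose position
    is known to lie in \<open>P\<close>.\<close>
  define good where "good = (\<lambda>(n :: nat) (ws, t). live \<theta> ws t \<and> t < T \<and> (n = 0 \<longrightarrow> ws = [] \<and> t = 0))"
  define nx where "nx = (\<lambda>(n :: nat) (ws, t) (ws', s). \<exists>\<sigma>. t < (s :: real) \<and> orb ws \<theta> s \<in> side_set G \<sigma> \<and> ws' = \<sigma> # ws)"
  obtain f where f: "\<And>n. good n (f n)" "\<And>n. nx n (f n) (f (Suc n))"
  proof -
    have "\<exists>f. \<forall>n. good n (f n) \<and> nx n (f n) (f (Suc n))"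
    proof (rule dependent_nat_choice)
      show "\<exists>a. good 0 a" using live0 T by (intro exI[of _ "([], 0)"]) (simp add: good_def)
      fix a n assume a: "good n a"
      obtain ws t where wt: "a = (ws, t)" by (cases a)
      obtain s \<sigma> where "t < s" "s < T" "orb ws \<theta> s \<in> side_set G \<sigma>" "live \<theta> (\<sigma> # ws) s"
        using nxt[of ws t] a by (auto simp: good_def wt)
      then show "\<exists>c. good (Suc n) c \<and> nx n a c"
        by (intro exI[of _ "(\<sigma> # ws, s)"]) (simp add: good_def nx_def wt del: split_paired_Ex)
    qed
    then show ?thesis using that by blast
  qed
  define ws where "ws = (\<lambda>n. fst (f n))"
  define t where "t = (\<lambda>n. snd (f n))"
  have wt: "f n = (ws n, t n)" for n by (simp add: ws_def t_def)
  have 1: "live \<theta> (ws n) (t n)" "t n < T" for n using f(1)[of n] by (auto simp: good_def wt)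
  have "\<exists>\<sigma>. t n < t (Suc n) \<and> orb (ws n) \<theta> (t (Suc n)) \<in> side_set G \<sigma> \<and> ws (Suc n) = \<sigma> # ws n" for n
    using f(2)[of n] by (auto simp: nx_def wt)
  then obtain \<sigma> where \<sigma>: "\<And>n. t n < t (Suc n)" "\<And>n. orb (ws n) \<theta> (t (Suc n)) \<in> side_set G (\<sigma> n)"
    "\<And>n. ws (Suc n) = \<sigma> n # ws n" by metis
  have "orb (ws 0) \<theta> (t 0) \<in> P"
    using f(1)[of 0] base by (simp add: good_def wt orb_def)
  then show False
    by (rule no_accumulation[where ws = ws and t = t and T = T and \<sigma> = \<sigma>, OF \<theta> 1 \<sigma>(1,3,2)])
qed

section \<open>The pull-back measure\<close>

abbreviation cone :: "(real \<times> real) set" where "cone \<equiv> tangent_cone G P x e1 e2"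

abbreviation domain :: "(real \<times> real) set" where "domain \<equiv> billiard_domain G P S x e1 e2"

text \<open>Pointing into \<open>P\<close> is an open condition except at tangential directions, so
  the set of angles differs from its interior by a countable set. The angle 0 is an end of the
  parameter interval and joins the exceptions.\<close>

lemma cone_borel: "cone \<in> sets borel"
proof -
  define D where "D = {\<theta>. 0 \<le> \<theta> \<and> \<theta> < 2 * pi \<and> dir e1 e2 \<theta> \<in> dirs_into G P x}"
  have "\<theta>0 \<in> interior D" if \<theta>0: "\<theta>0 \<in> D" "\<theta>0 \<notin> tangential" "\<theta>0 \<noteq> 0" for \<theta>0
  proof -
    obtain \<epsilon> where \<epsilon>: "\<epsilon> > 0" "\<And>q. 0 < q \<Longrightarrow> q < \<epsilon> \<Longrightarrow> orb [] \<theta>0 q \<in> inside"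
      using \<theta>0(1) unfolding D_def dirs_into_def orb_Nil by blast
    obtain \<rho> d where \<rho>: "\<rho> > 0" and d: "d > 0"
      "\<And>\<theta> q. \<bar>\<theta> - \<theta>0\<bar> < d \<Longrightarrow> 0 < q \<Longrightarrow> q < \<rho> \<Longrightarrow> orb [] \<theta> q \<notin> rim"
      by (rule start_off_rim[OF \<theta>0(2)]) blast
    \<comment> \<open>At the single time \<open>q0\<close> nearby orbits are inside by
      \<open>inner_tube\<close>; avoiding the rim up to time \<open>\<rho>\<close>, they are inside
      throughout.\<close>
    define q0 where "q0 = min \<epsilon> \<rho> / 2"
    have q0: "0 < q0" "q0 < \<epsilon>" "q0 < \<rho>" using \<epsilon>(1) \<rho> by (auto simp: q0_def min_def)
    obtain d' where d': "d' > 0" "\<And>\<theta> q. \<bar>\<theta> - \<theta>0\<bar> < d' \<Longrightarrow> q0 \<le> q \<Longrightarrow> q \<le> q0 \<Longrightarrow>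
        orb [] \<theta> q \<in> pts G \<Longrightarrow> orb [] \<theta> q \<in> inside"
      by (rule inner_tube[of q0 q0 "[]" \<theta>0]) (use \<epsilon>(2) q0 in auto)
    have pts: "orb [] \<theta> q \<in> pts G" for \<theta> q
      unfolding orb_Nil by (rule geod_pts[OF x_pts dir_unit])
    define m where "m = Min {d, d', \<theta>0, 2 * pi - \<theta>0}"
    have "m > 0" using d(1) d'(1) \<theta>0 by (auto simp: m_def D_def)
    have m: "m \<le> c" if "c \<in> {d, d', \<theta>0, 2 * pi - \<theta>0}" for c
      unfolding m_def using that by (intro Min_le) auto
    have "ball \<theta>0 m \<subseteq> D"
    proof
      fix \<theta> assume "\<theta> \<in> ball \<theta>0 m"
      then have \<theta>m: "\<bar>\<theta> - \<theta>0\<bar> < m" by (simp add: dist_real_def abs_minus_commute)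
      have \<theta>: "\<bar>\<theta> - \<theta>0\<bar> < d" "\<bar>\<theta> - \<theta>0\<bar> < d'" "\<bar>\<theta> - \<theta>0\<bar> < \<theta>0" "\<bar>\<theta> - \<theta>0\<bar> < 2 * pi - \<theta>0"
        using \<theta>m m[of d] m[of d'] m[of \<theta>0] m[of "2 * pi - \<theta>0"] by simp_all
      have "orb [] \<theta> q \<in> inside" if "0 < q" "q < \<rho>" for q
      proof (rule stays_inner[of "{0<..<\<rho>}" "orb [] \<theta>" q0])
        show "continuous_on {0<..<\<rho>} (orb [] \<theta>)"
          by (intro continuous_orb continuous_on_const continuous_on_id)
        show "orb [] \<theta> q0 \<in> inside" using d'(2)[OF \<theta>(2)] pts by simp
      qed (use pts d(2)[OF \<theta>(1)] q0 that in auto)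
      then have "dir e1 e2 \<theta> \<in> dirs_into G P x"
        unfolding dirs_into_def orb_Nil using dir_unit \<rho> by blast
      moreover have "0 \<le> \<theta>" "\<theta> < 2 * pi" using \<theta>(3,4) by linarith+
      ultimately show "\<theta> \<in> D" by (simp add: D_def)
    qed
    then show ?thesis using \<open>m > 0\<close> mem_interior by blast
  qed
  then have "D - interior D \<subseteq> tangential \<union> {0}" by blast
  then have "countable (D - interior D)"
    by (rule countable_subset) (simp add: countable_tangential)
  then have "D - interior D \<in> sets borel" by (rule sets.countable[rotated]) auto
  moreover have "interior D \<in> sets borel" by simp
  ultimately have "(D - interior D) \<union> interior D \<in> sets borel" by blast
  moreover have "(D - interior D) \<union> interior D = D" using interior_subset by blast
  ultimately have D: "D \<in> sets borel" by simp
  have "cone = {0<..} \<times> D" by (auto simp: tangent_cone_def D_def)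
  also have "\<dots> \<in> sets (borel \<Otimes>\<^sub>M borel)" using D by (intro pair_measureI) auto
  finally show ?thesis unfolding borel_prod .
qed

lemma regular_domain:
  assumes "regular p" "p \<in> domain"
  shows "bexp differentiable (at p)" "area_jacobian G bexp p = \<bar>sn (fst p)\<bar>"
proof -
  obtain t \<theta> where p: "p = (t, \<theta>)" by (cases p)
  obtain z where z: "at_time \<theta> t z" using assms(2) by (auto simp: p billiard_domain_def)
  obtain ws where "set ws \<subseteq> S" "eventually (\<lambda>p. bexp p = orb ws (snd p) (fst p)) (nhds (t, \<theta>))"
    using bexp_local[OF assms(1)[unfolded p] z] by blast
  from jacobian_orb[OF this] show "bexp differentiable (at p)" "area_jacobian G bexp p = \<bar>sn (fst p)\<bar>"
    by (simp_all add: p)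
qed

lemma AE_lebesgue_regular: "AE p in lebesgue. regular p"
  using AE_regular by (rule AE_completion)

lemma ae_differentiable: "ae_differentiable_on bexp domain"
  unfolding ae_differentiable_on_def
  using AE_lebesgue_regular by eventually_elim (simp add: regular_domain(1))

lemma AE_cone:
  assumes "AE p in lebesgue. p \<in> cone \<longrightarrow> Q p" shows "AE p in lebesgue_on cone. Q p"
proof -
  have "cone \<inter> space lebesgue \<in> sets lebesgue"
    using sets_completionI_sets[of cone lborel] cone_borel by simp
  then show ?thesis using assms by (subst AE_restrict_space_iff) auto
qed

lemma pullback_eq:
  "billiard_pullback G P S x e1 e2 =
     density (lebesgue_on cone) (\<lambda>(t, \<theta>). ennreal \<bar>sn t\<bar> * indicator domain (t, \<theta>))"
  unfolding billiard_pullback_def pullback_area_def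
proof (rule density_cong_AE, rule AE_cone)
  show "AE p in lebesgue. p \<in> cone \<longrightarrow> ennreal (area_jacobian G bexp p) * indicator domain p =
      (case p of (t, \<theta>) \<Rightarrow> ennreal \<bar>sn t\<bar> * indicator domain (t, \<theta>))"
    using AE_lebesgue_regular
    by eventually_elim (auto simp: indicator_def regular_domain(2) split: prod.splits)
qed

lemma pullback_eq_full:
  assumes "\<And>ws \<sigma> \<theta> t. set ws \<subseteq> S \<Longrightarrow> \<sigma> \<in> S \<Longrightarrow> t > 0 \<Longrightarrow> orb ws \<theta> t \<in> side_ends G \<sigma> \<Longrightarrow> sn t \<noteq> 0"
  shows "billiard_pullback G P S x e1 e2 = density (lebesgue_on cone) (\<lambda>(t, \<theta>). ennreal \<bar>sn t\<bar>)"
  unfolding pullback_eq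
proof (rule density_cong_AE, rule AE_cone)
  have "countable cornered" by (rule countable_cornered) (rule assms)
  from AE_completion[OF AE_angle[OF this]]
  have "AE p in lebesgue. snd (p :: real \<times> real) \<notin> cornered" .
  moreover note AE_lebesgue_regular
  ultimately show "AE p in lebesgue. p \<in> cone \<longrightarrow>
      (case p of (t, \<theta>) \<Rightarrow> ennreal \<bar>sn t\<bar> * indicator domain (t, \<theta>)) = (case p of (t, \<theta>) \<Rightarrow> ennreal \<bar>sn t\<bar>)"
  proof eventually_elim
    case (elim p)
    obtain t \<theta> where p: "p = (t, \<theta>)" by (cases p)
    have "p \<in> domain" if "p \<in> cone"
      using at_time_exists[of \<theta> t] elim that by (auto simp: p regular_def billiard_domain_def tangent_cone_def)
    then show ?case by (auto simp: p)
  qed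
qed

text \<open>Here \<open>sn\<close> is positive at all positive times, which settles both the
  condition on corners and the absolute value.\<close>

lemma pullback_eq_nonpositive:
  assumes "k \<le> 0"
  shows "billiard_pullback G P S x e1 e2 = density (lebesgue_on cone) (\<lambda>(t, \<theta>). ennreal (sn t))"
proof -
  have "billiard_pullback G P S x e1 e2 = density (lebesgue_on cone) (\<lambda>(t, \<theta>). ennreal \<bar>sn t\<bar>)"
    by (rule pullback_eq_full) (use sn_pos assms in fastforce)
  also have "\<dots> = density (lebesgue_on cone) (\<lambda>(t, \<theta>). ennreal (sn t))"
  proof (rule density_cong_AE, rule AE_cone, rule AE_I2, rule impI)
    fix p assume "p \<in> cone"
    then have "sn (fst p) > 0" using assms by (intro sn_pos) (auto simp: tangent_cone_def)
    then show "(case p of (t, \<theta>) \<Rightarrow> ennreal \<bar>sn t\<bar>) = (case p of (t, \<theta>) \<Rightarrow> ennreal (sn t))"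
      by (simp add: case_prod_unfold)
  qed
  finally show ?thesis .
qed

text \<open>Identifies the exceptional base points on the sphere: a corner met when the geodesics
  refocus has an unfolded copy at \<open>x\<close> or \<open>- x\<close>.\<close>

lemma hit_point_at_sn_zero:
  assumes "set ws \<subseteq> S" "orb ws \<theta> t = z" "sn t = 0"
  shows "unfolding_inv ws z = x \<or> unfolding_inv ws z = - x"
proof -
  have "unfolding_inv ws z = cs t *\<^sub>R x"
    using unfolding_inv_map[of ws "geod G x (dir e1 e2 \<theta>) t"] sides[OF assms(1)] assms(2,3)
    by (auto simp: orb_def geod_eq)
  moreover have "(cs t)\<^sup>2 = 1"
    using cs_sn_pythagoras[of t] assms(3) by (simp add: power2_eq_square)
  then have "cs t = 1 \<or> cs t = -1" by (simp add: power2_eq_1_iff)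
  ultimately show ?thesis by auto
qed

end

section \<open>The three surfaces\<close>

text \<open>Not an interpretation: the simplification rule \<open>sn (- t) = - sn t\<close> would become the looping
  rule \<open>- t = - t\<close>.\<close>

lemma plane_space_form:
  "space_form euclidean_plane 0 (\<lambda>t. 1) (\<lambda>t. t) (\<lambda>y v. vector [- v $ 2, v $ 1])"
proof (rule space_form.intro)
  fix y v w z :: "real ^ 2" and t :: real
  show "bounded_bilinear (metric_form euclidean_plane)"
    by (simp add: euclidean_plane_def bounded_bilinear_inner)
  show "metric_form euclidean_plane y v = metric_form euclidean_plane v y"
    by (simp add: euclidean_plane_def inner_commute)
  show "geod euclidean_plane y v t = 1 *\<^sub>R y + t *\<^sub>R v"
    by (simp add: euclidean_plane_def)
  show "geod euclidean_plane y v t \<in> pts euclidean_plane" by (simp add: euclidean_plane_def)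
  show "metric_form euclidean_plane (y - z) (y - z) = 0 \<Longrightarrow> y = z" by (simp add: euclidean_plane_def)
  assume v: "v \<in> unit_tangent euclidean_plane y"
  then have vv: "v $ 1 * v $ 1 + v $ 2 * v $ 2 = 1"
    by (simp add: unit_tangent_def euclidean_plane_def inner_vec_def sum_2)
  then show "orthonormal_frame euclidean_plane y v (vector [- v $ 2, v $ 1])"
    by (simp add: orthonormal_frame_def unit_tangent_def euclidean_plane_def inner_vec_def sum_2)
  have "w $ i * (v $ 1 * v $ 1 + v $ 2 * v $ 2) = w $ i" for i
    by (simp add: vv)
  from this[of 1] this[of 2] show "w = metric_form euclidean_plane w v *\<^sub>R v +
      metric_form euclidean_plane w (vector [- v $ 2, v $ 1]) *\<^sub>R vector [- v $ 2, v $ 1]"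
    by (simp add: euclidean_plane_def vec_eq_iff forall_2 inner_vec_def sum_2 algebra_simps)
  have "norm v = 1"
    using v by (simp add: unit_tangent_def euclidean_plane_def norm_eq_1)
  then show "norm v \<le> 1 + 2 * norm y" by simp
qed (auto simp: euclidean_plane_def)

text \<open>The sphere (\<open>c = 1\<close>) and the hyperboloid (\<open>c = -1\<close>) are level sets of the quadratic form with
  Gram matrix \<open>diag 1 1 c\<close>.\<close>

definition flip3 :: "real \<Rightarrow> real ^ 3 \<Rightarrow> real ^ 3" where
  "flip3 c u = vector [u $ 1, u $ 2, c * u $ 3]"

lemma flip3_nth: "flip3 c u $ 1 = u $ 1" "flip3 c u $ 2 = u $ 2" "flip3 c u $ 3 = c * u $ 3"
  by (simp_all add: flip3_def)

lemma inner_3: "(u :: real ^ 3) \<bullet> v = u $ 1 * v $ 1 + u $ 2 * v $ 2 + u $ 3 * v $ 3"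
  by (simp add: inner_vec_def sum_3)

lemma cross3_nth:
  "cross3 a b $ 1 = a $ 2 * b $ 3 - a $ 3 * b $ 2"
  "cross3 a b $ 2 = a $ 3 * b $ 1 - a $ 1 * b $ 3"
  "cross3 a b $ 3 = a $ 1 * b $ 2 - a $ 2 * b $ 1"
  by (simp_all add: cross3_def)

text \<open>\<open>n\<close> is the cross product adapted to the form: the flip turns Euclidean
  orthogonality of \<open>cross3 y v\<close> to \<open>y\<close> and \<open>v\<close> into
  orthogonality for the form.\<close>

lemma flip3_frame:
  fixes y v w :: "real ^ 3"
  assumes c: "c * c = 1" and y: "y \<bullet> flip3 c y = c" and v: "v \<bullet> flip3 c v = 1" and yv: "y \<bullet> flip3 c v = 0"
  defines "n \<equiv> flip3 c (cross3 y v)"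
  shows "n \<bullet> flip3 c n = 1" "y \<bullet> flip3 c n = 0" "v \<bullet> flip3 c n = 0"
    "y \<bullet> flip3 c w = 0 \<Longrightarrow> w = (w \<bullet> flip3 c v) *\<^sub>R v + (w \<bullet> flip3 c n) *\<^sub>R n"
proof -
  have cc: "c * (c * q) = q" for q by (simp only: mult.assoc[symmetric] c mult_1)
  have ff: "flip3 c (flip3 c u) = u" for u
    by (simp only: vec_eq_iff forall_3 flip3_nth cc)
  have sym: "a \<bullet> flip3 c b = b \<bullet> flip3 c a" for a b
    by (simp add: inner_3 flip3_nth algebra_simps)
  have fn: "flip3 c n = cross3 y v" unfolding n_def by (rule ff)
  show yn: "y \<bullet> flip3 c n = 0" and vn: "v \<bullet> flip3 c n = 0"
    unfolding fn by (fact dot_cross_self)+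
  \<comment> \<open>The Gram determinant of \<open>y\<close> and \<open>v\<close>, times
    \<open>c\<close>. The last term vanishes for \<open>c * c = 1\<close> and makes this a
    polynomial identity in \<open>c\<close> as well.\<close>
  have "n \<bullet> flip3 c n = c * ((y \<bullet> flip3 c y) * (v \<bullet> flip3 c v) - (y \<bullet> flip3 c v) * (y \<bullet> flip3 c v))
      - (c * c - 1) * ((cross3 y v $ 1)\<^sup>2 + (cross3 y v $ 2)\<^sup>2)"
    unfolding fn unfolding n_def inner_3 flip3_nth cross3_nth power2_eq_square
    by algebra
  then show nn: "n \<bullet> flip3 c n = 1" unfolding y v yv c by (simp add: c)
  assume yw: "y \<bullet> flip3 c w = 0"
  define d where "d = w - (w \<bullet> flip3 c v) *\<^sub>R v - (w \<bullet> flip3 c n) *\<^sub>R n"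
  have flip_lin: "flip3 c (a - r *\<^sub>R b - s *\<^sub>R b') = flip3 c a - r *\<^sub>R flip3 c b - s *\<^sub>R flip3 c b'" for a b b' r s
    by (simp add: vec_eq_iff forall_3 flip3_nth algebra_simps)
  have "y \<bullet> flip3 c d = 0" "v \<bullet> flip3 c d = 0" "n \<bullet> flip3 c d = 0"
    unfolding d_def flip_lin using yw yv yn v vn nn sym[of v w] sym[of n w] sym[of n v]
    by (simp_all add: inner_diff_right)
  then have "flip3 c d = 0"
  proof -
    assume d0: "y \<bullet> flip3 c d = 0" "v \<bullet> flip3 c d = 0" "n \<bullet> flip3 c d = 0"
    \<comment> \<open>Orthogonal to \<open>y\<close> and \<open>v\<close>, the vector
      \<open>flip3 c d\<close> is parallel to their cross product \<open>flip3 c n\<close>;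
      orthogonal also to \<open>n\<close>, it vanishes.\<close>
    have "cross3 (flip3 c d) (cross3 y v) = 0"
      using d0 by (simp add: Lagrange inner_commute)
    then have "cross3 (cross3 y v) (flip3 c d) = 0" by (metis cross_skew neg_0_equal_iff_equal)
    then have "cross3 n (cross3 (cross3 y v) (flip3 c d)) = 0" by (simp only: cross_zero_right)
    then have "(n \<bullet> flip3 c n) *\<^sub>R flip3 c d = 0" using d0(3) by (simp add: Lagrange fn)
    then show ?thesis using nn by simp
  qed
  then have "d = flip3 c 0" by (metis ff)
  then have "d = 0" by (simp add: vec_eq_iff forall_3 flip3_nth)
  then show "w = (w \<bullet> flip3 c v) *\<^sub>R v + (w \<bullet> flip3 c n) *\<^sub>R n"
    by (simp add: d_def algebra_simps)
qed

lemma flip3_1: "flip3 1 u = u" by (simp add: vec_eq_iff forall_3 flip3_nth)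

interpretation sphere: space_form unit_sphere 1 cos sin cross3
proof (rule space_form.intro)
  fix y v w z :: "real ^ 3" and t :: real
  show "bounded_bilinear (metric_form unit_sphere)"
    by (simp add: unit_sphere_def bounded_bilinear_inner)
  show "metric_form unit_sphere y v = metric_form unit_sphere v y"
    by (simp add: unit_sphere_def inner_commute)
  show "metric_form unit_sphere (y - z) (y - z) = 0 \<Longrightarrow> y = z" by (simp add: unit_sphere_def)
  assume y: "y \<in> pts unit_sphere" and v: "v \<in> unit_tangent unit_sphere y"
  then have yv: "y \<bullet> y = 1" "v \<bullet> v = 1" "y \<bullet> v = 0" "v \<bullet> y = 0"
    by (auto simp: unit_tangent_def unit_sphere_def norm_eq_1 inner_commute)
  show "geod unit_sphere y v t \<in> pts unit_sphere"
    using yv by (simp add: unit_sphere_def norm_eq_1 inner_add_left inner_add_right)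
  note f = flip3_frame[of 1 y v, unfolded flip3_1]
  show "orthonormal_frame unit_sphere y v (cross3 y v)"
    using v yv f(1,2,3) by (simp add: orthonormal_frame_def unit_tangent_def unit_sphere_def)
  show "norm v \<le> 1 + 2 * norm y"
    using yv by (simp add: norm_eq_1[symmetric])
  assume "w \<in> tangent unit_sphere y"
  then show "w = metric_form unit_sphere w v *\<^sub>R v + metric_form unit_sphere w (cross3 y v) *\<^sub>R cross3 y v"
    using f(4)[where w = w] yv by (simp add: unit_sphere_def)
qed (auto simp: unit_sphere_def norm_eq_1)

section \<open>Estimates on the hyperboloid\<close>

lemma lorentz_flip3: "lorentz u v = u \<bullet> flip3 (-1) v"
  by (simp add: lorentz_def inner_3 flip3_nth)

lemma plane_cauchy_schwarz:
  "(a * c + b * d)\<^sup>2 \<le> (a\<^sup>2 + b\<^sup>2) * (c\<^sup>2 + d\<^sup>2)" for a b c d :: real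
proof -
  have "(a\<^sup>2 + b\<^sup>2) * (c\<^sup>2 + d\<^sup>2) - (a * c + b * d)\<^sup>2 = (a * d - b * c)\<^sup>2"
    by (simp add: power2_eq_square algebra_simps)
  then show ?thesis by (metis diff_ge_0_iff_ge zero_le_power2)
qed

text \<open>Cauchy-Schwarz for the horizontal components, with their lengths eliminated by the
  equation of the hyperboloid, leaves a square of \<open>y $ 3 - z $ 3\<close> that is at most
  0.\<close>

lemma hyperboloid_definite:
  assumes y: "lorentz y y = -1" and z: "lorentz z z = -1" and yz: "lorentz (y - z) (y - z) = 0"
  shows "y = z"
proof -
  have y': "(y $ 1)\<^sup>2 + (y $ 2)\<^sup>2 = (y $ 3)\<^sup>2 - 1" and z': "(z $ 1)\<^sup>2 + (z $ 2)\<^sup>2 = (z $ 3)\<^sup>2 - 1"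
    using y z by (simp_all add: lorentz_def power2_eq_square)
  have sq: "(y $ 1 - z $ 1)\<^sup>2 + (y $ 2 - z $ 2)\<^sup>2 = (y $ 3 - z $ 3)\<^sup>2"
    using yz by (simp add: lorentz_def power2_eq_square)
  then have "y $ 1 * z $ 1 + y $ 2 * z $ 2 = y $ 3 * z $ 3 - 1"
    using y' z' by (simp add: power2_diff)
  then have "(y $ 3 * z $ 3 - 1)\<^sup>2 \<le> ((y $ 3)\<^sup>2 - 1) * ((z $ 3)\<^sup>2 - 1)"
    using plane_cauchy_schwarz[of "y $ 1" "z $ 1" "y $ 2" "z $ 2"] y' z' by simp
  then have "(y $ 3 - z $ 3)\<^sup>2 \<le> 0"
    by (simp add: power2_eq_square algebra_simps)
  then have "y $ 3 = z $ 3" by simp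
  then have "(y $ 1 - z $ 1)\<^sup>2 + (y $ 2 - z $ 2)\<^sup>2 = 0" using sq by simp
  then have "y $ 1 = z $ 1" "y $ 2 = z $ 2" by (simp_all add: sum_power2_eq_zero_iff)
  then show ?thesis using \<open>y $ 3 = z $ 3\<close> by (simp add: vec_eq_iff forall_3)
qed

text \<open>Cauchy-Schwarz for the horizontal components again. The estimate keeps geodesics on the
  upper sheet and bounds the ambient norm of unit tangent vectors.\<close>

lemma hyperboloid_tangent:
  assumes y: "lorentz y y = -1" and v: "lorentz v v = 1" and yv: "lorentz y v = 0"
  shows "(v $ 3)\<^sup>2 \<le> (y $ 3)\<^sup>2 - 1"
proof -
  have "(y $ 1)\<^sup>2 + (y $ 2)\<^sup>2 = (y $ 3)\<^sup>2 - 1" "(v $ 1)\<^sup>2 + (v $ 2)\<^sup>2 = (v $ 3)\<^sup>2 + 1"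
    "y $ 1 * v $ 1 + y $ 2 * v $ 2 = y $ 3 * v $ 3"
    using assms by (simp_all add: lorentz_def power2_eq_square)
  then have "(y $ 3 * v $ 3)\<^sup>2 \<le> ((y $ 3)\<^sup>2 - 1) * ((v $ 3)\<^sup>2 + 1)"
    using plane_cauchy_schwarz[of "y $ 1" "v $ 1" "y $ 2" "v $ 2"] by simp
  then show ?thesis by (simp add: power_mult_distrib algebra_simps)
qed

interpretation hyperbolic: space_form hyperbolic_plane "-1" cosh sinh "\<lambda>y v. flip3 (-1) (cross3 y v)"
proof (rule space_form.intro)
  fix y v w z :: "real ^ 3" and t :: real
  have "bilinear lorentz"
    by (simp add: bilinear_def linear_iff lorentz_def algebra_simps)
  then show "bounded_bilinear (metric_form hyperbolic_plane)"
    by (simp add: hyperbolic_plane_def bilinear_conv_bounded_bilinear)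
  have sym: "lorentz y v = lorentz v y" for y v by (simp add: lorentz_def)
  then show "metric_form hyperbolic_plane y v = metric_form hyperbolic_plane v y"
    by (simp add: hyperbolic_plane_def)
  assume y: "y \<in> pts hyperbolic_plane"
  then have y': "lorentz y y = -1" "y $ 3 > 0" by (auto simp: hyperbolic_plane_def)
  show "z \<in> pts hyperbolic_plane \<Longrightarrow> metric_form hyperbolic_plane (y - z) (y - z) = 0 \<Longrightarrow> y = z"
    using hyperboloid_definite[of y z] y'(1) by (simp add: hyperbolic_plane_def)
  assume v: "v \<in> unit_tangent hyperbolic_plane y"
  then have v': "lorentz v v = 1" "lorentz y v = 0" "lorentz v y = 0"
    using sym[of y v] by (auto simp: unit_tangent_def hyperbolic_plane_def)
  have v3: "(v $ 3)\<^sup>2 \<le> (y $ 3)\<^sup>2 - 1" by (rule hyperboloid_tangent[OF y'(1) v'(1,2)])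
  show "geod hyperbolic_plane y v t \<in> pts hyperbolic_plane"
  proof -
    have "lorentz (cosh t *\<^sub>R y + sinh t *\<^sub>R v) (cosh t *\<^sub>R y + sinh t *\<^sub>R v) =
        (cosh t)\<^sup>2 * lorentz y y + (sinh t)\<^sup>2 * lorentz v v + 2 * (cosh t * sinh t) * lorentz y v"
      by (simp add: lorentz_def power2_eq_square algebra_simps)
    also have "\<dots> = -1" using cosh_square_eq[of t] by (simp add: y' v')
    finally have 1: "lorentz (cosh t *\<^sub>R y + sinh t *\<^sub>R v) (cosh t *\<^sub>R y + sinh t *\<^sub>R v) = -1" .
    \<comment> \<open>Both factors of the \<open>v\<close> term are dominated by those of the
      \<open>y\<close> term, so the third coordinate stays positive.\<close>
    have "\<bar>sinh t\<bar> < \<bar>cosh t\<bar>"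
      using cosh_square_eq[of t] abs_le_square_iff[of "cosh t" "sinh t"] by linarith
    moreover have "\<bar>v $ 3\<bar> < \<bar>y $ 3\<bar>" using v3 abs_le_square_iff[of "y $ 3" "v $ 3"] by linarith
    ultimately have "\<bar>sinh t * v $ 3\<bar> < \<bar>cosh t\<bar> * \<bar>y $ 3\<bar>"
      unfolding abs_mult by (intro mult_strict_mono') auto
    then have "cosh t * y $ 3 + sinh t * v $ 3 > 0"
      using y'(2) abs_ge_minus_self[of "sinh t * v $ 3"] by (simp add: abs_mult)
    then show ?thesis using 1 by (simp add: hyperbolic_plane_def)
  qed
  have cm: "(- 1) * (- 1) = (1 :: real)" by simp
  note f = flip3_frame[of "-1" y v, folded lorentz_flip3, OF cm y'(1) v'(1,2)]
  show "orthonormal_frame hyperbolic_plane y v (flip3 (- 1) (cross3 y v))"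
    using v f(1,2,3) by (simp add: orthonormal_frame_def unit_tangent_def hyperbolic_plane_def)
  show "norm v \<le> 1 + 2 * norm y"
  proof (rule power2_le_imp_le)
    have "(norm v)\<^sup>2 = 1 + 2 * (v $ 3)\<^sup>2"
      unfolding power2_norm_eq_inner unfolding inner_3 power2_eq_square using v'(1) by (simp add: lorentz_def)
    also have "\<dots> \<le> 2 * (y $ 3)\<^sup>2" using v3 by simp
    also have "\<dots> \<le> 2 * (norm y)\<^sup>2"
      unfolding power2_norm_eq_inner unfolding inner_3 power2_eq_square by simp
    also have "\<dots> \<le> (1 + 2 * norm y)\<^sup>2" by (simp add: power2_eq_square algebra_simps)
    finally show "(norm v)\<^sup>2 \<le> (1 + 2 * norm y)\<^sup>2" .
  qed simp
  assume "w \<in> tangent hyperbolic_plane y"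
  then show "w = metric_form hyperbolic_plane w v *\<^sub>R v +
      metric_form hyperbolic_plane w (flip3 (- 1) (cross3 y v)) *\<^sub>R flip3 (- 1) (cross3 y v)"
    using f(4)[where w = w] by (simp add: hyperbolic_plane_def)
qed (auto simp: hyperbolic_plane_def)

theorem corollary13:
  shows
    "(\<forall>P S x e1 e2.
        geodesic_polygon euclidean_plane P S \<and> connected P \<and> x \<in> P \<and>
        orthonormal_frame euclidean_plane x e1 e2 \<longrightarrow>
        ae_differentiable_on (billiard_exp euclidean_plane P S x e1 e2)
          (billiard_domain euclidean_plane P S x e1 e2) \<and>
        billiard_pullback euclidean_plane P S x e1 e2 =
          density (lebesgue_on (tangent_cone euclidean_plane P x e1 e2))
            (\<lambda>(t, \<theta>). ennreal t)) \<and>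
     (\<forall>P S x e1 e2.
        geodesic_polygon hyperbolic_plane P S \<and> connected P \<and> x \<in> P \<and>
        orthonormal_frame hyperbolic_plane x e1 e2 \<longrightarrow>
        ae_differentiable_on (billiard_exp hyperbolic_plane P S x e1 e2)
          (billiard_domain hyperbolic_plane P S x e1 e2) \<and>
        billiard_pullback hyperbolic_plane P S x e1 e2 =
          density (lebesgue_on (tangent_cone hyperbolic_plane P x e1 e2))
            (\<lambda>(t, \<theta>). ennreal (sinh t))) \<and>
     (\<forall>P S. geodesic_polygon unit_sphere P S \<and> connected P \<longrightarrow>
        (\<forall>x e1 e2. x \<in> P \<and> orthonormal_frame unit_sphere x e1 e2 \<longrightarrow>
           ae_differentiable_on (billiard_exp unit_sphere P S x e1 e2)
             (billiard_domain unit_sphere P S x e1 e2) \<and>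
           billiard_pullback unit_sphere P S x e1 e2 =
             density (lebesgue_on (tangent_cone unit_sphere P x e1 e2))
               (\<lambda>(t, \<theta>). ennreal \<bar>sin t\<bar> * indicator (billiard_domain unit_sphere P S x e1 e2) (t, \<theta>))) \<and>
        (\<exists>N. countable N \<and>
           (\<forall>x e1 e2. x \<in> P - N \<and> orthonormal_frame unit_sphere x e1 e2 \<longrightarrow>
              billiard_pullback unit_sphere P S x e1 e2 =
                density (lebesgue_on (tangent_cone unit_sphere P x e1 e2))
                  (\<lambda>(t, \<theta>). ennreal \<bar>sin t\<bar>))))"
proof (intro conjI allI impI; (elim conjE)?)
  fix P S x e1 e2
  assume "geodesic_polygon euclidean_plane P S" "x \<in> P" "orthonormal_frame euclidean_plane x e1 e2"
  then have table: "billiard_table euclidean_plane 0 (\<lambda>t. 1) (\<lambda>t. t) (\<lambda>y v. vector [- v $ 2, v $ 1]) P S x e1 e2"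
    by (intro billiard_table.intro billiard_table_axioms.intro plane_space_form)
  show "ae_differentiable_on (billiard_exp euclidean_plane P S x e1 e2)
      (billiard_domain euclidean_plane P S x e1 e2)"
    by (rule billiard_table.ae_differentiable[OF table])
  show "billiard_pullback euclidean_plane P S x e1 e2 =
      density (lebesgue_on (tangent_cone euclidean_plane P x e1 e2)) (\<lambda>(t, \<theta>). ennreal t)"
    by (rule billiard_table.pullback_eq_nonpositive[OF table order_refl])
next
  fix P S x e1 e2
  assume "geodesic_polygon hyperbolic_plane P S" "x \<in> P" "orthonormal_frame hyperbolic_plane x e1 e2"
  then interpret billiard_table hyperbolic_plane "-1" cosh sinh "\<lambda>y v. flip3 (-1) (cross3 y v)" P S x e1 e2
    by unfold_locales
  show "ae_differentiable_on (billiard_exp hyperbolic_plane P S x e1 e2)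
      (billiard_domain hyperbolic_plane P S x e1 e2)"
    by (rule ae_differentiable)
  show "billiard_pullback hyperbolic_plane P S x e1 e2 =
      density (lebesgue_on (tangent_cone hyperbolic_plane P x e1 e2)) (\<lambda>(t, \<theta>). ennreal (sinh t))"
    using pullback_eq_nonpositive by simp
next
  fix P S x e1 e2
  assume "geodesic_polygon unit_sphere P S" "x \<in> P" "orthonormal_frame unit_sphere x e1 e2"
  then interpret billiard_table unit_sphere 1 cos sin cross3 P S x e1 e2
    by unfold_locales
  show "ae_differentiable_on (billiard_exp unit_sphere P S x e1 e2)
      (billiard_domain unit_sphere P S x e1 e2)"
    by (rule ae_differentiable)
  show "billiard_pullback unit_sphere P S x e1 e2 =
      density (lebesgue_on (tangent_cone unit_sphere P x e1 e2))
        (\<lambda>(t, \<theta>). ennreal \<bar>sin t\<bar> * indicator (billiard_domain unit_sphere P S x e1 e2) (t, \<theta>))"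
    by (rule pullback_eq)
next
  fix P and S :: "(real ^ 3) side set"
  assume poly: "geodesic_polygon unit_sphere P S"
  \<comment> \<open>All unfolded copies of all corners. The words range independently of
    \<open>x\<close> and the direction, so one countable set serves every base point; its antipodes
    are added because orbits also refocus at \<open>- x\<close>.\<close>
  define Z where "Z = (\<Union>ws\<in>lists S. \<Union>\<sigma>\<in>S. sphere.unfolding_inv ws ` side_ends unit_sphere \<sigma>)"
  have "countable S" using poly by (simp add: geodesic_polygon_def countable_finite)
  moreover have "countable (side_ends unit_sphere \<sigma>)" for \<sigma> by (cases \<sigma>) (simp add: side_ends_def)
  ultimately have "countable Z" unfolding Z_def by (intro countable_UN countable_image countable_lists) auto
  then have "countable (Z \<union> uminus ` Z)" by simp
  moreover have "billiard_pullback unit_sphere P S x e1 e2 =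
      density (lebesgue_on (tangent_cone unit_sphere P x e1 e2)) (\<lambda>(t, \<theta>). ennreal \<bar>sin t\<bar>)"
    if x: "x \<in> P - (Z \<union> uminus ` Z)" and fr: "orthonormal_frame unit_sphere x e1 e2" for x e1 e2
  proof -
    interpret billiard_table unit_sphere 1 cos sin cross3 P S x e1 e2
      by unfold_locales (use poly x fr in auto)
    show ?thesis
    proof (rule pullback_eq_full)
      fix ws \<sigma> \<theta> t
      assume *: "set ws \<subseteq> S" "\<sigma> \<in> S" "orb ws \<theta> t \<in> side_ends unit_sphere \<sigma>"
      show "sin t \<noteq> 0"
      proof
        assume "sin t = 0"
        then have "sphere.unfolding_inv ws (orb ws \<theta> t) = x \<or> sphere.unfolding_inv ws (orb ws \<theta> t) = - x"
          using hit_point_at_sn_zero[OF *(1) refl] by simp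
        moreover have "sphere.unfolding_inv ws (orb ws \<theta> t) \<in> Z"
          using * unfolding Z_def by (auto simp: lists_eq_set)
        ultimately show False using x by (metis DiffD2 UnCI image_eqI minus_minus)
      qed
    qed
  qed
  ultimately show "\<exists>N. countable N \<and> (\<forall>x e1 e2. x \<in> P - N \<and> orthonormal_frame unit_sphere x e1 e2 \<longrightarrow>
      billiard_pullback unit_sphere P S x e1 e2 =
        density (lebesgue_on (tangent_cone unit_sphere P x e1 e2)) (\<lambda>(t, \<theta>). ennreal \<bar>sin t\<bar>))"
    by blast
qed

end
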